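(* For every integer $d\ge 3$, the critical threshold $u_*=u_*(d)$ for percolation of the vacant set of random interlacements on $\mathbb{Z}^d$ satisfies $$\frac{c_g}{L_0}\cdot\frac{1}{\mathcal{C}_2}\cdot 2^{-(d+5)}\;\le\; u_*\;\le\;\frac{5}{2}\,C_g\,\ln(\mathcal{C}_d),$$ where $c_g=c_g(d)$ and $C_g=C_g(d)$ are the best constants in the Green function bounds given in the context, $$\mathcal{C}_k=(13^k-11^k)(25^k-23^k),\qquad k\ge 2,$$ and $$L_0=\begin{cases}\left\lceil \exp\left(48\,\frac{C_g}{c_g}\,\mathcal{C}_2\right)\right\rceil & \text{if } d=3,\\[2mm] \left\lceil \left(48\,\frac{C_g}{c_g}\,\mathcal{C}_2\right)^{\frac{1}{d-3}}\right\rceil & \text{if } d\ge 4.\end{cases}$$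
   Context: Let $d\ge 3$. For $x\in\mathbb{Z}^d$, $|x|$ is the $\ell^\infty$-norm and $P_x$ is the law of simple (nearest-neighbour, discrete-time) random walk $(X_n)_{n\ge 0}$ on $\mathbb{Z}^d$ started at $X_0=x$. The Green function is $g(x,y)=\sum_{n=0}^\infty P_x[X_n=y]$. The constants $0<c_g=c_g(d)$ and $C_g=C_g(d)<\infty$ are the best (largest, respectively smallest) constants such that $c_g(|x-y|\vee 1)^{2-d}\le g(x,y)\le C_g(|x-y|\vee 1)^{2-d}$ for all $x,y\in\mathbb{Z}^d$ (it is a known fact that such positive finite constants exist). For finite $K\subset\mathbb{Z}^d$, the equilibrium measure is $e_K(x)=P_x[X_n\notin K\text{ for all }n\ge 1]$, $x\in K$, and the capacity is $\mathrm{cap}(K)=\sum_{x\in K}e_K(x)$. For $u>0$, the random interlacement $\mathcal{I}^u$ at level $u$ is the random subset of $\mathbb{Z}^d$ whose law (known to exist) is characterized by $\mathbb{P}[\mathcal{I}^u\cap K=\emptyset]=e^{-u\,\mathrm{cap}(K)}$ for all finite $K\subset\mathbb{Z}^d$. The vacant set is $\mathcal{V}^u=\mathbb{Z}^d\setminus\mathcal{I}^u$. Connected components of $\mathcal{V}^u$ are those of the subgraph of the nearest-neighbour lattice $\mathbb{Z}^d$ spanned by $\mathcal{V}^u$. The threshold $u_*=u_*(d)$ is the value such that for every $u>u_*$, almost surely all connected components of $\mathcal{V}^u$ are finite, and for every $0<u<u_*$, almost surely $\mathcal{V}^u$ contains an infinite connected component; that is, $u_*=\inf\{u>0:\mathbb{P}[\mathcal{V}^u\text{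 has an infinite connected component}]=0\}$. *)

theory Defs
  imports "HOL-Probability.Probability"
begin

text \<open>
  The lattice \<open>\<int>\<^sup>d\<close> is the type \<^typ>\<open>int ^ 'd\<close> with \<open>d = CARD('d)\<close>; constants that depend
  on the dimension alone take an argument \<open>TYPE('d)\<close>.
\<close>

definition linf_norm :: "int ^ 'd::finite \<Rightarrow> int" where
  "linf_norm x = Max (range (\<lambda>i. \<bar>x $ i\<bar>))"

definition lattice_adj :: "int ^ 'd::finite \<Rightarrow> int ^ 'd \<Rightarrow> bool" where
  "lattice_adj x y \<longleftrightarrow> (\<Sum>i\<in>UNIV. \<bar>x $ i - y $ i\<bar>) = 1"

definition srw_step :: "(int ^ 'd::finite) pmf" where
  "srw_step = pmf_of_set {e. lattice_adj 0 e}"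

text \<open>The law \<open>P\<^sub>x\<close>, as a measure on trajectories \<open>X :: nat \<Rightarrow> int ^ 'd\<close>.\<close>

definition srw :: "int ^ 'd::finite \<Rightarrow> (nat \<Rightarrow> int ^ 'd) measure" where
  "srw x = distr (PiM UNIV (\<lambda>_. measure_pmf srw_step)) (PiM UNIV (\<lambda>_. count_space UNIV))
             (\<lambda>\<xi> n. x + (\<Sum>k<n. \<xi> k))"

definition green :: "int ^ 'd::finite \<Rightarrow> int ^ 'd \<Rightarrow> real" where
  "green x y = (\<Sum>n. measure (srw x) {X. X n = y})"

definition green_decay :: "int ^ 'd::finite \<Rightarrow> int ^ 'd \<Rightarrow> real" where
  "green_decay x y = real_of_int (max (linf_norm (x - y)) 1) powi (2 - int CARD('d))"

definition c_green :: "'d::finite itself \<Rightarrow> real" where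
  "c_green _ = (GREATEST c. \<forall>x y :: int ^ 'd. c * green_decay x y \<le> green x y)"

definition C_green :: "'d::finite itself \<Rightarrow> real" where
  "C_green _ = (LEAST C. \<forall>x y :: int ^ 'd. green x y \<le> C * green_decay x y)"

definition equilibrium :: "(int ^ 'd::finite) set \<Rightarrow> int ^ 'd \<Rightarrow> real" where
  "equilibrium K x = measure (srw x) {X. \<forall>n\<ge>1. X n \<notin> K}"

definition capacity :: "(int ^ 'd::finite) set \<Rightarrow> real" where
  "capacity K = (\<Sum>x\<in>K. equilibrium K x)"

text \<open>Subsets of the lattice, with the \<open>\<sigma>\<close>-algebra generated by the occupation events.\<close>

definition config_space :: "(int ^ 'd::finite) set measure" where
  "config_space = sigma UNIV (range (\<lambda>x. {I. x \<in> I}))"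

definition is_interlacement_law :: "real \<Rightarrow> (int ^ 'd::finite) set measure \<Rightarrow> bool" where
  "is_interlacement_law u Q \<longleftrightarrow> prob_space Q \<and> sets Q = sets config_space \<and>
     (\<forall>K. finite K \<longrightarrow> measure Q {I. I \<inter> K = {}} = exp (- u * capacity K))"

definition interlacement_law :: "real \<Rightarrow> (int ^ 'd::finite) set measure" where
  "interlacement_law u = (THE Q. is_interlacement_law u Q)"

definition component :: "(int ^ 'd::finite) set \<Rightarrow> int ^ 'd \<Rightarrow> (int ^ 'd) set" where
  "component V x = {y. (\<lambda>a b. a \<in> V \<and> b \<in> V \<and> lattice_adj a b)\<^sup>*\<^sup>* x y}"

definition has_infinite_component :: "(int ^ 'd::finite) set \<Rightarrow> bool" where
  "has_infinite_component V \<longleftrightarrow> (\<exists>x\<in>V. infinite (component V x))"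

text \<open>
  The vacant set is \<open>- I\<close>. The threshold is an extended real so that the infimum is meaningful
  without knowing beforehand that some level is subcritical.
\<close>

definition u_star :: "'d::finite itself \<Rightarrow> ereal" where
  "u_star _ = Inf {ereal u | u. u > 0 \<and>
     measure (interlacement_law u) {I :: (int ^ 'd) set. has_infinite_component (- I)} = 0}"

definition C_comb :: "nat \<Rightarrow> real" where
  "C_comb k = (13 ^ k - 11 ^ k) * (25 ^ k - 23 ^ k)"

definition L0 :: "'d::finite itself \<Rightarrow> int" where
  "L0 T = (let a = 48 * (C_green T / c_green T) * C_comb 2 in
     if CARD('d) = 3 then \<lceil>exp a\<rceil> else \<lceil>a powr (1 / (real CARD('d) - 3))\<rceil>)"

end

theory Submission
  imports Defs
begin

text \<open>
  Upper bound: a connected set that crosses a large annulus contains the \<open>2\<^sup>n\<close> leaves of one of at most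
  \<open>\<C>\<^sub>d\<close> to the power \<open>2\<^sup>n\<close> well spread binary trees. Being spread out, the leaves have capacity at
  least \<open>2\<^sup>n / (9/4 C\<^sub>g)\<close>, so a union bound over the trees beats their number once
  \<open>u > 5/2 C\<^sub>g ln \<C>\<^sub>d\<close>.

  Lower bound: if the vacant set has no infinite component in a coordinate plane, then planar duality
  gives a \<open>*\<close>-connected set in the interlacement crossing a large planar annulus, hence hitting square
  frames of radius \<open>L\<^sub>0\<close> around all leaves of a planar tree. The interlacement restricted to the frames
  is a Poisson union of walk traces, and a walk that hits one frame rarely hits another, because
  \<open>L\<^sub>0\<close> is large; an exponential moment bound on the number of frames hit makes this event too unlikely.

  The constant \<open>C\<^sub>g\<close> is finite because \<open>(|x|\<^sup>2 + a) powr (- (d - 2) / 2)\<close> is superharmonic for the walk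
  when \<open>a\<close> is large. The interlacement law exists by Kolmogorov's theorem: for finite sets
  \<open>K \<subseteq> F\<close>, the capacity of \<open>K\<close> is the mass of the traces on \<open>F\<close> that meet \<open>K\<close>.
\<close>

section \<open>The lattice\<close>

text \<open>Origin of the constants: \<open>C_comb k\<close> counts the choices at one branching of
  a tree in dimension \<open>k\<close>, namely a point on the sphere of radius 6 and one on the
  sphere of radius 12, a sphere of radius r having (2r+1)^k - (2r-1)^k points. With these radii and
  scale ratio 6, siblings stay a fifth of the parent's scale apart, so the Green function summed
  over the other leaves is dominated by a geometric series of ratio 1/3 and sum 5/4. Together with
  the diagonal term this is 9/4, below the 5/2 of the theorem. The obstacle in the lower bound is
  long-range dependence: one trajectory can hit many frames, so hits of different frames are not
  independent. The 48 in \<open>L0\<close> makes the Green function of a frame, seen from itself, at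
  least 4.8 \<open>C_comb 2\<close> times that of all the others. This keeps the moment of base
  \<open>2 * C_comb 2\<close> of the number of frames hit by one walk bounded. The base beats the
  number of trees by a factor 2 per leaf, and at \<open>u\<close> up to 1/256 of
  \<open>c_g / (L\<^sub>0 * C_comb 2)\<close> the capacity of the frames gives back only exp(1/8)
  per leaf.\<close>

definition nbrs :: "(int ^ 'd::finite) set" where
  "nbrs = {e. lattice_adj 0 e}"

lemma lattice_adj_0_iff:
  "lattice_adj 0 (e :: int ^ 'd::finite) \<longleftrightarrow> (\<exists>i. e = axis i 1 \<or> e = axis i (-1))"
proof
  assume "lattice_adj 0 e"
  then have sum1: "(\<Sum>i\<in>UNIV. \<bar>e $ i\<bar>) = 1" by (simp add: lattice_adj_def)
  then obtain i where i: "e $ i \<noteq> 0" by (metis abs_zero sum.neutral zero_neq_one)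
  have eq: "\<bar>e $ i\<bar> + (\<Sum>j\<in>UNIV - {i}. \<bar>e $ j\<bar>) = 1"
    using sum1 by (simp add: sum.remove[of UNIV i])
  have ge: "(\<Sum>j\<in>UNIV - {i}. \<bar>e $ j\<bar>) \<ge> 0" by (rule sum_nonneg) simp
  have ei: "\<bar>e $ i\<bar> = 1" and "(\<Sum>j\<in>UNIV - {i}. \<bar>e $ j\<bar>) = 0"
    using eq ge i by linarith+
  then have "\<forall>j\<in>UNIV - {i}. e $ j = 0"
    by (subst (asm) sum_nonneg_eq_0_iff) auto
  with ei have "e = axis i (e $ i)" "e $ i = 1 \<or> e $ i = -1"
    by (auto simp: vec_eq_iff axis_def)
  then show "\<exists>i. e = axis i 1 \<or> e = axis i (-1)" by metis
next
  assume "\<exists>i. e = axis i 1 \<or> e = axis i (-1)"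
  then obtain i c where "e = axis i c" "\<bar>c\<bar> = 1" by force
  then show "lattice_adj 0 e"
    by (simp add: lattice_adj_def axis_def if_distrib[of abs] cong: if_cong)
qed

lemma nbrs_eq: "nbrs = range (\<lambda>i. axis i 1) \<union> range (\<lambda>i :: 'd::finite. axis i (-1 :: int))"
  by (auto simp: nbrs_def lattice_adj_0_iff)

lemma finite_nbrs [simp, intro]: "finite nbrs"
  by (simp add: nbrs_eq)

lemma sum_nbrs:
  fixes f :: "int ^ 'd::finite \<Rightarrow> 'a::comm_monoid_add"
  shows "(\<Sum>e\<in>nbrs. f e) = (\<Sum>i\<in>UNIV. f (axis i 1) + f (axis i (-1)))"
proof -
  have inj: "inj_on (\<lambda>i. axis i c :: int ^ 'd) UNIV" if "c \<noteq> 0" for c :: int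
    using that by (auto simp: inj_on_def axis_eq_axis)
  have disj: "range (\<lambda>i. axis i 1) \<inter> range (\<lambda>i :: 'd. axis i (-1 :: int)) = {}"
    by (auto simp: axis_eq_axis)
  show ?thesis
    unfolding nbrs_eq using inj disj
    by (subst sum.union_disjoint) (auto simp: sum.reindex sum.distrib)
qed

lemma card_nbrs: "card (nbrs :: (int ^ 'd::finite) set) = 2 * CARD('d)"
  using sum_nbrs[of "\<lambda>_ :: int ^ 'd. 1 :: nat"] by simp

lemma nbrs_nonempty [simp]: "nbrs \<noteq> {}"
  by (simp add: nbrs_eq)

lemma sum_nbrs_uminus:
  fixes f :: "int ^ 'd::finite \<Rightarrow> 'a::comm_monoid_add"
  shows "(\<Sum>e\<in>nbrs. f (- e)) = (\<Sum>e\<in>nbrs. f e)"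
proof -
  have *: "- axis i c = (axis i (- c) :: int ^ 'd)" for i :: 'd and c
    by (auto simp: vec_eq_iff axis_def)
  show ?thesis by (simp add: sum_nbrs * add.commute)
qed

lemma linf_norm_le_iff: "linf_norm x \<le> r \<longleftrightarrow> (\<forall>i. \<bar>x $ i\<bar> \<le> r)"
  by (auto simp: linf_norm_def)

lemma linf_norm_ge_iff: "r \<le> linf_norm x \<longleftrightarrow> (\<exists>i. r \<le> \<bar>x $ i\<bar>)"
  unfolding linf_norm_def by (subst Max_ge_iff) auto

lemma abs_nth_le_linf: "\<bar>x $ i\<bar> \<le> linf_norm x"
  using linf_norm_le_iff by blast

lemma linf_norm_attained: "\<exists>i. \<bar>x $ i\<bar> = linf_norm x"
  using linf_norm_ge_iff[of "linf_norm x" x] abs_nth_le_linf[of x] by (metis order_antisym order_refl)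

lemma linf_norm_nonneg [simp]: "0 \<le> linf_norm x"
  by (meson abs_ge_zero linf_norm_ge_iff)

lemma linf_norm_0 [simp]: "linf_norm 0 = 0"
  by (simp add: linf_norm_def)

lemma linf_norm_eq_0 [simp]: "linf_norm x = 0 \<longleftrightarrow> x = 0"
  using linf_norm_le_iff[of x 0] linf_norm_nonneg[of x] by (force simp: vec_eq_iff)

lemma linf_norm_triangle: "linf_norm (x + y) \<le> linf_norm x + linf_norm y"
proof (subst linf_norm_le_iff, rule allI)
  fix i
  show "\<bar>(x + y) $ i\<bar> \<le> linf_norm x + linf_norm y"
    using abs_nth_le_linf[of x i] abs_nth_le_linf[of y i] by simp
qed

lemma linf_norm_minus [simp]: "linf_norm (- x) = linf_norm x"
  by (simp add: linf_norm_def)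

lemma linf_norm_minus_commute: "linf_norm (x - y) = linf_norm (y - x)"
  by (metis linf_norm_minus minus_diff_eq)

lemma linf_dist_triangle: "linf_norm (x - z) \<le> linf_norm (x - y) + linf_norm (y - z)"
  using linf_norm_triangle[of "x - y" "y - z"] by simp

lemma lattice_adj_linf: "lattice_adj x y \<Longrightarrow> linf_norm (x - y) \<le> 1"
proof -
  assume a: "lattice_adj x y"
  have "\<bar>(x - y) $ i\<bar> \<le> 1" for i
    using a member_le_sum[of i UNIV "\<lambda>i. \<bar>x $ i - y $ i\<bar>"] by (simp add: lattice_adj_def)
  then show ?thesis by (simp add: linf_norm_le_iff)
qed

lemma finite_linf_ball: "finite {x :: int ^ 'd::finite. linf_norm (x - c) \<le> r}"
proof -
  have "finite (vec_lambda ` (\<Pi>\<^sub>E i\<in>(UNIV :: 'd set). {c $ i - r .. c $ i + r}))"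
    by (intro finite_imageI finite_PiE) auto
  moreover have "{x :: int ^ 'd. linf_norm (x - c) \<le> r} \<subseteq> vec_lambda ` (\<Pi>\<^sub>E i\<in>UNIV. {c $ i - r .. c $ i + r})"
  proof
    fix x assume "x \<in> {x :: int ^ 'd. linf_norm (x - c) \<le> r}"
    then have "\<bar>x $ i - c $ i\<bar> \<le> r" for i by (simp add: linf_norm_le_iff)
    then have "x $ i \<in> {c $ i - r .. c $ i + r}" for i
      by (simp add: abs_le_iff) (smt (verit))
    then have "vec_nth x \<in> (\<Pi>\<^sub>E i\<in>UNIV. {c $ i - r .. c $ i + r})"
      by (auto simp: PiE_iff)
    then show "x \<in> vec_lambda ` (\<Pi>\<^sub>E i\<in>UNIV. {c $ i - r .. c $ i + r})"
      by (rule image_eqI[rotated]) (simp add: vec_nth_inverse)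
  qed
  ultimately show ?thesis by (rule finite_subset[rotated])
qed

section \<open>Simple random walk\<close>

abbreviation path_space :: "(nat \<Rightarrow> int ^ 'd::finite) measure" where
  "path_space \<equiv> PiM UNIV (\<lambda>_. count_space UNIV)"

abbreviation steps :: "(nat \<Rightarrow> int ^ 'd::finite) measure" where
  "steps \<equiv> PiM UNIV (\<lambda>_. measure_pmf srw_step)"

interpretation steps: sequence_space "measure_pmf (srw_step :: (int ^ 'd::finite) pmf)"
  by unfold_locales

definition avg :: "(int ^ 'd::finite \<Rightarrow> real) \<Rightarrow> int ^ 'd \<Rightarrow> real" where
  "avg f x = (\<Sum>e\<in>nbrs. f (x + e)) / real (card (nbrs :: (int ^ 'd) set))"

lemma card_nbrs_pos [simp]: "0 < card nbrs"
  by (simp add: card_gt_0_iff)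

lemma avg_mono: "(\<And>y. f y \<le> g y) \<Longrightarrow> avg f x \<le> avg g x"
  by (simp add: avg_def divide_right_mono sum_mono)

lemma avg_const [simp]: "avg (\<lambda>_. c) x = c"
  by (simp add: avg_def)

lemma avg_add: "avg (\<lambda>y. f y + g y) x = avg f x + avg g x"
  by (simp add: avg_def sum.distrib add_divide_distrib)

lemma avg_cmult: "avg (\<lambda>y. c * f y) x = c * avg f x"
  by (simp add: avg_def sum_distrib_left)

lemma avg_sum: "avg (\<lambda>y. \<Sum>i\<in>I. f i y) x = (\<Sum>i\<in>I. avg (f i) x)"
  unfolding avg_def by (subst sum.swap) (simp add: sum_divide_distrib)

lemma space_path_space [simp]: "space path_space = UNIV"
  by (simp add: space_PiM)

lemma path_component_measurable [measurable]: "(\<lambda>X. X n) \<in> measurable path_space (count_space UNIV)"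
  by (rule measurable_component_singleton) simp

lemma walk_path_measurable [measurable]:
  "(\<lambda>\<xi> n. x + (\<Sum>k<n. \<xi> k)) \<in> measurable steps (path_space :: (nat \<Rightarrow> int ^ 'd::finite) measure)"
proof (rule measurable_PiM_single')
  fix n :: nat
  have comp: "(\<lambda>\<xi>. \<xi> k) \<in> measurable steps (count_space (UNIV :: (int ^ 'd) set))" for k :: nat
    using measurable_component_singleton[of k UNIV "\<lambda>_. measure_pmf (srw_step :: (int ^ 'd) pmf)"]
    by (simp cong: measurable_cong_sets)
  show "(\<lambda>\<xi>. x + (\<Sum>k<n. \<xi> k)) \<in> measurable steps (count_space (UNIV :: (int ^ 'd) set))"
  proof (induction n)
    case (Suc n)
    have "(\<lambda>\<xi>. (\<lambda>s \<xi>. s + \<xi> n) (x + (\<Sum>k<n. \<xi> k)) \<xi>) \<in> measurable steps (count_space (UNIV :: (int ^ 'd) set))"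
      by (rule measurable_compose_countable[OF _ Suc]) (rule measurable_compose[OF comp], simp)
    then show ?case by (simp add: add.assoc)
  qed simp
qed auto

lemma sets_srw [simp, measurable_cong]: "sets (srw x) = sets path_space"
  by (simp add: srw_def)

lemma space_srw [simp]: "space (srw x) = UNIV"
  by (simp add: srw_def)

lemma prob_space_srw: "prob_space (srw x)"
  unfolding srw_def by (rule steps.P.prob_space_distr) measurable

interpretation srw: prob_space "srw x" for x :: "int ^ 'd::finite"
  by (rule prob_space_srw)

lemma case_nat_path_measurable [measurable]:
  "(\<lambda>X. case_nat x X) \<in> measurable path_space (path_space :: (nat \<Rightarrow> int ^ 'd::finite) measure)"
proof (rule measurable_PiM_single')
  fix i
  show "(\<lambda>X. case i of 0 \<Rightarrow> x | Suc k \<Rightarrow> X k) \<in> measurable path_space (count_space UNIV)"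
    by (cases i) auto
qed auto

text \<open>Markov property at time 1. The product measure of the steps is split at its zeroth
  coordinate; what remains is a fresh walk from \<open>x + e\<close>, preceded by \<open>x\<close>.
  Later inductions on time all go through this identity.\<close>

lemma nn_integral_srw_step:
  fixes f :: "(nat \<Rightarrow> int ^ 'd::finite) \<Rightarrow> ennreal"
  assumes f [measurable]: "f \<in> borel_measurable path_space"
  shows "(\<integral>\<^sup>+X. f X \<partial>srw x) = (\<Sum>e\<in>nbrs. \<integral>\<^sup>+X. f (case_nat x X) \<partial>srw (x + e)) / card (nbrs :: (int ^ 'd) set)"
proof -
  let ?W = "\<lambda>(x :: int ^ 'd) (\<xi> :: nat \<Rightarrow> int ^ 'd) n. x + (\<Sum>k<n. \<xi> k)"
  have W: "?W x (case_nat e \<xi>) = case_nat x (?W (x + e) \<xi>)" for e \<xi>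
  proof
    fix n show "?W x (case_nat e \<xi>) n = case_nat x (?W (x + e) \<xi>) n"
      by (cases n) (simp_all add: sum.lessThan_Suc_shift add.assoc del: sum.lessThan_Suc)
  qed
  have "(\<integral>\<^sup>+X. f X \<partial>srw x) = (\<integral>\<^sup>+\<xi>. f (?W x \<xi>) \<partial>steps)"
    unfolding srw_def by (rule nn_integral_distr) measurable
  also have "\<dots> = (\<integral>\<^sup>+\<xi>. f (?W x \<xi>) \<partial>distr (measure_pmf srw_step \<Otimes>\<^sub>M steps) steps (\<lambda>(s, \<omega>). case_nat s \<omega>))"
    by (simp only: steps.PiM_iter)
  also have "\<dots> = (\<integral>\<^sup>+p. f (?W x (case p of (s, \<omega>) \<Rightarrow> case_nat s \<omega>)) \<partial>(measure_pmf srw_step \<Otimes>\<^sub>M steps))"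
    by (rule nn_integral_distr) measurable
  also have "\<dots> = (\<integral>\<^sup>+e. \<integral>\<^sup>+\<xi>. f (?W x (case_nat e \<xi>)) \<partial>steps \<partial>srw_step)"
  proof -
    have "(\<lambda>p. f (?W x (case p of (s, \<omega>) \<Rightarrow> case_nat s \<omega>))) \<in> borel_measurable (measure_pmf srw_step \<Otimes>\<^sub>M steps)"
      by (rule measurable_compose[OF _ f], rule measurable_compose[OF _ walk_path_measurable]) measurable
    from steps.P.nn_integral_fst[OF this] show ?thesis by simp
  qed
  also have "\<dots> = (\<integral>\<^sup>+e. \<integral>\<^sup>+X. f (case_nat x X) \<partial>srw (x + e) \<partial>srw_step)"
  proof (rule nn_integral_cong)
    fix e
    show "(\<integral>\<^sup>+\<xi>. f (?W x (case_nat e \<xi>)) \<partial>steps) = (\<integral>\<^sup>+X. f (case_nat x X) \<partial>srw (x + e))"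
      unfolding W srw_def by (rule nn_integral_distr[symmetric]) measurable
  qed
  also have "\<dots> = (\<Sum>e\<in>nbrs. \<integral>\<^sup>+X. f (case_nat x X) \<partial>srw (x + e)) / card (nbrs :: (int ^ 'd) set)"
    unfolding srw_step_def nbrs_def[symmetric] by (rule nn_integral_pmf_of_set) auto
  finally show ?thesis .
qed

lemma measure_srw_step:
  fixes x :: "int ^ 'd::finite"
  assumes A [measurable]: "A \<in> sets path_space"
  shows "measure (srw x) A = avg (\<lambda>y. measure (srw y) {X. case_nat x X \<in> A}) x"
proof -
  let ?N = "nbrs :: (int ^ 'd) set"
  have m: "{X. case_nat x X \<in> A} \<in> sets path_space"
    using measurable_sets[OF case_nat_path_measurable A, of x] by (simp add: vimage_def)
  have eq: "(\<integral>\<^sup>+X. indicator A (case_nat x X) \<partial>srw y) = ennreal (measure (srw y) {X. case_nat x X \<in> A})" for y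
  proof -
    have "(\<integral>\<^sup>+X. indicator A (case_nat x X) \<partial>srw y) = (\<integral>\<^sup>+X. indicator {X. case_nat x X \<in> A} X \<partial>srw y)"
      by (rule nn_integral_cong) (auto simp: indicator_def)
    also have "\<dots> = emeasure (srw y) {X. case_nat x X \<in> A}"
      using m by (subst nn_integral_indicator) auto
    finally show ?thesis by (simp add: srw.emeasure_eq_measure)
  qed
  have "ennreal (measure (srw x) A) = (\<integral>\<^sup>+X. indicator A X \<partial>srw x)"
    using A by (simp add: srw.emeasure_eq_measure)
  also have "\<dots> = (\<Sum>e\<in>?N. ennreal (measure (srw (x + e)) {X. case_nat x X \<in> A})) / card ?N"
    by (subst nn_integral_srw_step) (measurable, simp add: eq)
  also have "\<dots> = ennreal (avg (\<lambda>y. measure (srw y) {X. case_nat x X \<in> A}) x)"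
    unfolding avg_def by (simp add: sum_nonneg divide_ennreal[symmetric] card_gt_0_iff flip: ennreal_of_nat_eq_real_of_nat)
  finally show ?thesis
    by (simp add: avg_def sum_nonneg)
qed

section \<open>Transition probabilities and the Markov property at a fixed time\<close>

definition heat_kernel :: "nat \<Rightarrow> int ^ 'd::finite \<Rightarrow> int ^ 'd \<Rightarrow> real" where
  "heat_kernel n x y = measure (srw x) {X. X n = y}"

lemma path_setI: "Measurable.pred path_space P \<Longrightarrow> {X. P X} \<in> sets path_space"
  by (simp add: pred_def)

lemma srw_start: "AE X in srw x. X 0 = x"
proof -
  have "{X \<in> space path_space. X 0 = x} \<in> sets path_space"
    by measurable
  then show ?thesis
    unfolding srw_def by (subst AE_distr_iff[OF walk_path_measurable]) simp_all
qed

lemma heat_kernel_nonneg [simp]: "0 \<le> heat_kernel n x y"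
  by (simp add: heat_kernel_def)

lemma heat_kernel_0: "heat_kernel 0 x y = (if x = y then 1 else 0)"
proof -
  have "heat_kernel 0 x y = measure (srw x) {X. x = y}"
    unfolding heat_kernel_def
  proof (rule srw.finite_measure_eq_AE)
    show "AE X in srw x. (X \<in> {X. X 0 = y}) = (X \<in> {X. x = y})"
      using srw_start[of x] by auto
  qed (unfold sets_srw, (rule path_setI, measurable)+)
  then show ?thesis
    using srw.prob_space[of x] by auto
qed

lemma heat_kernel_Suc: "heat_kernel (Suc n) x y = avg (\<lambda>z. heat_kernel n z y) x"
  unfolding heat_kernel_def by (subst measure_srw_step, rule path_setI) simp_all

lemma green_heat_kernel: "green x y = (\<Sum>n. heat_kernel n x y)"
  by (simp add: green_def heat_kernel_def)

lemma heat_kernel_translate: "heat_kernel n (x + c) (y + c) = heat_kernel n x y"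
proof (induction n arbitrary: x)
  case (Suc n)
  have "heat_kernel n (x + c + e) (y + c) = heat_kernel n (x + e) y" for e
    using Suc[of "x + e"] by (simp add: add.assoc add.commute add.left_commute)
  then show ?case by (simp add: heat_kernel_Suc avg_def)
qed (simp add: heat_kernel_0)

lemma heat_kernel_reflect: "heat_kernel n (- x) (- y) = heat_kernel n x y"
proof (induction n arbitrary: x)
  case (Suc n)
  have "heat_kernel n (- x + - e) (- y) = heat_kernel n (x + e) y" for e
    using Suc[of "x + e"] by simp
  then show ?case
    unfolding heat_kernel_Suc avg_def
    using sum_nbrs_uminus[of "\<lambda>e. heat_kernel n (- x + e) (- y)"] by simp
qed (simp add: heat_kernel_0)

text \<open>Reflection in the midpoint of \<open>x\<close> and \<open>y\<close>, written as the
  reflection at 0 followed by the translation by \<open>x + y\<close>.\<close>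

lemma heat_kernel_sym: "heat_kernel n x y = heat_kernel n y x"
  using heat_kernel_translate[of n "- x" "x + y" "- y"] heat_kernel_reflect[of n x y] by simp

lemma green_sym: "green x y = green y x"
  by (simp add: green_heat_kernel heat_kernel_sym)

lemma shift_path_measurable [measurable]:
  "(\<lambda>X j. X (n + j)) \<in> measurable path_space (path_space :: (nat \<Rightarrow> int ^ 'd::finite) measure)"
  by (rule measurable_PiM_single') auto

lemma markov_property:
  assumes B [measurable]: "B \<in> sets path_space"
  shows "measure (srw x) {X. X n = z \<and> (\<lambda>j. X (n + j)) \<in> B} = heat_kernel n x z * measure (srw z) B"
proof (induction n arbitrary: x)
  case 0
  have "measure (srw x) {X. X 0 = z \<and> (\<lambda>j. X (0 + j)) \<in> B} = measure (srw x) {X. x = z \<and> X \<in> B}"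
  proof (rule srw.finite_measure_eq_AE)
    show "AE X in srw x. (X \<in> {X. X 0 = z \<and> (\<lambda>j. X (0 + j)) \<in> B}) = (X \<in> {X. x = z \<and> X \<in> B})"
      using srw_start[of x] by auto
  qed (unfold sets_srw, (rule path_setI, measurable)+)
  then show ?case by (simp add: heat_kernel_0)
next
  case (Suc n)
  have "{X. X (Suc n) = z \<and> (\<lambda>j. X (Suc n + j)) \<in> B} \<in> sets path_space"
    by (rule path_setI) measurable
  then have "measure (srw x) {X. X (Suc n) = z \<and> (\<lambda>j. X (Suc n + j)) \<in> B}
      = avg (\<lambda>y. measure (srw y) {X. X n = z \<and> (\<lambda>j. X (n + j)) \<in> B}) x"
    by (subst measure_srw_step) simp_all
  then show ?case
    by (simp add: Suc heat_kernel_Suc avg_def sum_distrib_right)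
qed

section \<open>The Green function\<close>

text \<open>\<open>h / \<delta>\<close> dominates the expected number of visits to \<open>y\<close>
  before time \<open>N\<close>: superharmonicity carries the bound through a step, and the deficit
  \<open>\<delta>\<close> at \<open>y\<close> pays for the visit at time 0. Partial sums are bounded
  because summability is deduced from them.\<close>

lemma sum_heat_kernel_le_supersolution:
  assumes nonneg: "\<And>x. 0 \<le> h x" and super: "\<And>x. avg h x \<le> h x"
    and \<delta>: "0 < \<delta>" "avg h y + \<delta> \<le> h y"
  shows "(\<Sum>n<N. heat_kernel n x y) \<le> h x / \<delta>"
proof (induction N arbitrary: x)
  case 0
  then show ?case using nonneg \<delta> by simp
next
  case (Suc N)
  have "(\<Sum>n<Suc N. heat_kernel n x y) = heat_kernel 0 x y + avg (\<lambda>z. \<Sum>n<N. heat_kernel n z y) x"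
    by (simp add: sum.lessThan_Suc_shift heat_kernel_Suc avg_sum del: sum.lessThan_Suc)
  also have "\<dots> \<le> heat_kernel 0 x y + avg (\<lambda>z. (1 / \<delta>) * h z) x"
    using Suc by (intro add_left_mono avg_mono) simp
  also have "\<dots> = heat_kernel 0 x y + avg h x / \<delta>"
    by (simp only: avg_cmult) simp
  also have "\<dots> \<le> h x / \<delta>"
  proof -
    have "(avg h x + (if x = y then \<delta> else 0)) / \<delta> \<le> h x / \<delta>"
      using super[of x] \<delta> by (intro divide_right_mono) auto
    then show ?thesis using \<delta> by (simp add: heat_kernel_0 add_divide_distrib split: if_splits)
  qed
  finally show ?case .
qed

text \<open>Taylor expansion to fourth order at 0: the odd terms cancel between \<open>z\<close> and
  \<open>- z\<close>, and the fourth derivative is bounded for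
  \<open>\<bar>z\<bar> \<le> 1/2\<close>.\<close>

lemma powr_neg_symmetric_bound:
  fixes \<alpha> :: real
  assumes "0 < \<alpha>"
  obtains C where "0 \<le> C"
    "\<And>z. \<bar>z\<bar> \<le> 1/2 \<Longrightarrow> (1 + z) powr (-\<alpha>) + (1 - z) powr (-\<alpha>) \<le> 2 + \<alpha> * (\<alpha> + 1) * z\<^sup>2 + C * z ^ 4"
proof -
  \<comment> \<open>\<open>D m\<close> is the \<open>m\<close>-th derivative of
    \<open>(1 + t) powr (-\<alpha>)\<close> in \<open>t\<close>.\<close>
  define D where "D m t = (-1) ^ m * pochhammer \<alpha> m * (1 + t) powr (-\<alpha> - real m)" for m and t :: real
  define C1 where "C1 = pochhammer \<alpha> 4 / 24 * (1/2) powr (-\<alpha> - 4)"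
  have D_deriv: "DERIV (D m) t :> D (Suc m) t" if "\<bar>t\<bar> \<le> 1/2" for m t
  proof -
    have "1 + t > 0" using that by linarith
    then have "DERIV (D m) t :> (-1) ^ m * pochhammer \<alpha> m * ((-\<alpha> - real m) * (1 + t) powr (-\<alpha> - real m - 1))"
      unfolding D_def by (auto intro!: derivative_eq_intros)
    moreover have "-\<alpha> - real m - 1 = -\<alpha> - real (Suc m)" by simp
    ultimately show ?thesis
      unfolding D_def by (simp add: pochhammer_Suc algebra_simps)
  qed
  have poch: "0 \<le> pochhammer \<alpha> 4"
    using assms by (simp add: pochhammer_nonneg)
  have taylor: "(1 + z) powr (-\<alpha>) \<le> 1 - \<alpha> * z + \<alpha> * (\<alpha> + 1) / 2 * z\<^sup>2
      - \<alpha> * (\<alpha> + 1) * (\<alpha> + 2) / 6 * z ^ 3 + C1 * z ^ 4" if z: "\<bar>z\<bar> \<le> 1/2" for z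
  proof -
    have "\<exists>t. \<bar>t\<bar> \<le> \<bar>z\<bar> \<and> (1 + z) powr (-\<alpha>) = (\<Sum>m<4. D m 0 / fact m * z ^ m) + D 4 t / fact 4 * z ^ 4"
    proof (rule Maclaurin_bi_le)
      show "\<forall>m t. m < 4 \<and> \<bar>t\<bar> \<le> \<bar>z\<bar> \<longrightarrow> DERIV (D m) t :> D (Suc m) t"
        using z D_deriv by force
    qed (simp add: D_def)
    then obtain t where t: "\<bar>t\<bar> \<le> 1/2"
      and eq: "(1 + z) powr (-\<alpha>) = (\<Sum>m<4. D m 0 / fact m * z ^ m) + D 4 t / fact 4 * z ^ 4"
      using z by (meson order_trans)
    have "(1 + t) powr (-\<alpha> - 4) \<le> (1/2) powr (-\<alpha> - 4)"
      using t assms by (intro powr_mono2') linarith+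
    then have "D 4 t / 24 \<le> C1"
      unfolding D_def C1_def using poch by (simp add: mult_left_mono)
    then have "D 4 t / 24 * z ^ 4 \<le> C1 * z ^ 4"
      by (intro mult_right_mono) auto
    moreover have "(\<Sum>m<4. D m 0 / fact m * z ^ m) = 1 - \<alpha> * z + \<alpha> * (\<alpha> + 1) / 2 * z\<^sup>2
      - \<alpha> * (\<alpha> + 1) * (\<alpha> + 2) / 6 * z ^ 3"
      by (simp add: D_def eval_nat_numeral pochhammer_Suc field_simps)
    moreover have "(fact 4 :: real) = 24" by (simp add: eval_nat_numeral)
    ultimately show ?thesis using eq by simp
  qed
  show ?thesis
  proof (rule that[of "2 * C1"])
    show "0 \<le> 2 * C1" unfolding C1_def using poch by simp
    fix z :: real assume z: "\<bar>z\<bar> \<le> 1/2"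
    then show "(1 + z) powr (-\<alpha>) + (1 - z) powr (-\<alpha>) \<le> 2 + \<alpha> * (\<alpha> + 1) * z\<^sup>2 + 2 * C1 * z ^ 4"
      using taylor[of z] taylor[of "-z"] by (simp add: field_simps)
  qed
qed

text \<open>Bernoulli's inequality for a negative exponent. With \<open>w = 1 / t\<close> it leads
  back from the expansion point \<open>sqnorm x + a + 1\<close> to the value at
  \<open>sqnorm x + a\<close>.\<close>

lemma powr_neg_bernoulli:
  fixes \<alpha> w :: real
  assumes "0 \<le> \<alpha>" "w < 1"
  shows "1 + \<alpha> * w \<le> (1 - w) powr (-\<alpha>)"
proof -
  have "ln (1 - w) \<le> - w" using ln_le_minus_one[of "1 - w"] assms by simp
  then have "\<alpha> * ln (1 - w) \<le> \<alpha> * (- w)" using assms by (intro mult_left_mono)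
  then have "1 + \<alpha> * w \<le> 1 + (- \<alpha> * ln (1 - w))" by simp
  also have "\<dots> \<le> exp (- \<alpha> * ln (1 - w))" by (rule exp_ge_add_one_self)
  also have "\<dots> = (1 - w) powr (-\<alpha>)" using assms by (simp add: powr_def)
  finally show ?thesis .
qed

definition sqnorm :: "int ^ 'd::finite \<Rightarrow> real" where
  "sqnorm x = (\<Sum>i\<in>UNIV. (real_of_int (x $ i))\<^sup>2)"

lemma sqnorm_nonneg: "0 \<le> sqnorm x"
  by (simp add: sqnorm_def sum_nonneg)

lemma sqnorm_add_axis: "sqnorm (x + axis i c) = sqnorm x + 2 * real_of_int c * real_of_int (x $ i) + (real_of_int c)\<^sup>2"
proof -
  have "sqnorm (x + axis i c) = (\<Sum>j\<in>UNIV. (real_of_int (x $ j))\<^sup>2 + (if j = i then 2 * real_of_int c * real_of_int (x $ i) + (real_of_int c)\<^sup>2 else 0))"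
    unfolding sqnorm_def by (rule sum.cong) (auto simp: axis_def power2_eq_square algebra_simps)
  then show ?thesis by (simp add: sum.distrib sqnorm_def)
qed

lemma nth_sq_le_sqnorm: "(real_of_int (x $ i))\<^sup>2 \<le> sqnorm x"
  unfolding sqnorm_def by (rule member_le_sum) auto

lemma sum_fourth_le_sqnorm: "(\<Sum>i\<in>UNIV. (real_of_int (x $ i)) ^ 4) \<le> (sqnorm x)\<^sup>2"
proof -
  have "(\<Sum>i\<in>UNIV. (real_of_int (x $ i)) ^ 4) = (\<Sum>i\<in>UNIV. (real_of_int (x $ i))\<^sup>2 * (real_of_int (x $ i))\<^sup>2)"
    by (simp flip: power_add)
  also have "\<dots> \<le> (\<Sum>i\<in>UNIV. (real_of_int (x $ i))\<^sup>2 * sqnorm x)"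
    by (intro sum_mono mult_left_mono nth_sq_le_sqnorm) auto
  also have "\<dots> = (sqnorm x)\<^sup>2"
    by (simp add: sqnorm_def sum_distrib_right power2_eq_square)
  finally show ?thesis .
qed

lemma linf_sq_le_sqnorm: "(real_of_int (linf_norm x))\<^sup>2 \<le> sqnorm x"
proof -
  obtain i where "\<bar>x $ i\<bar> = linf_norm x" using linf_norm_attained by blast
  then have "real_of_int (linf_norm x) = \<bar>real_of_int (x $ i)\<bar>" by simp
  then show ?thesis using nth_sq_le_sqnorm[of x i] by simp
qed

text \<open>
  The continuous Laplacian of \<open>(r\<^sup>2 + a) powr (- (d - 2) / 2)\<close> is
  \<open>- d (d - 2) a (r\<^sup>2 + a) powr (- (d + 2) / 2)\<close>, and the discretisation error has the same order
  with a constant that does not depend on \<open>a\<close>.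
\<close>

lemma radial_superharmonic:
  assumes d: "CARD('d::finite) \<ge> 3"
  defines "\<alpha> \<equiv> (real CARD('d) - 2) / 2"
  obtains a where "4 \<le> a"
    "\<And>x :: int ^ 'd. avg (\<lambda>x. (sqnorm x + a) powr (-\<alpha>)) x \<le> (sqnorm x + a) powr (-\<alpha>)"
proof -
  have \<alpha>: "0 < \<alpha>" "2 * (\<alpha> + 1) = real CARD('d)" using d by (auto simp: \<alpha>_def field_simps)
  obtain C where C: "0 \<le> C" "\<And>z. \<bar>z\<bar> \<le> 1/2 \<Longrightarrow>
      (1 + z) powr (-\<alpha>) + (1 - z) powr (-\<alpha>) \<le> 2 + \<alpha> * (\<alpha> + 1) * z\<^sup>2 + C * z ^ 4"
    using powr_neg_symmetric_bound[OF \<alpha>(1)] by blast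
  \<comment> \<open>Large enough that the gain from \<open>a\<close> in the second-order term
    absorbs the fourth-order error (\<open>aC\<close>). The summand 4 ensures that the expansion
    variables are at most 1/2 in absolute value.\<close>
  define a where "a = 4 + 4 * C / (\<alpha> * (\<alpha> + 1))"
  have a: "4 \<le> a" using C \<alpha> by (simp add: a_def)
  have aC: "16 * C \<le> 4 * \<alpha> * (\<alpha> + 1) * (a + 1)"
  proof -
    define b where "b = \<alpha> * (\<alpha> + 1)"
    have "0 < b" using \<alpha> by (simp add: b_def)
    then have "16 * C \<le> 4 * b * (4 + 4 * C / b + 1)" by (simp add: field_simps)
    then show ?thesis by (simp add: a_def b_def mult.assoc)
  qed
  show ?thesis
  proof (rule that[OF a])
    fix x :: "int ^ 'd"
    \<comment> \<open>The expansion is centred at \<open>t\<close>, because the two neighbours in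
      direction \<open>i\<close> have \<open>sqnorm + a\<close> equal to
      \<open>t * (1 + z i)\<close> and \<open>t * (1 - z i)\<close> exactly.\<close>
    define t where "t = sqnorm x + a + 1"
    define z where "z i = 2 * real_of_int (x $ i) / t" for i
    have t: "5 \<le> t" using a sqnorm_nonneg[of x] by (simp add: t_def)
    have z: "\<bar>z i\<bar> \<le> 1/2" for i
    proof -
      have "4 * \<bar>real_of_int (x $ i)\<bar> \<le> (real_of_int (x $ i))\<^sup>2 + 4"
        using zero_le_power2[of "\<bar>real_of_int (x $ i)\<bar> - 2"] by (simp add: power2_eq_square algebra_simps)
      also have "\<dots> \<le> t" using nth_sq_le_sqnorm[of x i] a by (simp add: t_def)
      finally show ?thesis using t by (simp add: z_def abs_mult field_simps)
    qed
    have pair: "(sqnorm (x + axis i 1) + a) powr (-\<alpha>) + (sqnorm (x + axis i (-1)) + a) powr (-\<alpha>)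
        \<le> t powr (-\<alpha>) * (2 + \<alpha> * (\<alpha> + 1) * (z i)\<^sup>2 + C * (z i) ^ 4)" for i
    proof -
      have "sqnorm (x + axis i 1) + a = t * (1 + z i)" "sqnorm (x + axis i (-1)) + a = t * (1 - z i)"
        using t by (simp_all add: sqnorm_add_axis t_def z_def field_simps)
      moreover have "0 \<le> 1 + z i" "0 \<le> 1 - z i" using z[of i] by linarith+
      ultimately have "(sqnorm (x + axis i 1) + a) powr (-\<alpha>) + (sqnorm (x + axis i (-1)) + a) powr (-\<alpha>)
          = t powr (-\<alpha>) * ((1 + z i) powr (-\<alpha>) + (1 - z i) powr (-\<alpha>))"
        using t by (simp add: powr_mult distrib_left[of "t powr (-\<alpha>)"])
      then show ?thesis using C(2)[OF z[of i]] by (simp add: mult_left_mono)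
    qed
    have z2: "(\<Sum>i\<in>UNIV. (z i)\<^sup>2) = 4 * (t - 1 - a) / t\<^sup>2"
      by (simp add: z_def power_divide power_mult_distrib t_def sqnorm_def sum_distrib_left flip: sum_divide_distrib)
    have z4: "(\<Sum>i\<in>UNIV. (z i) ^ 4) \<le> 16 / t\<^sup>2"
    proof -
      have "(\<Sum>i\<in>UNIV. (z i) ^ 4) = 16 * (\<Sum>i\<in>UNIV. (real_of_int (x $ i)) ^ 4) / t ^ 4"
        by (simp add: z_def power_divide power_mult_distrib sum_distrib_left flip: sum_divide_distrib)
      also have "\<dots> \<le> 16 * t\<^sup>2 / t ^ 4"
      proof -
        have "(sqnorm x)\<^sup>2 \<le> t\<^sup>2" using a sqnorm_nonneg[of x] by (intro power_mono) (auto simp: t_def)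
        then show ?thesis using sum_fourth_le_sqnorm[of x] t
          by (intro divide_right_mono mult_left_mono) auto
      qed
      also have "\<dots> = 16 / t\<^sup>2" using t by (simp add: field_simps eval_nat_numeral)
      finally show ?thesis .
    qed
    have "(\<Sum>e\<in>nbrs. (sqnorm (x + e) + a) powr (-\<alpha>))
        \<le> (\<Sum>i\<in>UNIV. t powr (-\<alpha>) * (2 + \<alpha> * (\<alpha> + 1) * (z i)\<^sup>2 + C * (z i) ^ 4))"
      unfolding sum_nbrs by (intro sum_mono pair)
    also have "\<dots> = t powr (-\<alpha>) * (2 * real CARD('d) + \<alpha> * (\<alpha> + 1) * (\<Sum>i\<in>UNIV. (z i)\<^sup>2) + C * (\<Sum>i\<in>UNIV. (z i) ^ 4))"
      by (simp add: sum.distrib flip: sum_distrib_left)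
    also have "\<dots> \<le> t powr (-\<alpha>) * (2 * real CARD('d) + \<alpha> * (\<alpha> + 1) * (4 * (t - 1 - a) / t\<^sup>2) + C * (16 / t\<^sup>2))"
      unfolding z2 by (intro mult_left_mono add_left_mono z4 C) auto
    also have "\<dots> \<le> t powr (-\<alpha>) * (2 * real CARD('d) * (1 + \<alpha> * (1 / t)))"
    proof (intro mult_left_mono)
      have "\<alpha> * (\<alpha> + 1) * (4 * (t - 1 - a) / t\<^sup>2) + C * (16 / t\<^sup>2)
          = (\<alpha> * (\<alpha> + 1) * 4 * t + (16 * C - 4 * \<alpha> * (\<alpha> + 1) * (a + 1))) / t\<^sup>2"
        using t by (simp add: field_simps)
      also have "\<dots> \<le> (\<alpha> * (\<alpha> + 1) * 4 * t) / t\<^sup>2"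
        using aC by (intro divide_right_mono) auto
      also have "\<dots> = 2 * \<alpha> * (2 * (\<alpha> + 1)) / t"
        using t by (simp add: power2_eq_square)
      \<comment> \<open>The exponent is made for this identity: since
        \<open>2 * (\<alpha> + 1)\<close> is the dimension, the second-order term equals the
        Bernoulli term \<open>\<alpha> / t\<close>, summed over all neighbours.\<close>
      also have "\<dots> = 2 * real CARD('d) * (\<alpha> * (1 / t))"
        unfolding \<alpha>(2) by simp
      finally show "2 * real CARD('d) + \<alpha> * (\<alpha> + 1) * (4 * (t - 1 - a) / t\<^sup>2) + C * (16 / t\<^sup>2)
          \<le> 2 * real CARD('d) * (1 + \<alpha> * (1 / t))" by (simp add: algebra_simps)
    qed simp
    also have "\<dots> \<le> t powr (-\<alpha>) * (2 * real CARD('d) * (1 - 1 / t) powr (-\<alpha>))"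
      using powr_neg_bernoulli[of \<alpha> "1 / t"] \<alpha> t by (intro mult_left_mono) auto
    also have "\<dots> = 2 * real CARD('d) * (t * (1 - 1 / t)) powr (-\<alpha>)"
      using t by (simp add: powr_mult)
    also have "t * (1 - 1 / t) = sqnorm x + a"
      using t by (simp add: field_simps t_def)
    finally show "avg (\<lambda>x. (sqnorm x + a) powr (-\<alpha>)) x \<le> (sqnorm x + a) powr (-\<alpha>)"
      by (simp add: avg_def card_nbrs field_simps)
  qed
qed

section \<open>Decay of the Green function and its best constants\<close>

lemma green_decay_pos: "0 < green_decay x y"
  by (simp add: green_decay_def)

lemma sum_heat_kernel_bounded:
  assumes d: "CARD('d::finite) \<ge> 3"
  obtains C where "\<And>N (x :: int ^ 'd) y. (\<Sum>n<N. heat_kernel n x y) \<le> C * green_decay x y"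
proof -
  define \<alpha> where "\<alpha> = (real CARD('d) - 2) / 2"
  have \<alpha>: "0 < \<alpha>" "-2 * \<alpha> = of_int (2 - int CARD('d))" using d by (auto simp: \<alpha>_def field_simps)
  obtain a where a: "4 \<le> a"
    and super: "\<And>x :: int ^ 'd. avg (\<lambda>x. (sqnorm x + a) powr (-\<alpha>)) x \<le> (sqnorm x + a) powr (-\<alpha>)"
    using radial_superharmonic[OF d] unfolding \<alpha>_def by blast
  define h where "h x = (sqnorm x + a) powr (-\<alpha>)" for x :: "int ^ 'd"
  have "h = (\<lambda>x. (sqnorm x + a) powr (-\<alpha>))" by (simp add: h_def fun_eq_iff)
  with super have super': "avg h x \<le> h x" for x by simp
  \<comment> \<open>All neighbours of 0 have \<open>sqnorm\<close> 1, so \<open>\<delta>\<close> is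
    exactly the gap between \<open>h 0\<close> and the average of \<open>h\<close> around 0.\<close>
  define \<delta> where "\<delta> = a powr (-\<alpha>) - (a + 1) powr (-\<alpha>)"
  have \<delta>: "0 < \<delta>" using a \<alpha> by (simp add: \<delta>_def powr_less_mono2_neg)
  have "h e = (a + 1) powr (-\<alpha>)" if "e \<in> nbrs" for e
  proof -
    have "sqnorm (axis i c) = (real_of_int c)\<^sup>2" for i :: 'd and c
      using sqnorm_add_axis[of 0 i c] by (simp add: sqnorm_def)
    then show ?thesis using that by (auto simp: nbrs_eq h_def add.commute)
  qed
  then have "avg h 0 = (a + 1) powr (-\<alpha>)" by (simp add: avg_def)
  then have h0: "avg h 0 + \<delta> \<le> h 0" by (simp add: \<delta>_def h_def sqnorm_def)
  have decay: "h (x - y) \<le> green_decay x y" for x y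
  proof -
    let ?m = "real_of_int (max (linf_norm (x - y)) 1)"
    have "?m\<^sup>2 \<le> sqnorm (x - y) + a"
      using linf_sq_le_sqnorm[of "x - y"] a sqnorm_nonneg[of "x - y"]
      by (auto simp: max_def)
    then have "h (x - y) \<le> (?m\<^sup>2) powr (-\<alpha>)"
      unfolding h_def using \<alpha> by (intro powr_mono2') auto
    also have "\<dots> = (?m powr 2) powr (-\<alpha>)" by (simp add: powr_numeral)
    also have "\<dots> = ?m powr (-2 * \<alpha>)" by (simp only: powr_powr) simp
    also have "\<dots> = ?m powi (2 - int CARD('d))"
      unfolding \<alpha>(2) by (rule powr_real_of_int') (auto simp: max_def)
    finally show ?thesis by (simp add: green_decay_def)
  qed
  show ?thesis
  proof (rule that[of "1 / \<delta>"])
    fix N and x y :: "int ^ 'd"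
    have "(\<Sum>n<N. heat_kernel n x y) = (\<Sum>n<N. heat_kernel n (x - y) 0)"
      using heat_kernel_translate[of _ "x - y" y 0] by simp
    also have "\<dots> \<le> h (x - y) / \<delta>"
    proof (rule sum_heat_kernel_le_supersolution[OF _ super' \<delta> h0])
      show "0 \<le> h x" for x by (simp add: h_def)
    qed
    also have "\<dots> \<le> 1 / \<delta> * green_decay x y"
      using decay[of x y] \<delta> by (simp add: divide_right_mono)
    finally show "(\<Sum>n<N. heat_kernel n x y) \<le> 1 / \<delta> * green_decay x y" .
  qed
qed

lemma summable_heat_kernel:
  assumes d: "CARD('d::finite) \<ge> 3"
  shows "summable (\<lambda>n. heat_kernel n (x :: int ^ 'd) y)"
proof -
  obtain C where "\<And>N (x :: int ^ 'd) y. (\<Sum>n<N. heat_kernel n x y) \<le> C * green_decay x y"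
    using sum_heat_kernel_bounded[OF d] by blast
  then show ?thesis by (intro summableI_nonneg_bounded) auto
qed

lemma heat_kernel_sums_green:
  assumes "CARD('d::finite) \<ge> 3"
  shows "(\<lambda>n. heat_kernel n (x :: int ^ 'd) y) sums green x y"
  unfolding green_heat_kernel using summable_heat_kernel[OF assms] by (rule summable_sums)

lemma green_nonneg: "CARD('d::finite) \<ge> 3 \<Longrightarrow> 0 \<le> green (x :: int ^ 'd) y"
  unfolding green_heat_kernel by (rule suminf_nonneg) (auto intro: summable_heat_kernel)

lemma green_first_step:
  assumes d: "CARD('d::finite) \<ge> 3"
  shows "green (x :: int ^ 'd) y = (if x = y then 1 else 0) + avg (\<lambda>z. green z y) x"
proof -
  have "(\<lambda>n. avg (\<lambda>z. heat_kernel n z y) x) sums avg (\<lambda>z. green z y) x"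
    unfolding avg_def by (intro sums_divide sums_sum heat_kernel_sums_green d)
  then have "(\<lambda>n. heat_kernel (Suc n) x y) sums avg (\<lambda>z. green z y) x"
    by (simp add: heat_kernel_Suc)
  then have "(\<lambda>n. heat_kernel n x y) sums (avg (\<lambda>z. green z y) x + heat_kernel 0 x y)"
    by (rule sums_Suc)
  then show ?thesis
    using heat_kernel_sums_green[OF d, of x y] by (simp add: sums_unique2 heat_kernel_0 add.commute)
qed

lemma avg_green_le: "CARD('d::finite) \<ge> 3 \<Longrightarrow> avg (\<lambda>z. green z y) (x :: int ^ 'd) \<le> green x y"
  using green_first_step[of x y] by auto

lemma one_le_green_diag: "CARD('d::finite) \<ge> 3 \<Longrightarrow> 1 \<le> green (x :: int ^ 'd) x"
  using green_first_step[of x x] avg_mono[of "\<lambda>_. 0" "\<lambda>z. green z x" x] by (auto simp: green_nonneg)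

lemma green_decay_refl [simp]: "green_decay x x = 1"
  by (simp add: green_decay_def)

text \<open>A \<open>LEAST\<close> carries information only once it is attained. The set of
  admissible constants is nonempty by the superharmonic bound, and it contains its infimum because
  it is cut out by non-strict inequalities.\<close>

lemma green_le_C_green:
  assumes d: "CARD('d::finite) \<ge> 3"
  shows "green (x :: int ^ 'd) y \<le> C_green TYPE('d) * green_decay x y"
proof -
  define S where "S = {C. \<forall>x y :: int ^ 'd. green x y \<le> C * green_decay x y}"
  have S_iff: "C \<in> S \<longleftrightarrow> (\<forall>x y :: int ^ 'd. green x y \<le> C * green_decay x y)" for C
    by (simp add: S_def)
  obtain C where C: "\<And>N (x :: int ^ 'd) y. (\<Sum>n<N. heat_kernel n x y) \<le> C * green_decay x y"
    using sum_heat_kernel_bounded[OF d] by blast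
  then have "C \<in> S"
    unfolding S_def green_heat_kernel by (auto intro!: suminf_le_const summable_heat_kernel d)
  then have ne: "S \<noteq> {}" by auto
  have div: "green x y / green_decay x y \<le> C" if "C \<in> S" for C and x y :: "int ^ 'd"
    using that green_decay_pos[of x y] by (simp add: S_def divide_le_eq)
  have bdd: "bdd_below S" using div by (auto intro!: bdd_belowI)
  have "Inf S \<in> S"
    unfolding S_iff
  proof (intro allI)
    fix x y :: "int ^ 'd"
    have "green x y / green_decay x y \<le> Inf S" using div ne by (intro cInf_greatest)
    then show "green x y \<le> Inf S * green_decay x y"
      using green_decay_pos[of x y] by (simp add: divide_le_eq)
  qed
  then have "(LEAST C. C \<in> S) = Inf S"
    using bdd by (intro Least_equality) (auto intro: cInf_lower)
  then have "C_green TYPE('d) = Inf S" by (simp add: C_green_def S_def)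
  with \<open>Inf S \<in> S\<close> show ?thesis by (simp add: S_iff)
qed

text \<open>The \<open>GREATEST\<close> is attained at the supremum of the admissible constants.
  Among them is 0, which gives nonnegativity.\<close>

lemma c_green_bounds:
  assumes d: "CARD('d::finite) \<ge> 3"
  shows "c_green TYPE('d) * green_decay x y \<le> green (x :: int ^ 'd) y" "0 \<le> c_green TYPE('d)"
proof -
  define S where "S = {c. \<forall>x y :: int ^ 'd. c * green_decay x y \<le> green x y}"
  have S_iff: "c \<in> S \<longleftrightarrow> (\<forall>x y :: int ^ 'd. c * green_decay x y \<le> green x y)" for c
    by (simp add: S_def)
  have z: "0 \<in> S" by (simp add: S_def green_nonneg[OF d])
  have div: "c \<le> green x y / green_decay x y" if "c \<in> S" for c and x y :: "int ^ 'd"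
    using that green_decay_pos[of x y] by (simp add: S_def le_divide_eq)
  have bdd: "bdd_above S" using div by (auto intro!: bdd_aboveI)
  have mem: "Sup S \<in> S"
    unfolding S_iff
  proof (intro allI)
    fix x y :: "int ^ 'd"
    have "Sup S \<le> green x y / green_decay x y" using div z by (intro cSup_least) auto
    then show "Sup S * green_decay x y \<le> green x y"
      using green_decay_pos[of x y] by (simp add: le_divide_eq)
  qed
  then have "(GREATEST c. c \<in> S) = Sup S"
    using bdd by (intro Greatest_equality) (auto intro: cSup_upper)
  then have eq: "c_green TYPE('d) = Sup S" by (simp add: c_green_def S_def)
  with mem show "c_green TYPE('d) * green_decay x y \<le> green x y" by (simp add: S_iff)
  show "0 \<le> c_green TYPE('d)" unfolding eq using z bdd by (rule cSup_upper)
qed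

lemma C_green_ge_1: "CARD('d::finite) \<ge> 3 \<Longrightarrow> 1 \<le> C_green TYPE('d)"
  using green_le_C_green[of "0 :: int ^ 'd" 0] one_le_green_diag[of "0 :: int ^ 'd"] by simp

section \<open>Capacity\<close>

definition hit_prob :: "(int ^ 'd::finite) set \<Rightarrow> int ^ 'd \<Rightarrow> real" where
  "hit_prob K x = measure (srw x) {X. \<exists>n. X n \<in> K}"

lemma equilibrium_nonneg [simp]: "0 \<le> equilibrium K x"
  by (simp add: equilibrium_def)

lemma capacity_nonneg: "0 \<le> capacity K"
  by (simp add: capacity_def sum_nonneg)

lemma hit_prob_1:
  assumes "x \<in> K"
  shows "hit_prob K x = 1"
  unfolding hit_prob_def
proof (subst srw.prob_eq_1)
  show "{X. \<exists>n. X n \<in> K} \<in> srw.events x"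
    unfolding sets_srw by (rule path_setI) measurable
  show "AE X in srw x. X \<in> {X. \<exists>n. X n \<in> K}"
    using srw_start[of x] by eventually_elim (use assms in auto)
qed

lemma prob_visit:
  assumes "finite K"
  shows "measure (srw x) {X. X n \<in> K} = (\<Sum>z\<in>K. heat_kernel n x z)"
proof -
  have "measure (srw x) (\<Union>z\<in>K. {X. X n = z}) = (\<Sum>z\<in>K. measure (srw x) {X. X n = z})"
  proof (rule srw.finite_measure_finite_Union[OF assms])
    show "(\<lambda>z. {X. X n = z}) ` K \<subseteq> srw.events x"
      unfolding sets_srw by (auto intro!: path_setI)
  qed (auto simp: disjoint_family_on_def)
  moreover have "(\<Union>z\<in>K. {X. X n = z}) = {X. X n \<in> K}" by auto
  ultimately show ?thesis by (simp add: heat_kernel_def)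
qed

text \<open>Borel-Cantelli: the visit probabilities are summable because the Green function is
  finite.\<close>

lemma AE_transient:
  assumes d: "CARD('d::finite) \<ge> 3" and K: "finite K"
  shows "AE X in srw (x :: int ^ 'd). \<exists>m. \<forall>n\<ge>m. X n \<notin> K"
proof -
  have "AE X in srw x. eventually (\<lambda>n. X \<in> space (srw x) - {X. X n \<in> K}) sequentially"
  proof (rule borel_cantelli_AE1)
    show "{X. X n \<in> K} \<in> srw.events x" for n
      unfolding sets_srw by (rule path_setI) measurable
    show "summable (\<lambda>n. srw.prob x {X. X n \<in> K})"
      unfolding prob_visit[OF K] by (intro summable_sum summable_heat_kernel d)
  qed (simp add: srw.emeasure_eq_measure)
  then show ?thesis by (simp add: eventually_sequentially)
qed

text \<open>Decomposition according to the last visit to \<open>K\<close>.\<close>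

lemma hit_prob_eq_green_equilibrium:
  assumes d: "CARD('d::finite) \<ge> 3" and K: "finite K"
  shows "hit_prob K (x :: int ^ 'd) = (\<Sum>z\<in>K. green x z * equilibrium K z)"
proof -
  define E where "E = {X :: nat \<Rightarrow> int ^ 'd. \<forall>j\<ge>1. X j \<notin> K}"
  \<comment> \<open>\<open>L n\<close> says that the last visit to \<open>K\<close> takes place at
    time \<open>n\<close>. These events are disjoint, and by transience they exhaust the hitting
    event almost surely.\<close>
  define L where "L n = {X :: nat \<Rightarrow> int ^ 'd. X n \<in> K \<and> (\<lambda>j. X (n + j)) \<in> E}" for n
  have E [measurable]: "E \<in> sets path_space"
    unfolding E_def by (rule path_setI) measurable
  have L [measurable]: "L n \<in> sets path_space" for n
    unfolding L_def by (rule path_setI) measurable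
  have disj: "disjoint_family L"
    unfolding disjoint_family_on_def
  proof (intro ballI impI)
    have "X \<notin> L n" if "m < n" "X \<in> L m" for m n X
      using that by (auto simp: L_def E_def dest!: spec[of _ "n - m"])
    then show "L m \<inter> L n = {}" if "m \<noteq> n" for m n
      using that by (metis disjoint_iff linorder_neqE_nat)
  qed
  have meas: "measure (srw x) (L n) = (\<Sum>z\<in>K. heat_kernel n x z * equilibrium K z)" for n
  proof -
    have "measure (srw x) (\<Union>z\<in>K. {X. X n = z \<and> (\<lambda>j. X (n + j)) \<in> E})
        = (\<Sum>z\<in>K. measure (srw x) {X. X n = z \<and> (\<lambda>j. X (n + j)) \<in> E})"
    proof (rule srw.finite_measure_finite_Union[OF K])
      have "{X. X n = z \<and> (\<lambda>j. X (n + j)) \<in> E} \<in> sets path_space" for z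
        by (rule path_setI) measurable
      then show "(\<lambda>z. {X. X n = z \<and> (\<lambda>j. X (n + j)) \<in> E}) ` K \<subseteq> srw.events x"
        by auto
    qed (auto simp: disjoint_family_on_def)
    moreover have "(\<Union>z\<in>K. {X. X n = z \<and> (\<lambda>j. X (n + j)) \<in> E}) = L n" by (auto simp: L_def)
    moreover have "measure (srw z) E = equilibrium K z" for z by (simp add: E_def equilibrium_def)
    ultimately show ?thesis by (simp add: markov_property[OF E])
  qed
  have "(\<lambda>n. measure (srw x) (L n)) sums measure (srw x) (\<Union>n. L n)"
    by (rule srw.finite_measure_UNION) (use L disj in auto)
  moreover have "(\<lambda>n. measure (srw x) (L n)) sums (\<Sum>z\<in>K. green x z * equilibrium K z)"
    unfolding meas by (intro sums_sum sums_mult2 heat_kernel_sums_green d)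
  ultimately have "measure (srw x) (\<Union>n. L n) = (\<Sum>z\<in>K. green x z * equilibrium K z)"
    by (rule sums_unique2)
  moreover have "hit_prob K x = measure (srw x) (\<Union>n. L n)"
    unfolding hit_prob_def
  proof (rule srw.finite_measure_eq_AE)
    show "AE X in srw x. (X \<in> {X. \<exists>n. X n \<in> K}) = (X \<in> (\<Union>n. L n))"
      using AE_transient[OF d K, of x]
    proof eventually_elim
      fix X :: "nat \<Rightarrow> int ^ 'd" assume "\<exists>m. \<forall>n\<ge>m. X n \<notin> K"
      then obtain m where m: "\<And>n. n \<ge> m \<Longrightarrow> X n \<notin> K" by auto
      show "(X \<in> {X. \<exists>n. X n \<in> K}) = (X \<in> (\<Union>n. L n))"
      proof
        assume "X \<in> {X. \<exists>n. X n \<in> K}"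
        then have ne: "{n. X n \<in> K} \<noteq> {}" by auto
        have "{n. X n \<in> K} \<subseteq> {..<m}" using m not_le by blast
        then have fin: "finite {n. X n \<in> K}" by (rule finite_subset) simp
        define n where "n = Max {n. X n \<in> K}"
        have "X n \<in> K" using Max_in[OF fin ne] by (simp add: n_def)
        moreover have "X (n + j) \<notin> K" if "j \<ge> 1" for j
          using Max_ge[OF fin, of "n + j"] that by (auto simp: n_def)
        ultimately have "X \<in> L n" by (simp add: L_def E_def)
        then show "X \<in> (\<Union>n. L n)" by auto
      qed (auto simp: L_def)
    qed
    show "{X. \<exists>n. X n \<in> K} \<in> srw.events x"
      unfolding sets_srw by (rule path_setI) measurable
  qed (use L in auto)
  ultimately show ?thesis by simp
qed

text \<open>Each point of \<open>K\<close> hits \<open>K\<close> with probability 1. Summing the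
  last-exit formula over these points and using the symmetry of the Green function puts the row sums
  of \<open>green\<close>, hence \<open>M\<close>, in front of the equilibrium measure.\<close>

lemma card_le_capacity:
  assumes d: "CARD('d::finite) \<ge> 3" and K: "finite (K :: (int ^ 'd) set)"
    and M: "\<And>x. x \<in> K \<Longrightarrow> (\<Sum>y\<in>K. green x y) \<le> M"
  shows "real (card K) \<le> M * capacity K"
proof -
  have "real (card K) = (\<Sum>x\<in>K. hit_prob K x)" by (simp add: hit_prob_1)
  also have "\<dots> = (\<Sum>x\<in>K. \<Sum>z\<in>K. green x z * equilibrium K z)"
    using hit_prob_eq_green_equilibrium[OF d K] by simp
  also have "\<dots> = (\<Sum>z\<in>K. (\<Sum>x\<in>K. green z x) * equilibrium K z)"
    by (subst sum.swap) (simp add: sum_distrib_right green_sym)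
  also have "\<dots> \<le> (\<Sum>z\<in>K. M * equilibrium K z)"
    by (intro sum_mono mult_right_mono M) auto
  finally show ?thesis by (simp add: capacity_def sum_distrib_left)
qed

text \<open>Avoiding \<open>K\<close> is harder than avoiding \<open>{x}\<close>, and for a
  singleton the last-exit formula at \<open>x\<close> itself reads
  \<open>green x x * equilibrium {x} x = 1\<close>.\<close>

lemma equilibrium_le_inverse_green:
  assumes d: "CARD('d::finite) \<ge> 3" and x: "(x :: int ^ 'd) \<in> K"
  shows "equilibrium K x \<le> 1 / green x x"
proof -
  have "{X. \<forall>n\<ge>1. X n \<notin> {x}} \<in> sets path_space"
    by (rule path_setI) measurable
  then have "equilibrium K x \<le> equilibrium {x} x"
    unfolding equilibrium_def using x by (intro srw.finite_measure_mono) auto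
  also have "green x x * equilibrium {x} x = 1"
    using hit_prob_eq_green_equilibrium[OF d, of "{x}" x] hit_prob_1[of x "{x}"] by simp
  then have "equilibrium {x} x = 1 / green x x"
    by (metis mult_zero_left nonzero_mult_div_cancel_left zero_neq_one)
  finally show ?thesis .
qed

text \<open>Writing \<open>hit_prob K\<close> by last exits turns the right side into a double sum
  that, read the other way, contains \<open>hit_prob F z\<close>, which is 1 for \<open>z\<close> in
  \<open>K\<close>. The capacities of all subsets of \<open>F\<close> thus come from the one
  starting measure \<open>equilibrium F\<close>.\<close>

lemma capacity_sweeping:
  assumes d: "CARD('d::finite) \<ge> 3" and F: "finite (F :: (int ^ 'd) set)" and K: "K \<subseteq> F"
  shows "capacity K = (\<Sum>x\<in>F. equilibrium F x * hit_prob K x)"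
proof -
  have "(\<Sum>x\<in>F. equilibrium F x * hit_prob K x)
      = (\<Sum>x\<in>F. \<Sum>z\<in>K. green z x * equilibrium F x * equilibrium K z)"
    using hit_prob_eq_green_equilibrium[OF d finite_subset[OF K F]]
    by (simp add: sum_distrib_left green_sym mult_ac)
  also have "\<dots> = (\<Sum>z\<in>K. hit_prob F z * equilibrium K z)"
    unfolding hit_prob_eq_green_equilibrium[OF d F] by (subst sum.swap) (simp add: sum_distrib_right)
  also have "\<dots> = (\<Sum>z\<in>K. equilibrium K z)"
    by (rule sum.cong) (use K in \<open>auto simp: hit_prob_1\<close>)
  finally show ?thesis by (simp add: capacity_def)
qed

definition trace_prob :: "(int ^ 'd::finite) set \<Rightarrow> int ^ 'd \<Rightarrow> (int ^ 'd) set \<Rightarrow> real" where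
  "trace_prob F x T = measure (srw x) {X. range X \<inter> F = T}"

text \<open>The intensity of trajectories with trace \<open>T\<close>: walks start from the
  unnormalised equilibrium measure of \<open>F\<close>, whose total mass is
  \<open>capacity F\<close>.\<close>

definition trace_weight :: "(int ^ 'd::finite) set \<Rightarrow> (int ^ 'd) set \<Rightarrow> real" where
  "trace_weight F T = (\<Sum>x\<in>F. equilibrium F x * trace_prob F x T)"

lemma trace_prob_nonneg [simp]: "0 \<le> trace_prob F x T"
  by (simp add: trace_prob_def)

lemma trace_weight_nonneg [simp]: "0 \<le> trace_weight F T"
  by (simp add: trace_weight_def sum_nonneg)

lemma trace_event_measurable:
  assumes "finite F"
  shows "{X. range X \<inter> F = T} \<in> sets path_space"
proof -
  have "{X. range X \<inter> F = T} = {X. (\<forall>z\<in>F. (\<exists>n. X n = z) = (z \<in> T)) \<and> T \<subseteq> F}"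
    by (auto 4 4)
  also have "\<dots> \<in> sets path_space"
    using assms by (intro path_setI) measurable
  finally show ?thesis .
qed

lemma hit_prob_trace:
  assumes F: "finite F" and K: "K \<subseteq> F"
  shows "hit_prob K x = (\<Sum>T | T \<subseteq> F \<and> T \<inter> K \<noteq> {}. trace_prob F x T)"
proof -
  let ?A = "{T. T \<subseteq> F \<and> T \<inter> K \<noteq> {}}"
  have "measure (srw x) (\<Union>T\<in>?A. {X. range X \<inter> F = T}) = (\<Sum>T\<in>?A. trace_prob F x T)"
    unfolding trace_prob_def
  proof (rule srw.finite_measure_finite_Union)
    show "finite ?A" using F by simp
    show "(\<lambda>T. {X. range X \<inter> F = T}) ` ?A \<subseteq> srw.events x"
      unfolding sets_srw using trace_event_measurable[OF F] by blast
    show "disjoint_family_on (\<lambda>T. {X. range X \<inter> F = T}) ?A"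
      unfolding disjoint_family_on_def by blast
  qed
  moreover have "(\<Union>T\<in>?A. {X. range X \<inter> F = T}) = {X :: nat \<Rightarrow> _. \<exists>n. X n \<in> K}" (is "?L = ?R")
  proof (rule set_eqI)
    fix X
    have "X \<in> ?L \<longleftrightarrow> range X \<inter> F \<inter> K \<noteq> {}" by simp
    also have "\<dots> \<longleftrightarrow> X \<in> ?R" using K by blast
    finally show "X \<in> ?L \<longleftrightarrow> X \<in> ?R" .
  qed
  ultimately show ?thesis by (simp add: hit_prob_def)
qed

text \<open>Additivity over the traces meeting \<open>K\<close> is what turns
  \<open>exp (- u * capacity K)\<close> into a product over independent traces.\<close>

lemma capacity_trace:
  assumes d: "CARD('d::finite) \<ge> 3" and F: "finite (F :: (int ^ 'd) set)" and K: "K \<subseteq> F"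
  shows "capacity K = (\<Sum>T | T \<subseteq> F \<and> T \<inter> K \<noteq> {}. trace_weight F T)"
  unfolding capacity_sweeping[OF assms] hit_prob_trace[OF F K] trace_weight_def sum_distrib_left
  by (rule sum.swap)

section \<open>The law of the interlacement\<close>

text \<open>Moebius inversion on the subset lattice, as an induction over proper subsets.\<close>

lemma subset_sums_determine:
  fixes f g :: "'a set \<Rightarrow> real"
  assumes F: "finite F" and eq: "\<And>B. B \<subseteq> F \<Longrightarrow> (\<Sum>T\<in>Pow B. f T) = (\<Sum>T\<in>Pow B. g T)"
    and B: "B \<subseteq> F"
  shows "f B = g B"
  using finite_subset[OF B F] B
proof (induction B rule: finite_psubset_induct)
  case (psubset B)
  have "(\<Sum>T\<in>Pow B. h T) = h B + (\<Sum>T\<in>Pow B - {B}. h T)" for h :: "'a set \<Rightarrow> real"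
    using psubset.hyps by (intro sum.remove) auto
  moreover have "(\<Sum>T\<in>Pow B - {B}. f T) = (\<Sum>T\<in>Pow B - {B}. g T)"
    by (rule sum.cong) (use psubset in auto)
  ultimately show ?case using eq[OF psubset.prems] by simp
qed

text \<open>
  The trace of the interlacement on a finite set \<open>F\<close>: each nonempty \<open>T \<subseteq> F\<close> is independently
  covered by at least one trajectory with trace \<open>T\<close>.
\<close>

definition local_soup :: "real \<Rightarrow> (int ^ 'd::finite) set \<Rightarrow> ((int ^ 'd) set \<Rightarrow> bool) pmf" where
  "local_soup u F = Pi_pmf (Pow F) False (\<lambda>T. bernoulli_pmf (1 - exp (- u * trace_weight F T)))"

definition local_law :: "real \<Rightarrow> (int ^ 'd::finite) set \<Rightarrow> (int ^ 'd) set pmf" where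
  "local_law u F = map_pmf (\<lambda>c. \<Union>{T. T \<subseteq> F \<and> c T}) (local_soup u F)"

lemma set_pmf_local_law: "set_pmf (local_law u F) \<subseteq> Pow F"
  by (auto simp: local_law_def)

lemma local_law_void:
  assumes d: "CARD('d::finite) \<ge> 3" and F: "finite (F :: (int ^ 'd) set)" and K: "K \<subseteq> F" and u: "0 \<le> u"
  shows "measure_pmf.prob (local_law u F) {I. I \<inter> K = {}} = exp (- u * capacity K)"
proof -
  let ?p = "\<lambda>T. 1 - exp (- u * trace_weight F T)"
  have p: "0 \<le> ?p T" "?p T \<le> 1" for T using u by auto
  \<comment> \<open>Avoiding \<open>K\<close> is a product event: a trace that meets
    \<open>K\<close> must be absent, every other one is free.\<close>
  define B where "B T = (if T \<inter> K \<noteq> {} then {False} else UNIV)" for T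
  have "measure_pmf.prob (local_law u F) {I. I \<inter> K = {}}
      = measure_pmf.prob (local_soup u F) ((\<lambda>c. \<Union>{T. T \<subseteq> F \<and> c T}) -` {I. I \<inter> K = {}})"
    by (simp add: local_law_def)
  also have "(\<lambda>c. \<Union>{T. T \<subseteq> F \<and> c T}) -` {I. I \<inter> K = {}} = Pi (Pow F) B"
    by (auto simp: B_def Pi_def split: if_splits)
  also have "measure_pmf.prob (local_soup u F) (Pi (Pow F) B)
      = (\<Prod>T\<in>Pow F. measure_pmf.prob (bernoulli_pmf (?p T)) (B T))"
    unfolding local_soup_def using F by (intro measure_Pi_pmf_Pi) simp
  also have "\<dots> = (\<Prod>T\<in>Pow F. if T \<inter> K \<noteq> {} then exp (- u * trace_weight F T) else 1)"
    using p by (intro prod.cong) (auto simp: B_def measure_pmf_single)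
  also have "\<dots> = (\<Prod>T | T \<subseteq> F \<and> T \<inter> K \<noteq> {}. exp (- u * trace_weight F T))"
    using F by (intro prod.mono_neutral_cong_right) auto
  also have "\<dots> = exp (\<Sum>T | T \<subseteq> F \<and> T \<inter> K \<noteq> {}. - u * trace_weight F T)"
    using F by (simp add: exp_sum)
  also have "\<dots> = exp (- u * capacity K)"
    by (simp add: capacity_trace[OF d F K] sum_distrib_left sum_negf)
  finally show ?thesis .
qed

lemma prob_subset_eq_sum_pmf:
  assumes "set_pmf p \<subseteq> Pow F" "finite F" "B \<subseteq> F"
  shows "measure_pmf.prob p {I. I \<inter> (F - B) = {}} = (\<Sum>T\<in>Pow B. pmf p T)"
proof -
  have "measure_pmf.prob p {I. I \<inter> (F - B) = {}} = measure_pmf.prob p (Pow B)"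
    by (rule measure_pmf.finite_measure_eq_AE)
      (use assms in \<open>auto simp: AE_measure_pmf_iff\<close>)
  also have "\<dots> = (\<Sum>T\<in>Pow B. pmf p T)"
    using assms finite_subset by (intro measure_measure_pmf_finite) auto
  finally show ?thesis .
qed

lemma pmf_eqI_void:
  assumes p: "set_pmf p \<subseteq> Pow F" and q: "set_pmf q \<subseteq> Pow F" and F: "finite F"
    and eq: "\<And>K. K \<subseteq> F \<Longrightarrow> measure_pmf.prob p {I. I \<inter> K = {}} = measure_pmf.prob q {I. I \<inter> K = {}}"
  shows "p = q"
proof (rule pmf_eqI)
  fix I
  show "pmf p I = pmf q I"
  proof (cases "I \<subseteq> F")
    case True
    have "(\<Sum>T\<in>Pow B. pmf p T) = (\<Sum>T\<in>Pow B. pmf q T)" if "B \<subseteq> F" for B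
      using eq[of "F - B"] prob_subset_eq_sum_pmf[OF p F that] prob_subset_eq_sum_pmf[OF q F that] by auto
    then show ?thesis by (rule subset_sums_determine[OF F _ True])
  next
    case False
    then have "pmf p I = 0" "pmf q I = 0" using p q by (auto simp: pmf_eq_0_set_pmf)
    then show ?thesis by simp
  qed
qed

text \<open>The consistency condition of Kolmogorov's theorem. The void probabilities on both sides
  agree because \<open>capacity K\<close> does not depend on the window in which the traces are
  taken, and they determine a law on the subsets of a finite set.\<close>

lemma local_law_restrict:
  assumes d: "CARD('d::finite) \<ge> 3" and H: "finite (H :: (int ^ 'd) set)" and J: "J \<subseteq> H" and u: "0 \<le> u"
  shows "local_law u J = map_pmf (\<lambda>I. I \<inter> J) (local_law u H)"
proof (rule pmf_eqI_void)
  show "set_pmf (local_law u J) \<subseteq> Pow J" by (rule set_pmf_local_law)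
  show "set_pmf (map_pmf (\<lambda>I. I \<inter> J) (local_law u H)) \<subseteq> Pow J" by auto
  show fJ: "finite J" using J H by (rule finite_subset)
  fix K assume K: "K \<subseteq> J"
  have "(\<lambda>I. I \<inter> J) -` {I. I \<inter> K = {}} = {I. I \<inter> K = {}}" using K by auto
  then show "measure_pmf.prob (local_law u J) {I. I \<inter> K = {}}
      = measure_pmf.prob (map_pmf (\<lambda>I. I \<inter> J) (local_law u H)) {I. I \<inter> K = {}}"
    using local_law_void[OF d fJ K u] local_law_void[OF d H _ u, of K] K J by auto
qed

section \<open>The law on infinite configurations: uniqueness, existence, restriction to finite
  windows\<close>

lemma space_config_space [simp]: "space config_space = UNIV"
  by (simp add: config_space_def)

lemma sets_config_space: "sets config_space = sigma_sets UNIV (range (\<lambda>x. {I. x \<in> I}))"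
  by (simp add: config_space_def)

lemma occupied_measurable [measurable]: "Measurable.pred config_space (\<lambda>I. x \<in> I)"
  by (auto simp: pred_def sets_config_space)

lemma void_measurable [measurable]:
  assumes "finite K"
  shows "{I. I \<inter> K = {}} \<in> sets (config_space :: (int ^ 'd::finite) set measure)"
proof -
  have "{I. I \<inter> K = {}} = {I \<in> space config_space. \<forall>x\<in>K. x \<notin> I}" by auto
  also have "\<dots> \<in> sets config_space" using assms by measurable
  finally show ?thesis .
qed

lemma measurable_into_config:
  assumes "\<And>x. Measurable.pred M (\<lambda>\<omega>. x \<in> f \<omega>)"
  shows "f \<in> measurable M (config_space :: (int ^ 'd::finite) set measure)"
  unfolding config_space_def
proof (rule measurable_sigma_sets[OF refl[THEN trans]])
  show "sets (sigma UNIV (range (\<lambda>x. {I :: (int ^ 'd) set. x \<in> I}))) = sigma_sets UNIV (range (\<lambda>x. {I. x \<in> I}))"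
    by simp
  show "\<And>y. y \<in> range (\<lambda>x. {I. x \<in> I}) \<Longrightarrow> f -` y \<inter> space M \<in> sets M"
    using assms by (auto simp: pred_def vimage_def Int_def conj_commute)
qed auto

text \<open>The void events are stable under intersection, \<open>K\<close> and \<open>L\<close>
  giving \<open>K \<union> L\<close>, and they generate the \<sigma>-algebra.\<close>

lemma interlacement_law_unique:
  assumes P: "is_interlacement_law u P" and Q: "is_interlacement_law u Q"
  shows "P = (Q :: (int ^ 'd::finite) set measure)"
proof -
  define E where "E = {{I :: (int ^ 'd) set. I \<inter> K = {}} | K. finite K}"
  interpret P: prob_space P using P by (simp add: is_interlacement_law_def)
  interpret Q: prob_space Q using Q by (simp add: is_interlacement_law_def)
  have "{I :: (int ^ 'd) set. x \<in> I} \<in> sigma_sets UNIV E" for x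
  proof -
    have "{I :: (int ^ 'd) set. x \<in> I} = UNIV - {I. I \<inter> {x} = {}}" by auto
    also have "\<dots> \<in> sigma_sets UNIV E"
      by (rule sigma_sets.Compl, rule sigma_sets.Basic) (auto simp: E_def intro!: exI[of _ "{x}"])
    finally show ?thesis .
  qed
  then have "sigma_sets UNIV (range (\<lambda>x. {I :: (int ^ 'd) set. x \<in> I})) \<subseteq> sigma_sets UNIV E"
    by (intro sigma_sets_mono) auto
  moreover have "sigma_sets UNIV E \<subseteq> sigma_sets UNIV (range (\<lambda>x. {I :: (int ^ 'd) set. x \<in> I}))"
    using void_measurable by (intro sigma_sets_mono) (auto simp: E_def sets_config_space)
  ultimately have sets_eq: "sets (config_space :: (int ^ 'd) set measure) = sigma_sets UNIV E"
    unfolding sets_config_space by (rule equalityI)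
  have UNIV_E: "UNIV \<in> E" by (auto simp: E_def intro!: exI[of _ "{}"])
  show ?thesis
  proof (rule measure_eqI_generator_eq[where A = "\<lambda>_. UNIV" and \<Omega> = UNIV and E = E])
    show "Int_stable E"
    proof (rule Int_stableI)
      fix a b assume "a \<in> E" "b \<in> E"
      then obtain K L where "finite K" "finite L" "a = {I. I \<inter> K = {}}" "b = {I. I \<inter> L = {}}"
        by (auto simp: E_def)
      then show "a \<inter> b \<in> E" by (auto simp: E_def intro!: exI[of _ "K \<union> L"])
    qed
    show "\<And>X. X \<in> E \<Longrightarrow> emeasure P X = emeasure Q X"
      using P Q by (auto simp: E_def is_interlacement_law_def P.emeasure_eq_measure Q.emeasure_eq_measure)
  qed (use P Q sets_eq UNIV_E in \<open>auto simp: is_interlacement_law_def P.emeasure_eq_measure\<close>)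
qed

lemma interlacement_law_exists:
  assumes d: "CARD('d::finite) \<ge> 3" and u: "0 \<le> u"
  shows "\<exists>Q :: (int ^ 'd) set measure. is_interlacement_law u Q"
proof -
  \<comment> \<open>The projective limit is built on real-valued coordinates, so a configuration
    enters as an indicator function.\<close>
  define enc where "enc J I = (\<lambda>x\<in>J. indicator I x :: real)" for J I :: "(int ^ 'd) set"
  define P where "P J = distr (measure_pmf (local_law u J)) (PiM J (\<lambda>_. borel)) (enc J)" for J
  have enc [measurable]: "enc J \<in> measurable (measure_pmf p) (PiM J (\<lambda>_. borel))" for J and p :: "(int ^ 'd) set pmf"
    by (auto simp: enc_def space_PiM PiE_iff extensional_def)
  interpret P: polish_projective "UNIV :: (int ^ 'd) set" P
  proof (intro polish_projective.intro projective_family.intro)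
    fix J H :: "(int ^ 'd) set" assume JH: "J \<subseteq> H" "finite H"
    have "distr (P H) (PiM J (\<lambda>_. borel)) (\<lambda>f. restrict f J)
        = distr (measure_pmf (local_law u H)) (PiM J (\<lambda>_. borel)) ((\<lambda>f. restrict f J) \<circ> enc H)"
      unfolding P_def using JH enc by (intro distr_distr measurable_restrict_subset) auto
    also have "(\<lambda>f. restrict f J) \<circ> enc H = enc J \<circ> (\<lambda>I. I \<inter> J)"
      using JH by (auto simp: enc_def fun_eq_iff restrict_def indicator_def)
    also have "distr (measure_pmf (local_law u H)) (PiM J (\<lambda>_. borel)) (enc J \<circ> (\<lambda>I. I \<inter> J))
        = distr (distr (measure_pmf (local_law u H)) (count_space UNIV) (\<lambda>I. I \<inter> J)) (PiM J (\<lambda>_. borel)) (enc J)"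
      by (rule distr_distr[symmetric]) (auto simp: enc_def space_PiM PiE_iff extensional_def)
    also have "\<dots> = distr (measure_pmf (map_pmf (\<lambda>I. I \<inter> J) (local_law u H))) (PiM J (\<lambda>_. borel)) (enc J)"
      by (simp add: map_pmf_rep_eq)
    also have "\<dots> = P J"
      unfolding P_def using local_law_restrict[OF d JH(2,1) u] by simp
    finally show "P J = distr (P H) (PiM J (\<lambda>_. borel)) (\<lambda>f. restrict f J)" by (rule sym)
  next
    fix J :: "(int ^ 'd) set"
    show "prob_space (P J)" unfolding P_def by (rule measure_pmf.prob_space_distr) measurable
  qed
  \<comment> \<open>A coordinate of the limit may a priori be any real number. Only the value 1
    counts as occupied, so a void event pulls back to the cylinder over
    \<open>- {1}\<close>.\<close>
  define dec where "dec \<omega> = {x. \<omega> x = 1}" for \<omega> :: "int ^ 'd \<Rightarrow> real"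
  have dec [measurable]: "dec \<in> measurable P.lim config_space"
  proof (rule measurable_into_config)
    fix x
    have [measurable]: "(\<lambda>\<omega>. \<omega> x) \<in> borel_measurable P.lim"
      by (subst measurable_cong_sets[OF P.sets_lim refl]) (rule measurable_component_singleton, simp)
    show "Measurable.pred P.lim (\<lambda>\<omega>. x \<in> dec \<omega>)"
      unfolding dec_def mem_Collect_eq by measurable
  qed
  have "is_interlacement_law u (distr P.lim config_space dec)"
    unfolding is_interlacement_law_def
  proof (intro conjI allI impI)
    show "prob_space (distr P.lim config_space dec)"
      by (rule P.P.prob_space_distr) measurable
    show "sets (distr P.lim config_space dec) = sets config_space" by simp
    fix K :: "(int ^ 'd) set" assume K: "finite K"
    let ?X = "\<Pi>\<^sub>E x\<in>K. - {1 :: real}"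
    have X: "?X \<in> sets (PiM K (\<lambda>_. borel))"
      using K by (intro sets_PiM_I_finite) auto
    have "measure (distr P.lim config_space dec) {I. I \<inter> K = {}} = measure P.lim (dec -` {I. I \<inter> K = {}} \<inter> space P.lim)"
      using K by (intro measure_distr) auto
    also have "dec -` {I. I \<inter> K = {}} \<inter> space P.lim = prod_emb UNIV (\<lambda>_. borel) K ?X"
      by (auto simp: dec_def prod_emb_def space_PiM PiE_iff)
    also have "measure P.lim (prod_emb UNIV (\<lambda>_. borel) K ?X) = measure (P K) ?X"
      by (rule P.measure_lim_emb) (use K X in auto)
    also have "\<dots> = measure_pmf.prob (local_law u K) (enc K -` ?X)"
      unfolding P_def using X by (subst measure_distr[OF enc]) auto
    also have "enc K -` ?X = {I. I \<inter> K = {}}"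
      by (auto simp: enc_def PiE_iff indicator_def)
    also have "measure_pmf.prob (local_law u K) {I. I \<inter> K = {}} = exp (- u * capacity K)"
      by (rule local_law_void[OF d K order_refl u])
    finally show "measure (distr P.lim config_space dec) {I. I \<inter> K = {}} = exp (- u * capacity K)" .
  qed
  then show ?thesis by blast
qed

lemma is_interlacement_law:
  assumes d: "CARD('d::finite) \<ge> 3" and u: "0 \<le> u"
  shows "is_interlacement_law u (interlacement_law u :: (int ^ 'd) set measure)"
proof -
  obtain Q :: "(int ^ 'd) set measure" where Q: "is_interlacement_law u Q"
    using interlacement_law_exists[OF assms] by blast
  then have "interlacement_law u = Q"
    unfolding interlacement_law_def by (rule the_equality) (rule interlacement_law_unique[OF _ Q])
  with Q show ?thesis by simp
qed

text \<open>Lets the abstract law be replaced by the explicit soup for every event, described by an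
  arbitrary \<open>R\<close>, that depends on a finite window. The probabilities of the single
  traces \<open>I \<inter> F = T\<close> follow from the void probabilities by Moebius
  inversion.\<close>

lemma interlacement_local:
  assumes d: "CARD('d::finite) \<ge> 3" and u: "0 \<le> u" and F: "finite (F :: (int ^ 'd) set)"
  shows "measure (interlacement_law u) {I. R (I \<inter> F)} = measure_pmf.prob (local_law u F) {I. R I}"
proof -
  define Q :: "(int ^ 'd) set measure" where "Q = interlacement_law u"
  have law: "is_interlacement_law u Q" using is_interlacement_law[OF d u] by (simp add: Q_def)
  interpret Q: prob_space Q using law by (simp add: is_interlacement_law_def)
  have sets_Q [measurable_cong]: "sets Q = sets config_space" using law by (simp add: is_interlacement_law_def)
  have space_Q: "space Q = UNIV" using sets_eq_imp_space_eq[OF sets_Q] by simp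
  have meas: "{I. I \<inter> F = T} \<in> sets Q" for T
  proof -
    have "{I. I \<inter> F = T} = {I \<in> space Q. (\<forall>x\<in>F. (x \<in> I) = (x \<in> T)) \<and> T \<subseteq> F}"
      by (auto simp: space_Q)
    also have "\<dots> \<in> sets Q" using F by measurable
    finally show ?thesis .
  qed
  have split: "measure Q {I. S (I \<inter> F)} = (\<Sum>T | T \<subseteq> F \<and> S T. measure Q {I. I \<inter> F = T})" for S
  proof -
    have "measure Q (\<Union>T\<in>{T. T \<subseteq> F \<and> S T}. {I. I \<inter> F = T}) = (\<Sum>T | T \<subseteq> F \<and> S T. measure Q {I. I \<inter> F = T})"
    proof (rule Q.finite_measure_finite_Union)
      show "finite {T. T \<subseteq> F \<and> S T}" using F by simp
      show "(\<lambda>T. {I. I \<inter> F = T}) ` {T. T \<subseteq> F \<and> S T} \<subseteq> Q.events" using meas by blast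
      show "disjoint_family_on (\<lambda>T. {I. I \<inter> F = T}) {T. T \<subseteq> F \<and> S T}"
        unfolding disjoint_family_on_def by blast
    qed
    moreover have "(\<Union>T\<in>{T. T \<subseteq> F \<and> S T}. {I. I \<inter> F = T}) = {I. S (I \<inter> F)}" by auto
    ultimately show ?thesis by simp
  qed
  have eq: "measure Q {I. I \<inter> F = T} = pmf (local_law u F) T" if "T \<subseteq> F" for T
  proof (rule subset_sums_determine[OF F _ that])
    fix B assume B: "B \<subseteq> F"
    have "{T. T \<subseteq> F \<and> T \<inter> (F - B) = {}} = Pow B" using B by auto
    moreover have "{I. (I \<inter> F) \<inter> (F - B) = {}} = {I. I \<inter> (F - B) = {}}" by auto
    ultimately have "(\<Sum>T\<in>Pow B. measure Q {I. I \<inter> F = T}) = measure Q {I. I \<inter> (F - B) = {}}"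
      using split[of "\<lambda>T. T \<inter> (F - B) = {}"] by simp
    also have "\<dots> = exp (- u * capacity (F - B))"
      using law F by (simp add: is_interlacement_law_def)
    also have "\<dots> = measure_pmf.prob (local_law u F) {I. I \<inter> (F - B) = {}}"
      by (rule local_law_void[OF d F _ u, symmetric]) auto
    also have "\<dots> = (\<Sum>T\<in>Pow B. pmf (local_law u F) T)"
      by (rule prob_subset_eq_sum_pmf[OF set_pmf_local_law F B])
    finally show "(\<Sum>T\<in>Pow B. measure Q {I. I \<inter> F = T}) = (\<Sum>T\<in>Pow B. pmf (local_law u F) T)" .
  qed
  have "measure Q {I. R (I \<inter> F)} = (\<Sum>T | T \<subseteq> F \<and> R T. pmf (local_law u F) T)"
    unfolding split by (rule sum.cong) (auto simp: eq)
  also have "\<dots> = measure_pmf.prob (local_law u F) {T. T \<subseteq> F \<and> R T}"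
    using F by (intro measure_measure_pmf_finite[symmetric]) simp
  also have "\<dots> = measure_pmf.prob (local_law u F) {I. R I}"
    by (rule measure_pmf.finite_measure_eq_AE)
      (use set_pmf_local_law[of u F] in \<open>auto simp: AE_measure_pmf_iff\<close>)
  finally show ?thesis by (simp add: Q_def)
qed

section \<open>Embedded binary trees\<close>

definition plane :: "'d::finite set \<Rightarrow> (int ^ 'd) set" where
  "plane J = {x. \<forall>i. i \<notin> J \<longrightarrow> x $ i = 0}"

definition plane_shell :: "'d::finite set \<Rightarrow> int \<Rightarrow> (int ^ 'd) set" where
  "plane_shell J k = {v \<in> plane J. linf_norm v = k}"

lemma card_plane_ball:
  fixes J :: "'d::finite set"
  assumes "0 \<le> k"
  shows "card {v \<in> plane J. linf_norm v \<le> k} = nat (2 * k + 1) ^ card J"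
proof -
  let ?B = "{v \<in> plane J. linf_norm v \<le> k}" and ?P = "J \<rightarrow>\<^sub>E {-k..k}"
  have "bij_betw (\<lambda>v. restrict (vec_nth v) J) ?B ?P"
  proof (rule bij_betw_byWitness[where f' = "\<lambda>f. \<chi> i. if i \<in> J then f i else 0"])
    show "\<forall>v\<in>?B. (\<chi> i. if i \<in> J then restrict (($) v) J i else 0) = v"
      by (auto simp: vec_eq_iff plane_def)
    show "\<forall>f\<in>?P. restrict (($) (\<chi> i. if i \<in> J then f i else 0)) J = f"
      by (auto simp: fun_eq_iff PiE_iff extensional_def)
    show "(\<lambda>v. restrict (($) v) J) ` ?B \<subseteq> ?P"
    proof
      fix f assume "f \<in> (\<lambda>v. restrict (($) v) J) ` ?B"
      then obtain v where v: "linf_norm v \<le> k" "f = restrict (($) v) J" by auto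
      then have "\<bar>v $ i\<bar> \<le> k" for i by (simp add: linf_norm_le_iff)
      then have "- k \<le> v $ i \<and> v $ i \<le> k" for i by (metis abs_le_iff minus_le_iff)
      then show "f \<in> ?P" by (auto simp: v)
    qed
    show "(\<lambda>f. \<chi> i. if i \<in> J then f i else 0) ` ?P \<subseteq> ?B"
    proof
      fix v assume "v \<in> (\<lambda>f. \<chi> i. if i \<in> J then f i else 0) ` ?P"
      then obtain f where f: "f \<in> ?P" and v: "v = (\<chi> i. if i \<in> J then f i else 0)" by auto
      have "\<bar>v $ i\<bar> \<le> k" for i
        using f assms by (auto simp: v PiE_iff abs_le_iff dest!: bspec[of J _ i])
      then show "v \<in> ?B" by (auto simp: linf_norm_le_iff plane_def v)
    qed
  qed
  then have "card ?B = card ?P" by (rule bij_betw_same_card)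
  also have "\<dots> = nat (2 * k + 1) ^ card J"
    using assms by (simp add: card_PiE)
  finally show ?thesis .
qed

lemma finite_plane_shell [simp]: "finite (plane_shell J k)"
  by (rule finite_subset[OF _ finite_linf_ball[of 0 k]]) (auto simp: plane_shell_def)

lemma card_plane_shell:
  fixes J :: "'d::finite set"
  assumes "1 \<le> k"
  shows "real (card (plane_shell J k)) = real_of_int (2 * k + 1) ^ card J - real_of_int (2 * k - 1) ^ card J"
proof -
  let ?B = "\<lambda>k. {v \<in> plane J. linf_norm v \<le> k}"
  have "plane_shell J k = ?B k - ?B (k - 1)" by (auto simp: plane_shell_def)
  moreover have fin: "finite (?B k)" for k
    by (rule finite_subset[OF _ finite_linf_ball[of 0 k]]) auto
  moreover have sub: "?B (k - 1) \<subseteq> ?B k" by auto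
  ultimately have "real (card (plane_shell J k)) = real (card (?B k)) - real (card (?B (k - 1)))"
    by (simp only: card_Diff_subset[OF fin sub] of_nat_diff[OF card_mono[OF fin sub]])
  moreover have ball: "real (card (?B m)) = real_of_int (2 * m + 1) ^ card J" if "0 \<le> m" for m
    using card_plane_ball[OF that, of J] that by simp
  moreover have "real (card (?B (k - 1))) = real_of_int (2 * k - 1) ^ card J"
  proof -
    have eq: "2 * (k - 1) + 1 = 2 * k - 1" by simp
    have "real (card (?B (k - 1))) = real_of_int (2 * (k - 1) + 1) ^ card J"
      using assms by (intro ball) simp
    then show ?thesis by (simp only: eq)
  qed
  ultimately show ?thesis using assms ball[of k] by linarith
qed

text \<open>
  Leaf sets of the embedded binary trees with root \<open>x\<close>, at the scales \<open>L\<^sub>n = l * 6 ^ n\<close>: the children of a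
  vertex at level \<open>n + 1\<close> lie in \<open>x + L\<^sub>n \<int>\<^sup>d\<close> at distances \<open>L\<^sub>n\<^sub>+\<^sub>1\<close> and \<open>2 L\<^sub>n\<^sub>+\<^sub>1\<close>, within the plane
  spanned by \<open>J\<close>.
\<close>

fun leaf_sets :: "'d::finite set \<Rightarrow> int \<Rightarrow> nat \<Rightarrow> int ^ 'd \<Rightarrow> (int ^ 'd) set set" where
  "leaf_sets J l 0 x = {{x}}"
| "leaf_sets J l (Suc n) x = (\<Union>(v, w) \<in> plane_shell J 6 \<times> plane_shell J 12.
     (\<lambda>(A, B). A \<union> B) ` (leaf_sets J l n (x + (l * 6 ^ n) *s v) \<times> leaf_sets J l n (x + (l * 6 ^ n) *s w)))"

lemma leaf_sets_SucE:
  assumes "A \<in> leaf_sets J l (Suc n) x"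
  obtains v w A1 A2 where "v \<in> plane_shell J 6" "w \<in> plane_shell J 12"
    "A1 \<in> leaf_sets J l n (x + (l * 6 ^ n) *s v)" "A2 \<in> leaf_sets J l n (x + (l * 6 ^ n) *s w)" "A = A1 \<union> A2"
  using assms by auto

lemma leaf_sets_SucI:
  assumes "v \<in> plane_shell J 6" "w \<in> plane_shell J 12"
    "A1 \<in> leaf_sets J l n (x + (l * 6 ^ n) *s v)" "A2 \<in> leaf_sets J l n (x + (l * 6 ^ n) *s w)"
  shows "A1 \<union> A2 \<in> leaf_sets J l (Suc n) x"
  using assms by force

lemma linf_norm_scale: "0 \<le> s \<Longrightarrow> linf_norm (s *s v) = s * linf_norm v"
proof (rule antisym)
  assume s: "0 \<le> s"
  show "linf_norm (s *s v) \<le> s * linf_norm v"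
    using s by (simp add: linf_norm_le_iff abs_mult mult_left_mono abs_nth_le_linf)
  obtain i where "\<bar>v $ i\<bar> = linf_norm v" using linf_norm_attained by blast
  then show "s * linf_norm v \<le> linf_norm (s *s v)"
    using s abs_nth_le_linf[of "s *s v" i] by (simp add: abs_mult)
qed

text \<open>A binary tree of depth \<open>n\<close> has \<open>2 ^ n - 1\<close> branchings, each
  with one choice from either shell.\<close>

lemma card_leaf_sets:
  "finite (leaf_sets J l n x) \<and> card (leaf_sets J l n x) \<le> (card (plane_shell J 6) * card (plane_shell J 12)) ^ (2 ^ n - 1)"
proof (induction n arbitrary: x)
  case (Suc n)
  define C where "C = card (plane_shell J 6) * card (plane_shell J 12)"
  define N where "N = C ^ (2 ^ n - 1)"
  let ?U = "\<lambda>v w. (\<lambda>(A, B). A \<union> B) ` (leaf_sets J l n (x + (l * 6 ^ n) *s v) \<times> leaf_sets J l n (x + (l * 6 ^ n) *s w))"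
  have IH: "finite (leaf_sets J l n y)" "card (leaf_sets J l n y) \<le> N" for y
    using Suc[of y] by (auto simp: N_def C_def)
  have U: "card (?U v w) \<le> N * N" for v w
  proof -
    have "card (?U v w) \<le> card (leaf_sets J l n (x + (l * 6 ^ n) *s v) \<times> leaf_sets J l n (x + (l * 6 ^ n) *s w))"
      by (intro card_image_le finite_cartesian_product IH)
    also have "\<dots> \<le> N * N" by (simp add: card_cartesian_product mult_le_mono IH)
    finally show ?thesis .
  qed
  have "card (leaf_sets J l (Suc n) x) \<le> (\<Sum>(v, w) \<in> plane_shell J 6 \<times> plane_shell J 12. card (?U v w))"
    unfolding leaf_sets.simps case_prod_unfold by (intro card_UN_le finite_cartesian_product) auto
  also have "\<dots> \<le> (\<Sum>(v, w) \<in> plane_shell J 6 \<times> plane_shell J 12. N * N)"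
    by (intro sum_mono) (use U in auto)
  also have "\<dots> = C * (N * N)" by (simp add: C_def card_cartesian_product)
  also have "\<dots> = C ^ (1 + (2 ^ n - 1) + (2 ^ n - 1))"
    by (simp only: N_def power_add power_one_right mult.assoc)
  also have "1 + (2 ^ n - 1) + (2 ^ n - 1) = (2 ^ Suc n - 1 :: nat)"
  proof -
    have "(1 :: nat) \<le> 2 ^ n" by simp
    then show ?thesis unfolding power_Suc by linarith
  qed
  finally have "card (leaf_sets J l (Suc n) x) \<le> C ^ (2 ^ Suc n - 1)" .
  moreover have "finite (leaf_sets J l (Suc n) x)" using IH by auto
  ultimately show ?case by (simp add: C_def)
qed simp

text \<open>Displacements of at most \<open>12 * l * 6 ^ k\<close> for \<open>k < n\<close> add up
  geometrically. The factor 5 clears the denominator, so that all distances remain integers.\<close>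

lemma leaf_sets_radius:
  assumes "1 \<le> l" "A \<in> leaf_sets J l n x" "z \<in> A"
  shows "5 * linf_norm (z - x) \<le> 12 * (6 ^ n - 1) * l"
  using assms(2,3)
proof (induction n arbitrary: x A)
  case (Suc n)
  from Suc.prems(1) obtain v w A1 A2 where *: "v \<in> plane_shell J 6" "w \<in> plane_shell J 12"
    "A1 \<in> leaf_sets J l n (x + (l * 6 ^ n) *s v)" "A2 \<in> leaf_sets J l n (x + (l * 6 ^ n) *s w)" "A = A1 \<union> A2"
    by (rule leaf_sets_SucE)
  have "\<exists>v. linf_norm v \<le> 12 \<and> 5 * linf_norm (z - (x + (l * 6 ^ n) *s v)) \<le> 12 * (6 ^ n - 1) * l"
  proof (cases "z \<in> A1")
    case True
    then show ?thesis using Suc.IH[OF *(3)] *(1) by (intro exI[of _ v]) (auto simp: plane_shell_def)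
  next
    case False
    then show ?thesis using Suc.IH[OF *(4)] *(2,5) Suc.prems(2)
      by (intro exI[of _ w]) (auto simp: plane_shell_def)
  qed
  then obtain v where v: "linf_norm v \<le> 12" "5 * linf_norm (z - (x + (l * 6 ^ n) *s v)) \<le> 12 * (6 ^ n - 1) * l"
    by blast
  have "linf_norm ((l * 6 ^ n) *s v) \<le> (l * 6 ^ n) * 12"
    using assms(1) v(1) by (simp add: linf_norm_scale mult_left_mono)
  then have "linf_norm (z - x) \<le> linf_norm (z - (x + (l * 6 ^ n) *s v)) + 12 * (l * 6 ^ n)"
    using linf_dist_triangle[of z x "x + (l * 6 ^ n) *s v"] by (simp add: mult.commute)
  with v(2) show ?case by (simp add: algebra_simps)
qed simp

text \<open>Sibling centres are at least \<open>12 - 6\<close> units of \<open>l * 6 ^ n\<close>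
  apart. Removing the two radii leaves
  \<open>30 * 6 ^ n - 24 * (6 ^ n - 1) = 6 ^ Suc n + 24\<close>. The additive 24 later gives room
  for frames of radius \<open>l\<close> around the leaves.\<close>

lemma leaf_sets_separated:
  assumes l: "1 \<le> l" and vw: "v \<in> plane_shell J 6" "w \<in> plane_shell J 12"
    and A: "A1 \<in> leaf_sets J l n (x + (l * 6 ^ n) *s v)" "A2 \<in> leaf_sets J l n (x + (l * 6 ^ n) *s w)"
    and y: "y \<in> A1" and z: "z \<in> A2"
  shows "l * (6 ^ Suc n + 24) \<le> 5 * linf_norm (y - z)"
proof -
  let ?L = "l * 6 ^ n"
  have "6 \<le> linf_norm (w - v)"
    using linf_dist_triangle[of w 0 v] vw by (simp add: plane_shell_def)
  then have "?L * 6 \<le> ?L * linf_norm (w - v)" using l by (intro mult_left_mono) auto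
  also have "\<dots> = linf_norm ((x + ?L *s v) - (x + ?L *s w))"
    using l linf_norm_scale[of ?L "w - v"]
    by (simp add: linf_norm_minus_commute[of "?L *s v"] vector_ssub_ldistrib)
  also have "\<dots> \<le> linf_norm ((x + ?L *s v) - y) + (linf_norm (y - z) + linf_norm (z - (x + ?L *s w)))"
    using linf_dist_triangle[of "x + ?L *s v" "x + ?L *s w" y] linf_dist_triangle[of y "x + ?L *s w" z]
    by linarith
  finally have "30 * ?L \<le> 5 * linf_norm (y - (x + ?L *s v)) + 5 * linf_norm (y - z) + 5 * linf_norm (z - (x + ?L *s w))"
    by (simp add: linf_norm_minus_commute)
  with leaf_sets_radius[OF l A(1) y] leaf_sets_radius[OF l A(2) z]
  show ?thesis by (simp add: algebra_simps)
qed

lemma leaf_sets_disjoint: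
  assumes "1 \<le> l" "v \<in> plane_shell J 6" "w \<in> plane_shell J 12"
    "A1 \<in> leaf_sets J l n (x + (l * 6 ^ n) *s v)" "A2 \<in> leaf_sets J l n (x + (l * 6 ^ n) *s w)"
  shows "A1 \<inter> A2 = {}"
proof (rule ccontr)
  assume "A1 \<inter> A2 \<noteq> {}"
  then obtain y where "y \<in> A1" "y \<in> A2" by auto
  then have "l * (6 ^ Suc n + 24) \<le> 0"
    using leaf_sets_separated[OF assms, of y y] by simp
  moreover have "0 < l * (6 ^ Suc n + 24)" using assms(1) by (intro mult_pos_pos) (auto intro: add_pos_pos)
  ultimately show False by simp
qed

lemma leaf_sets_card:
  assumes l: "1 \<le> l" and A: "A \<in> leaf_sets J l n x"
  shows "finite A \<and> card A = 2 ^ n"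
  using A
proof (induction n arbitrary: x A)
  case (Suc n)
  from Suc.prems(1) obtain v w A1 A2 where *: "v \<in> plane_shell J 6" "w \<in> plane_shell J 12"
    "A1 \<in> leaf_sets J l n (x + (l * 6 ^ n) *s v)" "A2 \<in> leaf_sets J l n (x + (l * 6 ^ n) *s w)" "A = A1 \<union> A2"
    by (rule leaf_sets_SucE)
  have "A1 \<inter> A2 = {}" by (rule leaf_sets_disjoint[OF l *(1-4)])
  then show ?case using Suc.IH[OF *(3)] Suc.IH[OF *(4)] *(5) by (simp add: card_Un_disjoint)
qed simp

lemma leaf_sets_plane:
  assumes "A \<in> leaf_sets J l n x" "x \<in> plane J"
  shows "A \<subseteq> plane J"
  using assms
proof (induction n arbitrary: x A)
  case (Suc n)
  from Suc.prems(1) obtain v w A1 A2 where *: "v \<in> plane_shell J 6" "w \<in> plane_shell J 12"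
    "A1 \<in> leaf_sets J l n (x + (l * 6 ^ n) *s v)" "A2 \<in> leaf_sets J l n (x + (l * 6 ^ n) *s w)" "A = A1 \<union> A2"
    by (rule leaf_sets_SucE)
  have "x + (l * 6 ^ n) *s v \<in> plane J" "x + (l * 6 ^ n) *s w \<in> plane J"
    using * Suc.prems(2) by (auto simp: plane_shell_def plane_def)
  then show ?case using Suc.IH[OF *(3)] Suc.IH[OF *(4)] *(5) by auto
qed simp

text \<open>The sibling subtree met at height \<open>k\<close> has \<open>2 ^ k\<close> leaves of
  weight at most \<open>c * 5 / 6 ^ Suc k\<close>, hence total weight
  \<open>5/6 * (1/3) ^ k * c\<close>; these sum to at most \<open>5/4 * c\<close>. Later
  \<open>W\<close> is a Green function in one case and its sum over a frame in the other.\<close>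

lemma leaf_sets_sum_le:
  fixes W :: "int ^ 'd::finite \<Rightarrow> real"
  assumes l: "1 \<le> l" and A: "A \<in> leaf_sets J l n x" and y: "y \<in> A" and c: "0 \<le> c"
    and W: "\<And>z k. l * (6 ^ Suc k + 24) \<le> 5 * linf_norm (y - z) \<Longrightarrow> W z \<le> c * (5 / 6 ^ Suc k)"
  shows "(\<Sum>z\<in>A - {y}. W z) \<le> 5 / 4 * (1 - (1 / 3) ^ n) * c"
  using A y
proof (induction n arbitrary: x A)
  case (Suc n)
  from Suc.prems(1) obtain v w A1 A2 where *: "v \<in> plane_shell J 6" "w \<in> plane_shell J 12"
    "A1 \<in> leaf_sets J l n (x + (l * 6 ^ n) *s v)" "A2 \<in> leaf_sets J l n (x + (l * 6 ^ n) *s w)" "A = A1 \<union> A2"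
    by (rule leaf_sets_SucE)
  have disj: "A1 \<inter> A2 = {}" by (rule leaf_sets_disjoint[OF l *(1-4)])
  have fin: "finite A1" "finite A2" and card: "card A1 = 2 ^ n" "card A2 = 2 ^ n"
    using leaf_sets_card[OF l *(3)] leaf_sets_card[OF l *(4)] by auto
  have other: "(\<Sum>z\<in>B. W z) \<le> 2 ^ n * (c * (5 / 6 ^ Suc n))"
    if "finite B" "card B = 2 ^ n" "\<And>z. z \<in> B \<Longrightarrow> l * (6 ^ Suc n + 24) \<le> 5 * linf_norm (y - z)" for B
  proof -
    have "(\<Sum>z\<in>B. W z) \<le> (\<Sum>z\<in>B. c * (5 / 6 ^ Suc n))"
      by (intro sum_mono W that)
    then show ?thesis by (simp add: that)
  qed
  have step: "5 / 4 * (1 - (1 / 3) ^ n) * c + 2 ^ n * (c * (5 / 6 ^ Suc n)) = 5 / 4 * (1 - (1 / 3) ^ Suc n) * c"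
  proof -
    have "2 ^ n * (c * (5 / 6 ^ Suc n)) = 5 / 6 * (2 ^ n / 6 ^ n) * c" by simp
    also have "(2 :: real) ^ n / 6 ^ n = (1 / 3) ^ n" by (simp flip: power_divide)
    finally have eq: "2 ^ n * (c * (5 / 6 ^ Suc n)) = 5 / 6 * (1 / 3) ^ n * c" .
    define t :: real where "t = (1 / 3) ^ n"
    show ?thesis unfolding eq unfolding power_Suc t_def[symmetric] by (simp add: field_simps)
  qed
  from Suc.prems(2) *(5) consider "y \<in> A1" | "y \<in> A2" by auto
  then show ?case
  proof cases
    case 1
    then have "A - {y} = (A1 - {y}) \<union> A2" using disj *(5) by auto
    then have "(\<Sum>z\<in>A - {y}. W z) = (\<Sum>z\<in>A1 - {y}. W z) + (\<Sum>z\<in>A2. W z)"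
      using fin disj by (simp add: sum.union_disjoint Diff_Int_distrib2)
    also have "\<dots> \<le> 5 / 4 * (1 - (1 / 3) ^ n) * c + 2 ^ n * (c * (5 / 6 ^ Suc n))"
      using leaf_sets_separated[OF l *(1-4) 1] by (intro add_mono Suc.IH[OF *(3) 1] other fin card)
    finally show ?thesis unfolding step .
  next
    case 2
    then have "A - {y} = (A2 - {y}) \<union> A1" using disj *(5) by auto
    moreover have "(A2 - {y}) \<inter> A1 = {}" using disj by auto
    ultimately have "(\<Sum>z\<in>A - {y}. W z) = (\<Sum>z\<in>A2 - {y}. W z) + (\<Sum>z\<in>A1. W z)"
      using fin by (simp add: sum.union_disjoint)
    also have "\<dots> \<le> 5 / 4 * (1 - (1 / 3) ^ n) * c + 2 ^ n * (c * (5 / 6 ^ Suc n))"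
      using leaf_sets_separated[OF l *(1-4) _ 2]
      by (intro add_mono Suc.IH[OF *(4) 2] other fin card) (simp add: linf_norm_minus_commute)
    finally show ?thesis unfolding step .
  qed
qed simp

section \<open>Crossings of annuli by star-connected sets\<close>

definition star_connected :: "(int ^ 'd::finite) set \<Rightarrow> bool" where
  "star_connected S \<longleftrightarrow> (\<forall>a\<in>S. \<forall>b\<in>S. (\<lambda>a b. a \<in> S \<and> b \<in> S \<and> linf_norm (a - b) \<le> 1)\<^sup>*\<^sup>* a b)"

text \<open>A step changes the distance to \<open>x\<close> by at most 1, so no integer radius is
  skipped.\<close>

lemma star_connected_meets_sphere:
  assumes S: "star_connected S" and p: "p \<in> S" "linf_norm (p - x) \<le> r" and q: "q \<in> S" "r \<le> linf_norm (q - x)"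
  shows "\<exists>z\<in>S. linf_norm (z - x) = r"
proof -
  have "(\<lambda>a b. a \<in> S \<and> b \<in> S \<and> linf_norm (a - b) \<le> 1)\<^sup>*\<^sup>* p q"
    using S p q by (simp add: star_connected_def)
  then show ?thesis using q(2)
  proof (induction rule: rtranclp_induct)
    case base
    then show ?case using p by (intro bexI[of _ p]) auto
  next
    case (step y z)
    show ?case
    proof (cases "r \<le> linf_norm (y - x)")
      case False
      have "linf_norm (z - x) \<le> linf_norm (y - z) + linf_norm (y - x)"
        using linf_dist_triangle[of z x y] by (simp add: linf_norm_minus_commute)
      then have "linf_norm (z - x) = r" using False step by linarith
      then show ?thesis using step by auto
    qed (use step in auto)
  qed
qed

text \<open>Rounding down to multiples of \<open>L\<close> respects the bounds
  \<open>- k * L\<close> and \<open>k * L\<close>, and it fixes a coordinate of maximal modulus,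
  which is itself a multiple of \<open>L\<close>. So the norm is exactly \<open>k\<close> after
  rescaling, and rounding moves each coordinate by at most \<open>L - 1\<close>.\<close>

lemma round_to_sublattice:
  assumes L: "1 \<le> L" and z: "linf_norm z = k * L" "z \<in> plane J"
  obtains v where "v \<in> plane_shell J k" "linf_norm (z - L *s v) \<le> L - 1"
proof (rule that[of "\<chi> i. z $ i div L"])
  let ?v = "\<chi> i. z $ i div L"
  have z_le: "- (k * L) \<le> z $ i" "z $ i \<le> k * L" for i
    using abs_nth_le_linf[of z i] z by auto
  have "(- k) \<le> z $ i div L" "z $ i div L \<le> k" for i
    using zdiv_mono1[OF z_le(1), of L i] zdiv_mono1[OF z_le(2), of L i] L
    by (simp_all add: minus_mult_left del: mult_minus_left)
  then have le: "\<bar>?v $ i\<bar> \<le> k" for i by (simp add: abs_le_iff minus_le_iff)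
  obtain i where "\<bar>z $ i\<bar> = k * L" using linf_norm_attained[of z] z by auto
  then have "z $ i = k * L \<or> z $ i = (- k) * L" by auto
  moreover have "(k * L) div L = k" "((- k) * L) div L = - k"
    using L by (simp_all only: nonzero_mult_div_cancel_right)
  ultimately have "\<bar>?v $ i\<bar> = \<bar>k\<bar>" by auto
  then have "linf_norm ?v = k"
    using le abs_nth_le_linf[of ?v i] by (intro antisym) (auto simp: linf_norm_le_iff)
  then show "?v \<in> plane_shell J k" using z(2) by (simp add: plane_shell_def plane_def)
  have "\<bar>(z - L *s ?v) $ i\<bar> \<le> L - 1" for i
    using pos_mod_bound[of L "z $ i"] pos_mod_sign[of L "z $ i"] L
    by (simp add: minus_mult_div_eq_mod)
  then show "linf_norm (z - L *s ?v) \<le> L - 1" unfolding linf_norm_le_iff by blast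
qed

text \<open>The invariant says that \<open>S\<close> crosses the annulus around the root from
  \<open>L - 1\<close> to \<open>2 * L\<close> at its scale. With \<open>L\<close> the scale of the
  children, \<open>S\<close> has points at distances \<open>6 * L\<close> and \<open>12 * L\<close>;
  rounding them gives the children at the cost \<open>L - 1\<close> that the invariant allows. Each
  of the two points is at least \<open>6 * L\<close> from the other's child and serves as its far
  end.\<close>

lemma crossing_leaves:
  assumes l: "1 \<le> l" and S: "star_connected S" "S \<subseteq> plane J" and x: "x \<in> plane J"
    and p: "p \<in> S" "linf_norm (p - x) \<le> l * 6 ^ n - 1"
    and q: "q \<in> S" "2 * (l * 6 ^ n) \<le> linf_norm (q - x)"
  shows "\<exists>A\<in>leaf_sets J l n x. \<forall>y\<in>A. (\<exists>p\<in>S. linf_norm (p - y) \<le> l - 1) \<and> (\<exists>q\<in>S. 2 * l \<le> linf_norm (q - y))"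
  using x p q
proof (induction n arbitrary: x p q)
  case 0
  then show ?case by auto
next
  case (Suc n)
  define L where "L = l * 6 ^ n"
  have L: "1 \<le> L" using l unfolding L_def by (simp add: int_one_le_iff_zero_less)
  have px: "linf_norm (p - x) \<le> 6 * L" and qx: "12 * L \<le> linf_norm (q - x)"
    using Suc.prems by (auto simp: L_def)
  obtain z1 where z1: "z1 \<in> S" "linf_norm (z1 - x) = 6 * L"
    using star_connected_meets_sphere[OF S(1) \<open>p \<in> S\<close> px \<open>q \<in> S\<close>] qx L by auto
  obtain z2 where z2: "z2 \<in> S" "linf_norm (z2 - x) = 12 * L"
    using star_connected_meets_sphere[OF S(1) \<open>p \<in> S\<close> _ \<open>q \<in> S\<close> qx] px L by auto
  have plane: "z1 - x \<in> plane J" "z2 - x \<in> plane J"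
    using z1 z2 S(2) Suc.prems(1) by (auto simp: plane_def)
  obtain v where v: "v \<in> plane_shell J 6" "linf_norm (z1 - x - L *s v) \<le> L - 1"
    using round_to_sublattice[OF L z1(2) plane(1)] by blast
  obtain w where w: "w \<in> plane_shell J 12" "linf_norm (z2 - x - L *s w) \<le> L - 1"
    using round_to_sublattice[OF L z2(2) plane(2)] by blast
  let ?y1 = "x + L *s v" and ?y2 = "x + L *s w"
  have norms: "linf_norm (L *s v) = 6 * L" "linf_norm (L *s w) = 12 * L"
    using v w L by (auto simp: linf_norm_scale plane_shell_def)
  have y: "?y1 \<in> plane J" "?y2 \<in> plane J"
    using v w Suc.prems(1) by (auto simp: plane_shell_def plane_def)
  have far1: "2 * L \<le> linf_norm (z2 - ?y1)"
    using linf_dist_triangle[of z2 x ?y1] z2 norms L by simp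
  have far2: "2 * L \<le> linf_norm (z1 - ?y2)"
    using linf_dist_triangle[of ?y2 x z1] linf_norm_minus_commute[of z1 ?y2] z1 norms L by simp
  have "\<exists>A\<in>leaf_sets J l n ?y1. \<forall>y\<in>A. (\<exists>p\<in>S. linf_norm (p - y) \<le> l - 1) \<and> (\<exists>q\<in>S. 2 * l \<le> linf_norm (q - y))"
    using v(2) far1 by (intro Suc.IH[OF y(1) z1(1) _ z2(1)]) (auto simp: L_def diff_diff_eq)
  then obtain A1 where A1: "A1 \<in> leaf_sets J l n ?y1"
    "\<forall>y\<in>A1. (\<exists>p\<in>S. linf_norm (p - y) \<le> l - 1) \<and> (\<exists>q\<in>S. 2 * l \<le> linf_norm (q - y))" by blast
  have "\<exists>A\<in>leaf_sets J l n ?y2. \<forall>y\<in>A. (\<exists>p\<in>S. linf_norm (p - y) \<le> l - 1) \<and> (\<exists>q\<in>S. 2 * l \<le> linf_norm (q - y))"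
    using w(2) far2 by (intro Suc.IH[OF y(2) z2(1) _ z1(1)]) (auto simp: L_def diff_diff_eq)
  then obtain A2 where A2: "A2 \<in> leaf_sets J l n ?y2"
    "\<forall>y\<in>A2. (\<exists>p\<in>S. linf_norm (p - y) \<le> l - 1) \<and> (\<exists>q\<in>S. 2 * l \<le> linf_norm (q - y))" by blast
  have "A1 \<union> A2 \<in> leaf_sets J l (Suc n) x"
    using v w A1 A2 by (intro leaf_sets_SucI) (auto simp: L_def)
  then show ?case using A1 A2 by (intro bexI[of _ "A1 \<union> A2"]) auto
qed

section \<open>The upper bound\<close>

lemma green_decay_eq:
  assumes "CARD('d::finite) \<ge> 3"
  shows "green_decay x (y :: int ^ 'd) = 1 / real_of_int (max (linf_norm (x - y)) 1) ^ (CARD('d) - 2)"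
proof -
  have "2 - int CARD('d) = - int (CARD('d) - 2)" using assms by simp
  then show ?thesis
    unfolding green_decay_def by (simp only: power_int_minus power_int_of_nat inverse_eq_divide)
qed

lemma interlacement_law_props:
  assumes d: "CARD('d::finite) \<ge> 3" and u: "0 \<le> u"
  shows "prob_space (interlacement_law u :: (int ^ 'd) set measure)"
    "sets (interlacement_law u :: (int ^ 'd) set measure) = sets config_space"
    "space (interlacement_law u :: (int ^ 'd) set measure) = UNIV"
    "\<And>K :: (int ^ 'd) set. finite K \<Longrightarrow> measure (interlacement_law u) {I. I \<inter> K = {}} = exp (- u * capacity K)"
proof -
  note law = is_interlacement_law[OF assms, unfolded is_interlacement_law_def]
  show "prob_space (interlacement_law u :: (int ^ 'd) set measure)"
    and sets: "sets (interlacement_law u :: (int ^ 'd) set measure) = sets config_space"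
    and "\<And>K :: (int ^ 'd) set. finite K \<Longrightarrow> measure (interlacement_law u) {I. I \<inter> K = {}} = exp (- u * capacity K)"
    using law by auto
  show "space (interlacement_law u :: (int ^ 'd) set measure) = UNIV"
    using sets_eq_imp_space_eq[OF sets] by simp
qed

lemma component_subset: "x \<in> V \<Longrightarrow> component V x \<subseteq> V"
proof
  fix y assume x: "x \<in> V" and "y \<in> component V x"
  then have "(\<lambda>a b. a \<in> V \<and> b \<in> V \<and> lattice_adj a b)\<^sup>*\<^sup>* x y" by (simp add: component_def)
  then show "y \<in> V" by (induction rule: rtranclp_induct) (use x in auto)
qed

lemma star_connectedI_root:
  assumes "\<And>a. a \<in> S \<Longrightarrow> (\<lambda>a b. a \<in> S \<and> b \<in> S \<and> linf_norm (a - b) \<le> 1)\<^sup>*\<^sup>* x a"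
  shows "star_connected S"
  unfolding star_connected_def
proof (intro ballI)
  let ?R = "\<lambda>a b. a \<in> S \<and> b \<in> S \<and> linf_norm (a - b) \<le> 1"
  fix a b assume ab: "a \<in> S" "b \<in> S"
  have "symp ?R" by (auto simp: symp_def linf_norm_minus_commute)
  then have "?R\<^sup>*\<^sup>* a x" using assms[OF ab(1)] by (rule sympD[OF symp_rtranclp])
  then show "?R\<^sup>*\<^sup>* a b" using assms[OF ab(2)] by (rule rtranclp_trans)
qed

lemma star_connected_component: "star_connected (component V x)"
proof (rule star_connectedI_root[of _ x])
  fix a assume "a \<in> component V x"
  then have "(\<lambda>a b. a \<in> V \<and> b \<in> V \<and> lattice_adj a b)\<^sup>*\<^sup>* x a" by (simp add: component_def)
  then show "(\<lambda>a b. a \<in> component V x \<and> b \<in> component V x \<and> linf_norm (a - b) \<le> 1)\<^sup>*\<^sup>* x a"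
  proof (induction rule: rtranclp_induct)
    case (step y z)
    have "y \<in> component V x" using step(1) by (simp add: component_def)
    moreover have "z \<in> component V x"
      using rtranclp.rtrancl_into_rtrancl[OF step(1,2)] by (simp add: component_def)
    ultimately show ?case
      using step(2,3) lattice_adj_linf by (intro rtranclp.rtrancl_into_rtrancl[OF step(3)]) auto
  qed simp
qed

lemma infinite_unbounded:
  assumes "infinite S"
  shows "\<exists>q\<in>S. r \<le> linf_norm q"
proof (rule ccontr)
  assume "\<not> (\<exists>q\<in>S. r \<le> linf_norm q)"
  then have "S \<subseteq> {x. linf_norm (x - 0) \<le> r}" by auto
  with assms show False using finite_linf_ball finite_subset by blast
qed

lemma six_power_gt: "\<exists>N. \<forall>n\<ge>N. (k :: int) < 6 ^ n"
proof (intro exI[of _ "nat k"] allI impI)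
  fix n assume "nat k \<le> n"
  then have "k \<le> int n" by simp
  also have "int n < 2 ^ n" by (rule of_nat_less_two_power)
  also have "(2 :: int) ^ n \<le> 6 ^ n" by (rule power_mono) auto
  finally show "k < 6 ^ n" .
qed

text \<open>With \<open>l = 1\<close>, coming within \<open>l - 1\<close> of a leaf means containing
  it. The component starts inside the inner sphere once \<open>6 ^ n\<close> exceeds the norm of
  \<open>x\<close>, and it is unbounded, so it crosses at every large scale.\<close>

lemma infinite_component_leaves:
  assumes "has_infinite_component (V :: (int ^ 'd::finite) set)"
  shows "\<exists>N. \<forall>n\<ge>N. \<exists>A\<in>leaf_sets UNIV 1 n 0. A \<subseteq> V"
proof -
  obtain x where x: "x \<in> V" "infinite (component V x)"
    using assms by (auto simp: has_infinite_component_def)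
  obtain N where N: "\<And>n. n \<ge> N \<Longrightarrow> linf_norm x < 6 ^ n" using six_power_gt by blast
  have "\<exists>A\<in>leaf_sets UNIV 1 n 0. A \<subseteq> V" if n: "n \<ge> N" for n
  proof -
    obtain q where q: "q \<in> component V x" "2 * 6 ^ n \<le> linf_norm q"
      using infinite_unbounded[OF x(2)] by blast
    have "x \<in> component V x" by (simp add: component_def)
    then have "\<exists>A\<in>leaf_sets UNIV 1 n 0. \<forall>y\<in>A. (\<exists>p\<in>component V x. linf_norm (p - y) \<le> 1 - 1)
        \<and> (\<exists>q\<in>component V x. 2 * 1 \<le> linf_norm (q - y))"
      using N[OF n] q
      by (intro crossing_leaves[OF _ star_connected_component, where p = x and q = q]) (auto simp: plane_def)
    then obtain A where A: "A \<in> leaf_sets UNIV 1 n 0" "\<And>y. y \<in> A \<Longrightarrow> \<exists>p\<in>component V x. linf_norm (p - y) \<le> 0"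
      by auto
    have "y \<in> V" if y: "y \<in> A" for y
    proof -
      obtain p where p: "p \<in> component V x" "linf_norm (p - y) \<le> 0" using A(2)[OF y] by auto
      then have "linf_norm (p - y) = 0" using linf_norm_nonneg[of "p - y"] by linarith
      then show ?thesis using component_subset[OF x(1)] p(1) by auto
    qed
    with A show ?thesis by auto
  qed
  then show ?thesis by auto
qed

text \<open>The row sums of the Green function are at most \<open>9/4 * C_g\<close>: 1 for the
  diagonal and 5/4 for the other leaves. In every dimension from 3 on, the decay is at least as fast
  as the inverse distance, which is what the geometric series requires.\<close>

lemma capacity_leaves:
  assumes d: "CARD('d::finite) \<ge> 3" and A: "A \<in> leaf_sets J 1 n (x :: int ^ 'd)"
  shows "2 ^ n \<le> 9 / 4 * C_green TYPE('d) * capacity A"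
proof -
  let ?C = "C_green TYPE('d)"
  have C: "1 \<le> ?C" by (rule C_green_ge_1[OF d])
  have fin: "finite A" and card: "card A = 2 ^ n" using leaf_sets_card[OF _ A] by auto
  have "(\<Sum>z\<in>A. green y z) \<le> 9 / 4 * ?C" if y: "y \<in> A" for y
  proof -
    have "(\<Sum>z\<in>A - {y}. green y z) \<le> 5 / 4 * (1 - (1 / 3) ^ n) * ?C"
    proof (rule leaf_sets_sum_le[OF _ A y])
      fix z k assume *: "1 * (6 ^ Suc k + 24) \<le> 5 * linf_norm (y - z)"
      then have int_le: "6 ^ Suc k \<le> 5 * linf_norm (y - z)" by simp
      have "real_of_int (6 ^ Suc k) \<le> real_of_int (5 * linf_norm (y - z))"
        using int_le by (simp only: of_int_le_iff)
      then have m: "6 ^ Suc k \<le> 5 * real_of_int (linf_norm (y - z))" by simp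
      have "0 < linf_norm (y - z)" using int_le zero_less_power[of "6 :: int" "Suc k"] by linarith
      then have m1: "1 \<le> real_of_int (linf_norm (y - z))" by simp
      have "green_decay y z \<le> 1 / real_of_int (linf_norm (y - z))"
      proof -
        have "real_of_int (linf_norm (y - z)) ^ 1 \<le> real_of_int (linf_norm (y - z)) ^ (CARD('d) - 2)"
          using d m1 by (intro power_increasing) auto
        then show ?thesis unfolding green_decay_eq[OF d] using m1 by (intro divide_left_mono) (auto simp: max_def)
      qed
      also have "\<dots> \<le> 5 / 6 ^ Suc k" using m m1 by (simp add: field_simps)
      finally have "?C * green_decay y z \<le> ?C * (5 / 6 ^ Suc k)" using C by (intro mult_left_mono) auto
      then show "green y z \<le> ?C * (5 / 6 ^ Suc k)" using green_le_C_green[OF d, of y z] by linarith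
    qed (use C in auto)
    also have "\<dots> \<le> 5 / 4 * 1 * ?C" using C by (intro mult_right_mono mult_left_mono) auto
    finally show ?thesis
      using fin y green_le_C_green[OF d, of y y] by (simp add: sum.remove[of A y])
  qed
  from card_le_capacity[OF d fin this] show ?thesis by (simp add: card)
qed

lemma card_shells_C_comb:
  "real (card (plane_shell J 6) * card (plane_shell J 12)) = C_comb (card J)"
  by (simp add: C_comb_def card_plane_shell)

lemma C_comb_ge_1:
  assumes "1 \<le> k"
  shows "1 \<le> C_comb k"
proof -
  have pos: "1 \<le> (b :: real) ^ k - a ^ k" if "0 \<le> a" "a + 1 \<le> b" for a b :: real
  proof -
    have "a ^ k + 1 ^ k \<le> (a + 1) ^ k"
      using assms that(1)
    proof (induction k rule: nat_induct_at_least)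
      case (Suc k)
      have "a ^ Suc k + 1 ^ Suc k \<le> (a + 1) * (a ^ k + 1 ^ k)"
        using Suc.prems by (simp add: algebra_simps)
      also have "\<dots> \<le> (a + 1) * (a + 1) ^ k" using Suc by (intro mult_left_mono) auto
      finally show ?case by simp
    qed simp
    also have "\<dots> \<le> b ^ k" using that by (intro power_mono) auto
    finally show ?thesis by simp
  qed
  have "1 * 1 \<le> ((13 :: real) ^ k - 11 ^ k) * (25 ^ k - 23 ^ k)"
  proof (rule mult_mono)
    show "0 \<le> (13 :: real) ^ k - 11 ^ k" using pos[of 11 13] by linarith
  qed (use pos[of 11 13] pos[of 23 25] in auto)
  then show ?thesis by (simp add: C_comb_def)
qed

lemma power_two_power_tendsto_0:
  fixes \<rho> :: real
  assumes "0 \<le> \<rho>" "\<rho> < 1"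
  shows "(\<lambda>n. \<rho> ^ (2 ^ n)) \<longlonglongrightarrow> 0"
proof (rule Lim_null_comparison[OF _ LIMSEQ_power_zero[of \<rho>]])
  show "\<forall>\<^sub>F n in sequentially. norm (\<rho> ^ (2 ^ n)) \<le> \<rho> ^ n"
  proof (intro always_eventually allI)
    fix n :: nat
    have "\<rho> ^ (2 ^ n) \<le> \<rho> ^ n"
      using assms less_exp[of n] by (intro power_decreasing) auto
    then show "norm (\<rho> ^ (2 ^ n)) \<le> \<rho> ^ n" using assms by simp
  qed
qed (use assms in auto)

lemma no_infinite_component_above:
  assumes d: "CARD('d::finite) \<ge> 3" and u: "5 / 2 * C_green TYPE('d) * ln (C_comb CARD('d)) < u"
  shows "measure (interlacement_law u) {I :: (int ^ 'd) set. has_infinite_component (- I)} = 0"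
proof -
  let ?C = "C_comb CARD('d)" and ?G = "C_green TYPE('d)"
  have G: "1 \<le> ?G" by (rule C_green_ge_1[OF d])
  have C: "1 \<le> ?C" using d by (intro C_comb_ge_1) simp
  have u0: "0 < u" 
  proof -
    have "0 \<le> 5 / 2 * ?G * ln ?C" using G C by (intro mult_nonneg_nonneg) auto
    with u show ?thesis by linarith
  qed
  define Q :: "(int ^ 'd) set measure" where "Q = interlacement_law u"
  interpret Q: prob_space Q unfolding Q_def by (rule interlacement_law_props(1)[OF d]) (use u0 in simp)
  have sets_Q: "sets Q = sets config_space" unfolding Q_def by (rule interlacement_law_props(2)[OF d]) (use u0 in simp)
  \<comment> \<open>Number of trees times void probability, per leaf. The hypothesis on
    \<open>u\<close> says precisely that this is below 1.\<close>
  define \<rho> where "\<rho> = ?C * exp (- u / (5 / 2 * ?G))"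
  have \<rho>: "0 \<le> \<rho>" "\<rho> < 1"
  proof -
    show "0 \<le> \<rho>" using C by (simp add: \<rho>_def)
    have "ln ?C < u / (5 / 2 * ?G)" using u G by (simp add: field_simps)
    then have "exp (ln ?C) < exp (u / (5 / 2 * ?G))" by simp
    then show "\<rho> < 1" using C by (simp add: \<rho>_def exp_minus field_simps)
  qed
  define E where "E n = (\<Union>A\<in>leaf_sets UNIV 1 n 0. {I :: (int ^ 'd) set. I \<inter> A = {}})" for n
  have fin: "finite A" if "A \<in> leaf_sets UNIV 1 n 0" for A n
    using leaf_sets_card[OF _ that] by simp
  have void_sets: "{I :: (int ^ 'd) set. I \<inter> A = {}} \<in> sets Q" if "A \<in> leaf_sets UNIV 1 n 0" for A n
    unfolding sets_Q using fin[OF that] by (rule void_measurable)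
  have fin_leaves: "finite (leaf_sets UNIV 1 n (0 :: int ^ 'd))" for n using card_leaf_sets by blast
  have E_sets: "E n \<in> sets Q" for n
    unfolding E_def using void_sets fin_leaves by (intro sets.finite_UN) auto
  have E_prob: "measure Q (E n) \<le> \<rho> ^ (2 ^ n)" for n
  proof -
    have "measure Q (E n) \<le> (\<Sum>A\<in>leaf_sets UNIV 1 n 0. measure Q {I. I \<inter> A = {}})"
      unfolding E_def using void_sets by (intro Q.finite_measure_subadditive_finite fin_leaves) auto
    also have "\<dots> \<le> (\<Sum>A\<in>leaf_sets UNIV 1 n (0 :: int ^ 'd). exp (- u / (5 / 2 * ?G)) ^ (2 ^ n))"
    proof (rule sum_mono)
      fix A assume A: "A \<in> leaf_sets UNIV 1 n (0 :: int ^ 'd)"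
      have "2 ^ n \<le> 9 / 4 * ?G * capacity A" by (rule capacity_leaves[OF d A])
      also have "\<dots> \<le> 5 / 2 * ?G * capacity A"
        using G capacity_nonneg by (intro mult_right_mono) auto
      finally have "2 ^ n / (5 / 2 * ?G) \<le> capacity A" using G by (simp add: field_simps)
      then have "u * (2 ^ n / (5 / 2 * ?G)) \<le> u * capacity A" using u0 by (intro mult_left_mono) auto
      then have "exp (- u * capacity A) \<le> exp (2 ^ n * (- u / (5 / 2 * ?G)))" by (simp add: mult_ac)
      also have "\<dots> = exp (- u / (5 / 2 * ?G)) ^ (2 ^ n)" by (simp flip: exp_of_nat_mult)
      finally show "measure Q {I. I \<inter> A = {}} \<le> exp (- u / (5 / 2 * ?G)) ^ (2 ^ n)"
        unfolding Q_def using interlacement_law_props(4)[OF d _ fin[OF A]] u0 by simp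
    qed
    also have "\<dots> = real (card (leaf_sets UNIV 1 n (0 :: int ^ 'd))) * exp (- u / (5 / 2 * ?G)) ^ (2 ^ n)" by simp
    also have "\<dots> \<le> ?C ^ (2 ^ n) * exp (- u / (5 / 2 * ?G)) ^ (2 ^ n)"
    proof (rule mult_right_mono)
      have "real (card (leaf_sets UNIV 1 n (0 :: int ^ 'd)))
          \<le> real ((card (plane_shell (UNIV :: 'd set) 6) * card (plane_shell (UNIV :: 'd set) 12)) ^ (2 ^ n - 1))"
        using card_leaf_sets[of UNIV 1 n "0 :: int ^ 'd"] by (simp only: of_nat_le_iff)
      also have "\<dots> = ?C ^ (2 ^ n - 1)" by (simp only: of_nat_power card_shells_C_comb)
      also have "\<dots> \<le> ?C ^ (2 ^ n)" using C by (intro power_increasing) auto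
      finally show "real (card (leaf_sets UNIV 1 n (0 :: int ^ 'd))) \<le> ?C ^ (2 ^ n)" .
    qed simp
    also have "\<dots> = \<rho> ^ (2 ^ n)" by (simp add: \<rho>_def power_mult_distrib)
    finally show ?thesis .
  qed
  \<comment> \<open>An infinite component forces \<open>E n\<close> for all large \<open>n\<close>.
    The probability of \<open>B N\<close> is below \<open>\<rho> ^ (2 ^ n)\<close> for every
    \<open>n \<ge> N\<close>, hence zero.\<close>
  define B where "B N = (\<Inter>n\<in>{N..}. E n)" for N
  have B_null: "B N \<in> null_sets Q" for N
  proof -
    have B_sets: "B N \<in> sets Q" unfolding B_def using E_sets by (intro sets.countable_INT) auto
    have "\<forall>\<^sub>F n in sequentially. measure Q (B N) \<le> \<rho> ^ (2 ^ n)"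
      using eventually_ge_at_top[of N]
    proof eventually_elim
      case (elim n)
      then have "measure Q (B N) \<le> measure Q (E n)"
        unfolding B_def using E_sets by (intro Q.finite_measure_mono) auto
      with E_prob[of n] show ?case by linarith
    qed
    then have "measure Q (B N) \<le> 0"
      using tendsto_lowerbound[OF power_two_power_tendsto_0[OF \<rho>]] by simp
    then have "measure Q (B N) = 0" using measure_nonneg[of Q "B N"] by linarith
    with B_sets show ?thesis by (simp add: null_sets_def Q.emeasure_eq_measure)
  qed
  then have U: "(\<Union>N. B N) \<in> null_sets Q" by (rule null_sets_UN)
  have "{I :: (int ^ 'd) set. has_infinite_component (- I)} \<subseteq> (\<Union>N. B N)"
  proof
    fix I :: "(int ^ 'd) set" assume "I \<in> {I. has_infinite_component (- I)}"
    then obtain N where N: "\<And>n. n \<ge> N \<Longrightarrow> \<exists>A\<in>leaf_sets UNIV 1 n 0. A \<subseteq> - I"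
      using infinite_component_leaves[of "- I"] by blast
    have "I \<in> E n" if n: "n \<ge> N" for n
    proof -
      obtain A where "A \<in> leaf_sets UNIV 1 n 0" "A \<subseteq> - I" using N[OF n] by blast
      moreover from this have "I \<inter> A = {}" by blast
      ultimately show ?thesis unfolding E_def by blast
    qed
    then show "I \<in> (\<Union>N. B N)" unfolding B_def by blast
  qed
  then have "measure Q {I :: (int ^ 'd) set. has_infinite_component (- I)} \<le> measure Q (\<Union>N. B N)"
    using U by (intro Q.finite_measure_mono) auto
  also have "\<dots> = 0" using U by (simp add: null_sets_def measure_def)
  finally show ?thesis unfolding Q_def using measure_nonneg by (intro antisym)
qed

section \<open>Planar duality\<close>

definition adj4 :: "int \<times> int \<Rightarrow> int \<times> int \<Rightarrow> bool" where
  "adj4 p q \<longleftrightarrow> \<bar>fst p - fst q\<bar> + \<bar>snd p - snd q\<bar> = 1"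

definition adj8 :: "int \<times> int \<Rightarrow> int \<times> int \<Rightarrow> bool" where
  "adj8 p q \<longleftrightarrow> \<bar>fst p - fst q\<bar> \<le> 1 \<and> \<bar>snd p - snd q\<bar> \<le> 1"

lemma adj4_cases:
  assumes "adj4 p q"
  obtains "q = (fst p + 1, snd p)" | "p = (fst q + 1, snd q)" | "q = (fst p, snd p + 1)" | "p = (fst q, snd q + 1)"
proof -
  have "(fst q = fst p + 1 \<and> snd q = snd p) \<or> (fst p = fst q + 1 \<and> snd q = snd p)
      \<or> (fst q = fst p \<and> snd q = snd p + 1) \<or> (fst q = fst p \<and> snd p = snd q + 1)"
    using assms unfolding adj4_def by linarith
  then show ?thesis using that by (metis prod.collapse)
qed

lemma sum_int_telescope:
  fixes h :: "int \<Rightarrow> int"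
  assumes "a \<le> b"
  shows "(\<Sum>j\<in>{a..<b}. h j - h (j + 1)) = h a - h b"
  using assms
proof (induction b rule: int_ge_induct)
  case (step b)
  then have "{a..<b + 1} = insert b {a..<b}" by auto
  then show ?case using step by simp
qed simp

text \<open>
  For a \<open>*\<close>-component \<open>C\<close> of the boundary of \<open>A\<close>, the signed indicator \<open>w\<close> of the edges between
  \<open>A\<close> and \<open>C\<close> is a closed 1-form: around a unit square that meets \<open>C\<close> it is the differential of the
  indicator of \<open>A\<close>, since all four corners are \<open>*\<close>-adjacent. Its potential \<open>f\<close> is constant on \<open>A\<close>,
  so a flow of \<open>C\<close> across the positive axis must be balanced on the negative axis.
\<close>

lemma planar_boundary_meets_negative_axis:
  fixes A :: "(int \<times> int) set"
  assumes fin: "finite A" and conn: "\<And>a. a \<in> A \<Longrightarrow> (\<lambda>a b. a \<in> A \<and> b \<in> A \<and> adj4 a b)\<^sup>*\<^sup>* (0, 0) a"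
    and origin: "(0, 0) \<in> A"
  defines "D \<equiv> {y. y \<notin> A \<and> (\<exists>x\<in>A. adj4 x y)}"
  shows "\<exists>m m'. 0 < m \<and> 0 < m' \<and> (m, 0) \<in> D \<and> (\<lambda>a b. a \<in> D \<and> b \<in> D \<and> adj8 a b)\<^sup>*\<^sup>* (m, 0) (- m', 0)"
proof -
  let ?R = "\<lambda>a b. a \<in> D \<and> b \<in> D \<and> adj8 a b"
  define X where "X = {a. (a, 0) \<in> A}"
  have "X \<subseteq> fst ` A" by (force simp: X_def)
  then have finX: "finite X" using fin finite_surj by blast
  have X0: "0 \<in> X" using origin by (simp add: X_def)
  \<comment> \<open>The first site behind the last point of \<open>A\<close> on the positive axis,
    so the axis has no further edge from \<open>A\<close> beyond it.\<close>
  define m where "m = Max X + 1"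
  have "Max X \<in> X" using finX X0 by (intro Max_in) auto
  then have m1: "(m - 1, 0) \<in> A" by (simp add: m_def X_def)
  have beyond: "(a, 0) \<notin> A" if "m \<le> a" for a
    using Max_ge[OF finX, of a] that by (auto simp: m_def X_def)
  have m_pos: "0 < m" using Max_ge[OF finX X0] by (simp add: m_def)
  have mD: "(m, 0) \<in> D"
    unfolding D_def using beyond[of m] m1 by (auto simp: adj4_def intro!: bexI[of _ "(m - 1, 0)"])
  define C where "C = {y. ?R\<^sup>*\<^sup>* (m, 0) y}"
  have mC: "(m, 0) \<in> C" by (simp add: C_def)
  have CD: "y \<in> D" if "y \<in> C" for y
  proof -
    have "?R\<^sup>*\<^sup>* (m, 0) y" using that by (simp add: C_def)
    then show ?thesis by (induction rule: rtranclp_induct) (use mD in auto)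
  qed
  have CA: "y \<notin> A" if "y \<in> C" for y using CD[OF that] by (simp add: D_def)
  have C_ext: "z \<in> C" if "y \<in> C" "z \<in> D" "adj8 y z" for y z
  proof -
    have "?R y z" using that CD by auto
    then show ?thesis using that(1) unfolding C_def by (auto intro: rtranclp.rtrancl_into_rtrancl)
  qed
  define w where "w x y = (if x \<in> A \<and> y \<in> C then 1 else if y \<in> A \<and> x \<in> C then - 1 else 0 :: int)" for x y
  have w_anti: "w y x = - w x y" for x y using CA by (auto simp: w_def)

  obtain M where M: "\<And>p. p \<in> A \<union> C \<Longrightarrow> \<bar>fst p\<bar> < M \<and> \<bar>snd p\<bar> < M" and M0: "0 < M"
  proof -
    have finI: "finite ((\<lambda>p. \<bar>fst p\<bar> + \<bar>snd p\<bar>) ` A)" using fin by simp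
    define B where "B = Max ((\<lambda>p. \<bar>fst p\<bar> + \<bar>snd p\<bar>) ` A)"
    have B: "\<bar>fst p\<bar> + \<bar>snd p\<bar> \<le> B" if "p \<in> A" for p
      unfolding B_def using finI that by (intro Max_ge) auto
    have B0: "0 \<le> B" using B[OF origin] by simp
    have C_bd: "\<bar>fst p\<bar> + \<bar>snd p\<bar> \<le> B + 1" if p: "p \<in> C" for p
    proof -
      obtain x where "x \<in> A" "adj4 x p" using CD[OF p] by (auto simp: D_def)
      then show ?thesis using B[of x] unfolding adj4_def by linarith
    qed
    have "\<bar>fst p\<bar> < B + 2 \<and> \<bar>snd p\<bar> < B + 2" if "p \<in> A \<union> C" for p
      using that B[of p] C_bd[of p] by (auto; linarith)
    then show thesis using that[of "B + 2"] B0 by auto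
  qed
  have w_out: "w x y = 0" if "M \<le> \<bar>fst x\<bar> \<or> M \<le> \<bar>snd x\<bar> \<or> M \<le> \<bar>fst y\<bar> \<or> M \<le> \<bar>snd y\<bar>" for x y
    using that M[of x] M[of y] by (auto simp: w_def)

  have closed: "w (a, b) (a + 1, b) + w (a + 1, b) (a + 1, b + 1) = w (a, b) (a, b + 1) + w (a, b + 1) (a + 1, b + 1)" for a b
  proof -
    define Sq where "Sq = {(a, b), (a + 1, b), (a, b + 1), (a + 1, b + 1)}"
    show ?thesis
    proof (cases "Sq \<inter> C = {}")
      case True
      then show ?thesis by (auto simp: Sq_def w_def)
    next
      case False
      then obtain c where c: "c \<in> Sq" "c \<in> C" by auto
      have adj: "adj8 c s" if "s \<in> Sq" for s using c(1) that by (auto simp: Sq_def adj8_def)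
      have wI: "w x y = (if x \<in> A then 1 else 0) - (if y \<in> A then 1 else 0)"
        if xy: "x \<in> Sq" "y \<in> Sq" "adj4 x y" for x y
      proof -
        have yC: "y \<in> C" if "x \<in> A" "y \<notin> A"
          using C_ext[OF c(2) _ adj[OF xy(2)]] that xy(3) by (auto simp: D_def)
        have xC: "x \<in> C" if "y \<in> A" "x \<notin> A"
        proof -
          have "adj4 y x" using xy(3) by (simp add: adj4_def abs_minus_commute)
          then show ?thesis using C_ext[OF c(2) _ adj[OF xy(1)]] that by (auto simp: D_def)
        qed
        consider "x \<in> A" "x \<notin> C" "y \<in> A" "y \<notin> C" | "x \<in> A" "y \<notin> A" "y \<in> C"
          | "x \<notin> A" "x \<in> C" "y \<in> A" | "x \<notin> A" "y \<notin> A"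
          using CA xC yC by blast
        then show ?thesis by cases (simp_all add: w_def)
      qed
      have "w (a, b) (a + 1, b) = (if (a, b) \<in> A then 1 else 0) - (if (a + 1, b) \<in> A then 1 else 0)"
        "w (a + 1, b) (a + 1, b + 1) = (if (a + 1, b) \<in> A then 1 else 0) - (if (a + 1, b + 1) \<in> A then 1 else 0)"
        "w (a, b) (a, b + 1) = (if (a, b) \<in> A then 1 else 0) - (if (a, b + 1) \<in> A then 1 else 0)"
        "w (a, b + 1) (a + 1, b + 1) = (if (a, b + 1) \<in> A then 1 else 0) - (if (a + 1, b + 1) \<in> A then 1 else 0)"
        by (rule wI; simp add: Sq_def adj4_def)+
      then show ?thesis by linarith
    qed
  qed

  \<comment> \<open>The potential is the flow through the horizontal ray from \<open>p\<close> to
    the right; \<open>w\<close> vanishes from \<open>M\<close> on, so the sum may stop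
    there.\<close>
  define f where "f p = (\<Sum>j\<in>{fst p..<M}. w (j, snd p) (j + 1, snd p))" for p
  have f_h: "f (a, b) - f (a + 1, b) = w (a, b) (a + 1, b)" for a b
  proof (cases "a < M")
    case True
    then have "{a..<M} = insert a {a + 1..<M}" by auto
    then show ?thesis by (simp add: f_def)
  next
    case False
    then have "w (a, b) (a + 1, b) = 0" by (intro w_out) auto
    then show ?thesis using False by (simp add: f_def)
  qed
  \<comment> \<open>Closedness makes the difference of two neighbouring rows telescope.\<close>
  have f_v: "f (a, b) - f (a, b + 1) = w (a, b) (a, b + 1)" for a b
  proof (cases "a \<le> M")
    case True
    have "f (a, b) - f (a, b + 1) = (\<Sum>j\<in>{a..<M}. w (j, b) (j + 1, b) - w (j, b + 1) (j + 1, b + 1))"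
      by (simp add: f_def sum_subtractf)
    also have "\<dots> = (\<Sum>j\<in>{a..<M}. w (j, b) (j, b + 1) - w (j + 1, b) (j + 1, b + 1))"
    proof (rule sum.cong[OF refl])
      fix j show "w (j, b) (j + 1, b) - w (j, b + 1) (j + 1, b + 1) = w (j, b) (j, b + 1) - w (j + 1, b) (j + 1, b + 1)"
        using closed[of j b] by linarith
    qed
    also have "\<dots> = w (a, b) (a, b + 1) - w (M, b) (M, b + 1)"
      using sum_int_telescope[OF True, of "\<lambda>j. w (j, b) (j, b + 1)"] by simp
    also have "w (M, b) (M, b + 1) = 0" by (rule w_out) (simp add: abs_ge_self)
    finally show ?thesis by simp
  next
    case False
    then have "w (a, b) (a, b + 1) = 0" by (intro w_out) auto
    then show ?thesis using False by (simp add: f_def)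
  qed
  have f_edge: "f p - f q = w p q" if "adj4 p q" for p q
    using that
  proof (cases rule: adj4_cases)
    case 1 then show ?thesis using f_h[of "fst p" "snd p"] by simp
  next
    case 2 then show ?thesis using f_h[of "fst q" "snd q"] w_anti[of q p] by simp
  next
    case 3 then show ?thesis using f_v[of "fst p" "snd p"] by simp
  next
    case 4 then show ?thesis using f_v[of "fst q" "snd q"] w_anti[of q p] by simp
  qed
  have f_A: "f a = f (0, 0)" if "a \<in> A" for a
    using conn[OF that]
  proof (induction rule: rtranclp_induct)
    case (step y z)
    have "w y z = 0" using step(2) CA[of y] CA[of z] by (auto simp: w_def)
    then show ?case using f_edge[of y z] step by simp
  qed simp
  \<comment> \<open>On the ray from \<open>(m - 1, 0)\<close> only the edge into
    \<open>(m, 0)\<close> carries flow.\<close>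
  have "f (m - 1, 0) = 1"
  proof -
    have mM: "m < M" using M[of "(m, 0)"] mC by auto
    then have "f (m, 0) = 0"
      using beyond unfolding f_def by (intro sum.neutral) (auto simp: w_def)
    moreover have "w (m - 1, 0) (m, 0) = 1" using m1 mC by (simp add: w_def)
    ultimately show ?thesis using f_h[of "m - 1" 0] by simp
  qed
  then have f0: "f (0, 0) = 1" using f_A[OF m1] by simp
  \<comment> \<open>The row at height \<open>M\<close> is empty, and the column at
    \<open>- M\<close> carries no vertical flow. Hence the total flow through the horizontal axis is
    0, and the unit of flow on the right must be compensated left of the origin.\<close>
  have row: "f (- M, b) = 0" if "0 \<le> b" "b \<le> M" for b
    using that(2,1)
  proof (induction b rule: int_le_induct)
    case base
    show ?case unfolding f_def using M0 by (intro sum.neutral) (auto intro!: w_out)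
  next
    case (step b)
    have "w (- M, b - 1) (- M, b) = 0" by (rule w_out) (simp add: abs_ge_self)
    then show ?case using step f_v[of "- M" "b - 1"] by simp
  qed
  have "{- M..<M} = {- M..<0} \<union> {0..<M}" using M0 by auto
  then have "f (- M, 0) = (\<Sum>j\<in>{- M..<0}. w (j, 0) (j + 1, 0)) + f (0, 0)"
    unfolding f_def by (simp add: sum.union_disjoint ivl_disj_int)
  then have "(\<Sum>j\<in>{- M..<0}. w (j, 0) (j + 1, 0)) \<noteq> 0" using f0 row[of 0] M0 by simp
  then obtain j where j: "j < 0" "w (j, 0) (j + 1, 0) \<noteq> 0"
    by (metis (no_types, lifting) atLeastLessThan_iff sum.neutral)
  then have jC: "(j, 0) \<in> C \<or> (j + 1, 0) \<in> C" by (auto simp: w_def split: if_splits)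
  have "(0, 0) \<notin> C" using origin CA by blast
  from jC have "\<exists>m'. 0 < m' \<and> (- m', 0) \<in> C"
  proof
    assume "(j, 0) \<in> C"
    then show ?thesis using j(1) by (intro exI[of _ "- j"]) auto
  next
    assume *: "(j + 1, 0) \<in> C"
    then have "j + 1 \<noteq> 0" using \<open>(0, 0) \<notin> C\<close> by auto
    then show ?thesis using j(1) * by (intro exI[of _ "- (j + 1)"]) (auto simp: add.commute)
  qed
  then show ?thesis using m_pos mD by (auto simp: C_def)
qed

section \<open>Transfer of planar duality to a coordinate plane of the lattice\<close>

definition embed2 :: "'d::finite \<Rightarrow> 'd \<Rightarrow> int \<times> int \<Rightarrow> int ^ 'd" where
  "embed2 i j p = axis i (fst p) + axis j (snd p)"

lemma embed2_nth:
  assumes "i \<noteq> j"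
  shows "embed2 i j p $ k = (if k = i then fst p else if k = j then snd p else 0)"
  using assms by (auto simp: embed2_def axis_def)

lemma inj_embed2:
  assumes "i \<noteq> j"
  shows "inj (embed2 i j)"
proof (rule injI)
  fix p q assume eq: "embed2 i j p = embed2 i j q"
  have "fst p = fst q" "snd p = snd q"
    using arg_cong[OF eq, of "\<lambda>x. x $ i"] arg_cong[OF eq, of "\<lambda>x. x $ j"] assms
    by (auto simp: embed2_nth split: if_splits)
  then show "p = q" by (rule prod_eqI)
qed

lemma embed2_plane: "i \<noteq> j \<Longrightarrow> embed2 i j p \<in> plane {i, j}"
  by (simp add: plane_def embed2_nth)

lemma embed2_adj8: "i \<noteq> j \<Longrightarrow> adj8 p q \<Longrightarrow> linf_norm (embed2 i j p - embed2 i j q) \<le> 1"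
  by (simp add: linf_norm_le_iff embed2_nth adj8_def)

lemma embed2_adj4:
  assumes ij: "i \<noteq> j" and pq: "adj4 p q"
  shows "lattice_adj (embed2 i j p) (embed2 i j q)"
proof -
  have "(\<Sum>k\<in>UNIV. \<bar>embed2 i j p $ k - embed2 i j q $ k\<bar>) = (\<Sum>k\<in>{i, j}. \<bar>embed2 i j p $ k - embed2 i j q $ k\<bar>)"
    using ij by (intro sum.mono_neutral_right) (auto simp: embed2_nth)
  then show ?thesis using ij pq by (simp add: lattice_adj_def embed2_nth adj4_def)
qed

text \<open>A box of radius \<open>N\<close> is declared open and joined to the vacant sites of the
  plane. The cluster \<open>A\<close> of the origin is still finite, so it has a star-connected
  piece of boundary reaching both half-axes. Boundary sites are neither vacant nor in the box: they
  lie in \<open>I\<close>, and the positive axis is met beyond \<open>N\<close>.\<close>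

lemma plane_duality:
  fixes I :: "(int ^ 'd::finite) set"
  assumes ij: "i \<noteq> j" and no_inf: "\<not> has_infinite_component (- I)"
  shows "\<exists>S m m'. star_connected S \<and> S \<subseteq> I \<inter> plane {i, j} \<and> N < m \<and> 0 < m' \<and> axis i m \<in> S \<and> axis i (- m') \<in> S"
proof -
  define V where "V = {p. embed2 i j p \<notin> I}"
  \<comment> \<open>The origin is included explicitly so that it is available also for negative
    \<open>N\<close>.\<close>
  define B where "B = {p :: int \<times> int. \<bar>fst p\<bar> \<le> N \<and> \<bar>snd p\<bar> \<le> N \<or> p = (0, 0)}"
  define B1 where "B1 = B \<union> {q. \<exists>p\<in>B. adj4 p q}"
  let ?c = "\<lambda>W a b. a \<in> W \<and> b \<in> W \<and> adj4 a b"
  define A where "A = {q. (?c (V \<union> B))\<^sup>*\<^sup>* (0, 0) q}"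
  have comp_fin: "finite {q. (?c V)\<^sup>*\<^sup>* p q}" if p: "p \<in> V" for p
  proof -
    have sub: "embed2 i j ` {q. (?c V)\<^sup>*\<^sup>* p q} \<subseteq> component (- I) (embed2 i j p)"
    proof (clarsimp simp: component_def)
      fix a b assume "(?c V)\<^sup>*\<^sup>* p (a, b)"
      then show "(\<lambda>a b. a \<notin> I \<and> b \<notin> I \<and> lattice_adj a b)\<^sup>*\<^sup>* (embed2 i j p) (embed2 i j (a, b))"
      proof (induction rule: rtranclp_induct)
        case (step y z)
        then show ?case
          using embed2_adj4[OF ij] by (intro rtranclp.rtrancl_into_rtrancl[OF step(3)]) (auto simp: V_def)
      qed simp
    qed
    have "finite (component (- I) (embed2 i j p))"
      using no_inf p by (auto simp: has_infinite_component_def V_def)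
    then show ?thesis
      by (rule finite_imageD[OF finite_subset[OF sub]]) (rule inj_on_subset[OF inj_embed2[OF ij]], simp)
  qed
  have "B \<subseteq> insert (0, 0) ({- N..N} \<times> {- N..N})" by (auto simp: B_def)
  then have finB: "finite B" by (rule finite_subset) auto
  have "B1 \<subseteq> (\<Union>p\<in>B. {fst p - 1..fst p + 1} \<times> {snd p - 1..snd p + 1})"
    by (force simp: B1_def adj4_def)
  then have finB1: "finite B1" by (rule finite_subset) (use finB in auto)
  \<comment> \<open>A path from the origin is followed from its last exit from \<open>B\<close>: the
    rest runs through vacant sites and starts next to \<open>B\<close>. So \<open>A\<close> is
    covered by \<open>B\<close> and finitely many vacant components, each finite because it embeds
    into a lattice component.\<close>
  have "A \<subseteq> B \<union> (\<Union>p\<in>B1 \<inter> V. {q. (?c V)\<^sup>*\<^sup>* p q})"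
  proof
    fix q assume "q \<in> A"
    then have "(?c (V \<union> B))\<^sup>*\<^sup>* (0, 0) q" by (simp add: A_def)
    then show "q \<in> B \<union> (\<Union>p\<in>B1 \<inter> V. {q. (?c V)\<^sup>*\<^sup>* p q})"
    proof (induction rule: rtranclp_induct)
      case base
      then show ?case by (simp add: B_def)
    next
      case (step y z)
      show ?case
      proof (cases "z \<in> B")
        case False
        then have z: "z \<in> V" using step by auto
        show ?thesis
        proof (cases "y \<in> B")
          case True
          then have "z \<in> B1" using step by (auto simp: B1_def)
          then show ?thesis using z by auto
        next
          case False
          then obtain p where p: "p \<in> B1 \<inter> V" "(?c V)\<^sup>*\<^sup>* p y" using step by auto
          have "?c V y z" using False step z by auto
          with p(2) have "(?c V)\<^sup>*\<^sup>* p z" by (rule rtranclp.rtrancl_into_rtrancl)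
          with p(1) show ?thesis by auto
        qed
      qed simp
    qed
  qed
  moreover have "finite (B \<union> (\<Union>p\<in>B1 \<inter> V. {q. (?c V)\<^sup>*\<^sup>* p q}))"
    using finB finB1 comp_fin by auto
  ultimately have finA: "finite A" by (rule finite_subset)
  have A_ext: "z \<in> A" if "y \<in> A" "?c (V \<union> B) y z" for y z
    using that unfolding A_def by (auto intro: rtranclp.rtrancl_into_rtrancl)
  have A_sub: "q \<in> V \<union> B" if "q \<in> A" for q
  proof -
    have "(?c (V \<union> B))\<^sup>*\<^sup>* (0, 0) q" using that by (simp add: A_def)
    then show ?thesis by (induction rule: rtranclp_induct) (auto simp: B_def)
  qed
  have A_conn: "(?c A)\<^sup>*\<^sup>* (0, 0) a" if "a \<in> A" for a
  proof -
    have "(?c (V \<union> B))\<^sup>*\<^sup>* (0, 0) a" using that by (simp add: A_def)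
    then show ?thesis
    proof (induction rule: rtranclp_induct)
      case (step y z)
      have "y \<in> A" using step(1) by (simp add: A_def)
      with step A_ext[of y z] show ?case by (intro rtranclp.rtrancl_into_rtrancl[OF step(3)]) auto
    qed simp
  qed
  define D where "D = {y. y \<notin> A \<and> (\<exists>x\<in>A. adj4 x y)}"
  let ?R = "\<lambda>a b. a \<in> D \<and> b \<in> D \<and> adj8 a b"
  have D_sub: "y \<notin> V \<union> B" if "y \<in> D" for y
  proof
    assume y: "y \<in> V \<union> B"
    obtain x where x: "x \<in> A" "adj4 x y" "y \<notin> A" using \<open>y \<in> D\<close> by (auto simp: D_def)
    have "y \<in> A" using A_ext[OF x(1)] A_sub[OF x(1)] x(2) y by blast
    with x(3) show False by simp
  qed
  have origin: "(0, 0) \<in> A" by (simp add: A_def)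
  obtain m m' where mm: "0 < m" "0 < m'" "(m, 0) \<in> D" "?R\<^sup>*\<^sup>* (m, 0) (- m', 0)"
    using planar_boundary_meets_negative_axis[OF finA A_conn origin] unfolding D_def by blast
  define C where "C = {y. ?R\<^sup>*\<^sup>* (m, 0) y}"
  have CD: "y \<in> D" if "y \<in> C" for y
  proof -
    have "?R\<^sup>*\<^sup>* (m, 0) y" using that by (simp add: C_def)
    then show ?thesis by (induction rule: rtranclp_induct) (use mm in auto)
  qed
  have "star_connected (embed2 i j ` C)"
  proof (rule star_connectedI_root[of _ "embed2 i j (m, 0)"])
    fix a assume "a \<in> embed2 i j ` C"
    then obtain y where y: "a = embed2 i j y" "?R\<^sup>*\<^sup>* (m, 0) y" by (auto simp: C_def)
    from y(2) show "(\<lambda>a b. a \<in> embed2 i j ` C \<and> b \<in> embed2 i j ` C \<and> linf_norm (a - b) \<le> 1)\<^sup>*\<^sup>* (embed2 i j (m, 0)) a"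
      unfolding y(1)
    proof (induction rule: rtranclp_induct)
      case (step y z)
      have "y \<in> C" using step(1) by (simp add: C_def)
      moreover have "z \<in> C" using rtranclp.rtrancl_into_rtrancl[OF step(1,2)] by (simp add: C_def)
      ultimately show ?case
        using step(2) embed2_adj8[OF ij] by (intro rtranclp.rtrancl_into_rtrancl[OF step(3)]) auto
    qed simp
  qed
  moreover have "embed2 i j ` C \<subseteq> I \<inter> plane {i, j}"
    using CD D_sub embed2_plane[OF ij] by (auto simp: V_def)
  moreover have "N < m" using D_sub[OF mm(3)] mm(1) by (auto simp: B_def)
  moreover have "axis i m \<in> embed2 i j ` C"
    by (rule image_eqI[of _ _ "(m, 0)"]) (auto simp: embed2_def C_def vec_eq_iff axis_def)
  moreover have "axis i (- m') \<in> embed2 i j ` C"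
    using mm(4) by (intro image_eqI[of _ _ "(- m', 0)"]) (auto simp: embed2_def C_def vec_eq_iff axis_def)
  ultimately show ?thesis using mm(2) by blast
qed

section \<open>Exponential moments of the number of visited sets\<close>

lemma nn_integral_srw_step_le:
  fixes f :: "(nat \<Rightarrow> int ^ 'd::finite) \<Rightarrow> ennreal"
  assumes f: "f \<in> borel_measurable path_space" and b: "\<And>y. 0 \<le> b y"
    and le: "\<And>y. (\<integral>\<^sup>+X. f (case_nat x X) \<partial>srw y) \<le> ennreal (b y)"
  shows "(\<integral>\<^sup>+X. f X \<partial>srw x) \<le> ennreal (avg b x)"
proof -
  let ?N = "nbrs :: (int ^ 'd) set"
  have "(\<integral>\<^sup>+X. f X \<partial>srw x) = (\<Sum>e\<in>?N. \<integral>\<^sup>+X. f (case_nat x X) \<partial>srw (x + e)) / of_nat (card ?N)"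
    by (rule nn_integral_srw_step[OF f])
  also have "\<dots> \<le> (\<Sum>e\<in>?N. ennreal (b (x + e))) / of_nat (card ?N)"
    by (intro divide_right_mono_ennreal sum_mono le)
  also have "\<dots> = ennreal (avg b x)"
    unfolding avg_def using b
    by (simp add: sum_nonneg divide_ennreal[symmetric] card_gt_0_iff flip: ennreal_of_nat_eq_real_of_nat)
  finally show ?thesis .
qed

lemma visit_count_measurable:
  assumes "finite M"
  shows "(\<lambda>X. ennreal (a ^ card {y \<in> M. \<exists>k<n. X k \<in> S y})) \<in> borel_measurable (path_space :: (nat \<Rightarrow> int ^ 'd::finite) measure)"
    "(\<lambda>X. ennreal (a ^ card {y \<in> M. \<exists>k. X k \<in> S y})) \<in> borel_measurable (path_space :: (nat \<Rightarrow> int ^ 'd::finite) measure)"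
proof -
  have eq: "a ^ card {y \<in> M. P y} = (\<Prod>y\<in>M. if P y then a else 1 :: real)" for P
    using assms by (simp add: prod.If_cases Int_def)
  show "(\<lambda>X. ennreal (a ^ card {y \<in> M. \<exists>k<n. X k \<in> S y})) \<in> borel_measurable (path_space :: (nat \<Rightarrow> int ^ 'd) measure)"
    unfolding eq by measurable
  show "(\<lambda>X. ennreal (a ^ card {y \<in> M. \<exists>k. X k \<in> S y})) \<in> borel_measurable (path_space :: (nat \<Rightarrow> int ^ 'd) measure)"
    unfolding eq by measurable
qed

text \<open>
  The function \<open>x \<mapsto> (\<Sum>y\<in>M. \<Sum>z\<in>S y. green x z) / G\<close> is superharmonic and at least 1 on the sets
  \<open>S y\<close>, so it can replace the hitting probability of their union in a one-step induction; no
  strong Markov property is needed.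
\<close>

lemma exp_moment_visits_finite_time:
  fixes S :: "'c \<Rightarrow> (int ^ 'd::finite) set"
  assumes d: "CARD('d) \<ge> 3" and fin: "finite M0"
    and disj: "\<And>y y'. y \<in> M0 \<Longrightarrow> y' \<in> M0 \<Longrightarrow> y \<noteq> y' \<Longrightarrow> S y \<inter> S y' = {}"
    and G: "0 < G" "\<And>y x. y \<in> M0 \<Longrightarrow> x \<in> S y \<Longrightarrow> G \<le> (\<Sum>z\<in>S y. green x z)"
    and q: "\<And>y x. y \<in> M0 \<Longrightarrow> x \<in> S y \<Longrightarrow> (\<Sum>y'\<in>M0 - {y}. \<Sum>z\<in>S y'. green x z) \<le> q * G"
    and a: "1 \<le> a" "(2 * a - 1) * q \<le> 1"
    and M: "M \<subseteq> M0"
  shows "(\<integral>\<^sup>+X. ennreal (a ^ card {y \<in> M. \<exists>k<n. X k \<in> S y}) \<partial>srw x)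
      \<le> ennreal (1 + (2 * a - 1) * ((\<Sum>y\<in>M. \<Sum>z\<in>S y. green x z) / G))"
    "y \<in> M \<Longrightarrow> x \<in> S y \<Longrightarrow>
      (\<integral>\<^sup>+X. ennreal (a ^ card {y \<in> M. \<exists>k<n. X k \<in> S y}) \<partial>srw x) \<le> ennreal (2 * a)"
proof -
  define h where "h M x = (\<Sum>y\<in>M. \<Sum>z\<in>S y. green x z) / G" for M x
  \<comment> \<open>The factor \<open>2 * a - 1\<close> makes \<open>b\<close> at least
    \<open>2 * a\<close> wherever \<open>h\<close> is at least 1, in particular on the sets
    themselves.\<close>
  define b where "b M x = 1 + (2 * a - 1) * h M x" for M x
  define V where "V n M x = (\<integral>\<^sup>+X. ennreal (a ^ card {y \<in> M. \<exists>k<n. X k \<in> S y}) \<partial>srw x)" for n M x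
  have h_nonneg: "0 \<le> h M x" for M x
    unfolding h_def using G by (intro divide_nonneg_pos sum_nonneg green_nonneg[OF d]) auto
  have b_nonneg: "0 \<le> b M x" for M x
    unfolding b_def using h_nonneg[of M x] a by simp
  have h_super: "avg (h M) x \<le> h M x" for M x
  proof -
    have "avg (h M) x = (1 / G) * avg (\<lambda>x. \<Sum>y\<in>M. \<Sum>z\<in>S y. green x z) x"
      using avg_cmult[of "1 / G" "\<lambda>x. \<Sum>y\<in>M. \<Sum>z\<in>S y. green x z" x] by (simp add: h_def[abs_def])
    also have "\<dots> = (1 / G) * (\<Sum>y\<in>M. \<Sum>z\<in>S y. avg (\<lambda>x. green x z) x)" by (simp add: avg_sum)
    also have "\<dots> \<le> (1 / G) * (\<Sum>y\<in>M. \<Sum>z\<in>S y. green x z)"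
      using G by (intro mult_left_mono sum_mono avg_green_le[OF d]) auto
    finally show ?thesis by (simp add: h_def)
  qed
  have b_super: "avg (b M) x \<le> b M x" for M x
  proof -
    have "avg (b M) x = 1 + (2 * a - 1) * avg (h M) x"
      using avg_add[of "\<lambda>_. 1" "\<lambda>x. (2 * a - 1) * h M x" x] by (simp add: b_def[abs_def] avg_cmult)
    also have "\<dots> \<le> b M x" unfolding b_def using a h_super by (intro add_left_mono mult_left_mono) auto
    finally show ?thesis .
  qed
  have h_ge: "1 \<le> h M x" if M: "M \<subseteq> M0" and y: "y \<in> M" "x \<in> S y" for M x y
  proof -
    have "G \<le> (\<Sum>z\<in>S y. green x z)" using G y M by blast
    also have "\<dots> \<le> (\<Sum>y\<in>M. \<Sum>z\<in>S y. green x z)"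
      using finite_subset[OF M fin] y by (intro member_le_sum[of y M "\<lambda>y. \<Sum>z\<in>S y. green x z"] sum_nonneg green_nonneg[OF d]) auto
    finally show ?thesis using G by (simp add: h_def)
  qed
  have h_le: "h (M - {y}) x \<le> q" if M: "M \<subseteq> M0" and y: "y \<in> M" "x \<in> S y" for M x y
  proof -
    have "(\<Sum>y\<in>M - {y}. \<Sum>z\<in>S y. green x z) \<le> (\<Sum>y\<in>M0 - {y}. \<Sum>z\<in>S y. green x z)"
      using M fin by (intro sum_mono2 sum_nonneg green_nonneg[OF d]) auto
    also have "\<dots> \<le> q * G" using q M y by blast
    finally show ?thesis using G by (simp add: h_def divide_le_eq)
  qed
  \<comment> \<open>The induction ranges over all \<open>M \<subseteq> M0\<close>: when the walk
    stands in \<open>S y\<close>, one factor \<open>a\<close> is paid and only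
    \<open>M - {y}\<close> remains to be counted.\<close>
  have main: "V n M x \<le> ennreal (b M x) \<and> (\<forall>y\<in>M. x \<in> S y \<longrightarrow> V n M x \<le> ennreal (2 * a))"
    if "M \<subseteq> M0" for n M x
    using that
  proof (induction n arbitrary: M x)
    case 0
    have "V 0 M x = 1" unfolding V_def using srw.emeasure_space_1[of x] by simp
    moreover have "1 \<le> b M x" unfolding b_def using h_nonneg[of M x] a by simp
    ultimately show ?case using a by simp
  next
    case (Suc n)
    have finM: "finite M" using Suc.prems fin by (rule finite_subset)
    have meas: "(\<lambda>X. ennreal (a ^ card {y \<in> M. \<exists>k<m. X k \<in> S y})) \<in> borel_measurable path_space" for m
      by (rule visit_count_measurable(1)[OF finM])
    have shift: "(\<exists>k<Suc n. case_nat x X k \<in> S y) \<longleftrightarrow> x \<in> S y \<or> (\<exists>k<n. X k \<in> S y)" for X y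
      by (auto simp: less_Suc_eq_0_disj)
    have in_case: "V (Suc n) M x \<le> ennreal (2 * a)" if y: "y \<in> M" "x \<in> S y" for y
    proof -
      have "{y' \<in> M. \<exists>k<Suc n. case_nat x X k \<in> S y'} = insert y {y' \<in> M - {y}. \<exists>k<n. X k \<in> S y'}" for X
        unfolding shift using y disj Suc.prems by blast
      then have count: "card {y' \<in> M. \<exists>k<Suc n. case_nat x X k \<in> S y'} = Suc (card {y' \<in> M - {y}. \<exists>k<n. X k \<in> S y'})" for X
        using finM by simp
      have "V (Suc n) M x \<le> ennreal (avg (\<lambda>z. a * b (M - {y}) z) x)"
        unfolding V_def
      proof (rule nn_integral_srw_step_le[OF meas])
        show "0 \<le> a * b (M - {y}) z" for z using a b_nonneg by simp
        fix z
        have "(\<integral>\<^sup>+X. ennreal (a ^ card {y' \<in> M. \<exists>k<Suc n. case_nat x X k \<in> S y'}) \<partial>srw z)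
            = (\<integral>\<^sup>+X. ennreal a * ennreal (a ^ card {y' \<in> M - {y}. \<exists>k<n. X k \<in> S y'}) \<partial>srw z)"
          unfolding count using a by (simp add: ennreal_mult)
        also have "\<dots> = ennreal a * V n (M - {y}) z"
          unfolding V_def
        proof (rule nn_integral_cmult)
          show "(\<lambda>X. ennreal (a ^ card {y' \<in> M - {y}. \<exists>k<n. X k \<in> S y'})) \<in> borel_measurable (srw z)"
            unfolding measurable_cong_sets[OF sets_srw refl]
            by (rule visit_count_measurable(1)) (use finM in simp)
        qed
        also have "\<dots> \<le> ennreal a * ennreal (b (M - {y}) z)"
          using Suc.IH[of "M - {y}" z] Suc.prems by (intro mult_left_mono) auto
        also have "\<dots> = ennreal (a * b (M - {y}) z)" using a b_nonneg by (simp add: ennreal_mult)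
        finally show "(\<integral>\<^sup>+X. ennreal (a ^ card {y' \<in> M. \<exists>k<Suc n. case_nat x X k \<in> S y'}) \<partial>srw z)
            \<le> ennreal (a * b (M - {y}) z)" .
      qed
      also have "avg (\<lambda>z. a * b (M - {y}) z) x \<le> 2 * a"
      proof -
        have "avg (\<lambda>z. a * b (M - {y}) z) x = a * avg (b (M - {y})) x" by (rule avg_cmult)
        also have "\<dots> \<le> a * b (M - {y}) x" using a b_super by (intro mult_left_mono) auto
        \<comment> \<open>Seen from \<open>S y\<close>, the remaining sets have potential at most
          \<open>q\<close>; the condition \<open>(2 * a - 1) * q \<le> 1\<close> then closes the
          induction.\<close>
        also have "\<dots> \<le> a * (1 + (2 * a - 1) * q)"
          unfolding b_def using a h_le[OF Suc.prems y] by (intro mult_left_mono add_left_mono) auto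
        also have "\<dots> \<le> a * 2" using a by (intro mult_left_mono) auto
        finally show ?thesis by simp
      qed
      finally show ?thesis by (simp add: ennreal_leI)
    qed
    have "V (Suc n) M x \<le> ennreal (b M x)"
    proof (cases "\<exists>y\<in>M. x \<in> S y")
      case True
      then obtain y where y: "y \<in> M" "x \<in> S y" by blast
      have "(2 * a - 1) * 1 \<le> (2 * a - 1) * h M x"
        using h_ge[OF Suc.prems y] a by (intro mult_left_mono) auto
      then have "2 * a \<le> b M x" by (simp add: b_def)
      then show ?thesis using in_case[OF y] by (meson ennreal_leI order_trans)
    next
      case False
      have "V (Suc n) M x \<le> ennreal (avg (b M) x)"
        unfolding V_def
      proof (rule nn_integral_srw_step_le[OF meas b_nonneg])
        fix z
        have "{y' \<in> M. \<exists>k<Suc n. case_nat x X k \<in> S y'} = {y' \<in> M. \<exists>k<n. X k \<in> S y'}" for X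
          unfolding shift using False by blast
        then show "(\<integral>\<^sup>+X. ennreal (a ^ card {y' \<in> M. \<exists>k<Suc n. case_nat x X k \<in> S y'}) \<partial>srw z) \<le> ennreal (b M z)"
          using Suc.IH[OF Suc.prems, of z] by (simp add: V_def)
      qed
      also have "\<dots> \<le> ennreal (b M x)" by (intro ennreal_leI b_super)
      finally show ?thesis .
    qed
    with in_case show ?case by blast
  qed
  from main[OF M, of n x] show "(\<integral>\<^sup>+X. ennreal (a ^ card {y \<in> M. \<exists>k<n. X k \<in> S y}) \<partial>srw x)
      \<le> ennreal (1 + (2 * a - 1) * ((\<Sum>y\<in>M. \<Sum>z\<in>S y. green x z) / G))"
    by (simp add: V_def b_def h_def)
  show "y \<in> M \<Longrightarrow> x \<in> S y \<Longrightarrow>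
      (\<integral>\<^sup>+X. ennreal (a ^ card {y \<in> M. \<exists>k<n. X k \<in> S y}) \<partial>srw x) \<le> ennreal (2 * a)"
    using main[OF M, of n x] unfolding V_def by blast
qed

text \<open>Monotone convergence in the time horizon: on every path the finitely many visited sets
  have all been visited by some finite time.\<close>

lemma exp_moment_visits:
  fixes S :: "'c \<Rightarrow> (int ^ 'd::finite) set"
  assumes d: "CARD('d) \<ge> 3" and fin: "finite M"
    and disj: "\<And>y y'. y \<in> M \<Longrightarrow> y' \<in> M \<Longrightarrow> y \<noteq> y' \<Longrightarrow> S y \<inter> S y' = {}"
    and G: "0 < G" "\<And>y x. y \<in> M \<Longrightarrow> x \<in> S y \<Longrightarrow> G \<le> (\<Sum>z\<in>S y. green x z)"
    and q: "\<And>y x. y \<in> M \<Longrightarrow> x \<in> S y \<Longrightarrow> (\<Sum>y'\<in>M - {y}. \<Sum>z\<in>S y'. green x z) \<le> q * G"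
    and a: "1 \<le> a" "(2 * a - 1) * q \<le> 1"
    and x: "y \<in> M" "x \<in> S y"
  shows "(\<integral>\<^sup>+X. ennreal (a ^ card {y \<in> M. \<exists>k. X k \<in> S y}) \<partial>srw x) \<le> ennreal (2 * a)"
proof -
  define f where "f n X = ennreal (a ^ card {y \<in> M. \<exists>k<n. X k \<in> S y})" for n and X :: "nat \<Rightarrow> int ^ 'd"
  have meas: "f n \<in> borel_measurable (srw x)" for n
    unfolding f_def[abs_def] using visit_count_measurable(1)[OF fin] by (simp cong: measurable_cong_sets)
  have inc: "incseq f"
  proof (intro incseq_SucI le_funI)
    fix n X
    have "card {y \<in> M. \<exists>k<n. X k \<in> S y} \<le> card {y \<in> M. \<exists>k<Suc n. X k \<in> S y}"
      using fin by (intro card_mono) (auto intro: less_SucI)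
    then show "f n X \<le> f (Suc n) X" unfolding f_def using a by (intro ennreal_leI power_increasing) auto
  qed
  have sup: "ennreal (a ^ card {y \<in> M. \<exists>k. X k \<in> S y}) \<le> (SUP n. f n X)" for X :: "nat \<Rightarrow> int ^ 'd"
  proof -
    define H where "H = {y \<in> M. \<exists>k. X k \<in> S y}"
    have "\<forall>y\<in>H. \<exists>k. X k \<in> S y" by (simp add: H_def)
    then obtain t where t: "\<And>y. y \<in> H \<Longrightarrow> X (t y) \<in> S y" by metis
    define n where "n = Suc (Max (insert 0 (t ` H)))"
    have "finite H" using fin by (simp add: H_def)
    then have "t y < n" if "y \<in> H" for y
      unfolding n_def using that by (simp add: less_Suc_eq_le)
    then have "H = {y \<in> M. \<exists>k<n. X k \<in> S y}" using t by (auto simp: H_def)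
    then have "ennreal (a ^ card H) = f n X" by (simp only: f_def)
    also have "\<dots> \<le> (SUP n. f n X)" by (rule SUP_upper) simp
    finally show ?thesis unfolding H_def .
  qed
  have "(\<integral>\<^sup>+X. ennreal (a ^ card {y \<in> M. \<exists>k. X k \<in> S y}) \<partial>srw x) \<le> (\<integral>\<^sup>+X. (SUP n. f n X) \<partial>srw x)"
    by (rule nn_integral_mono) (rule sup)
  also have "\<dots> = (SUP n. \<integral>\<^sup>+X. f n X \<partial>srw x)"
    by (rule nn_integral_monotone_convergence_SUP[OF inc meas])
  also have "\<dots> \<le> ennreal (2 * a)"
    unfolding f_def by (intro SUP_least exp_moment_visits_finite_time(2)[OF d fin disj G q a order_refl x])
  finally show ?thesis .
qed

text \<open>Trajectories of the soup start on \<open>F\<close>, so the bound \<open>2 * a\<close>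
  for starting points in one of the sets applies to all of them, and their total mass is
  \<open>capacity F\<close>. The number of visited sets depends on the path through its trace alone,
  which makes the integral a finite sum.\<close>

lemma exp_moment_trace:
  fixes S :: "'c \<Rightarrow> (int ^ 'd::finite) set"
  assumes d: "CARD('d) \<ge> 3" and fin: "finite M" "\<And>y. y \<in> M \<Longrightarrow> finite (S y)"
    and disj: "\<And>y y'. y \<in> M \<Longrightarrow> y' \<in> M \<Longrightarrow> y \<noteq> y' \<Longrightarrow> S y \<inter> S y' = {}"
    and G: "0 < G" "\<And>y x. y \<in> M \<Longrightarrow> x \<in> S y \<Longrightarrow> G \<le> (\<Sum>z\<in>S y. green x z)"
    and q: "\<And>y x. y \<in> M \<Longrightarrow> x \<in> S y \<Longrightarrow> (\<Sum>y'\<in>M - {y}. \<Sum>z\<in>S y'. green x z) \<le> q * G"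
    and a: "1 \<le> a" "(2 * a - 1) * q \<le> 1"
  defines "F \<equiv> \<Union>y\<in>M. S y"
  shows "(\<Sum>T\<in>Pow F. trace_weight F T * a ^ card {y \<in> M. T \<inter> S y \<noteq> {}}) \<le> 2 * a * capacity F"
proof -
  have finF: "finite F" unfolding F_def using fin by blast
  define N where "N T = card {y \<in> M. T \<inter> S y \<noteq> {}}" for T
  have tr: "(\<Sum>T\<in>Pow F. trace_prob F x T * a ^ N T) \<le> 2 * a" if x: "x \<in> F" for x
  proof -
    obtain y where y: "y \<in> M" "x \<in> S y" using x by (auto simp: F_def)
    have ev: "{X. range X \<inter> F = T} \<in> sets (srw x)" for T
      using trace_event_measurable[OF finF] by simp
    have "ennreal (\<Sum>T\<in>Pow F. trace_prob F x T * a ^ N T)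
        = (\<Sum>T\<in>Pow F. ennreal (a ^ N T) * emeasure (srw x) {X. range X \<inter> F = T})"
      using a by (simp add: trace_prob_def srw.emeasure_eq_measure mult.commute ennreal_mult' sum_ennreal[symmetric] zero_le_power order_trans[OF zero_le_one])
    also have "\<dots> = (\<Sum>T\<in>Pow F. \<integral>\<^sup>+X. ennreal (a ^ N T) * indicator {X. range X \<inter> F = T} X \<partial>srw x)"
      by (intro sum.cong refl nn_integral_cmult_indicator[symmetric] ev)
    also have "\<dots> = (\<integral>\<^sup>+X. (\<Sum>T\<in>Pow F. ennreal (a ^ N T) * indicator {X. range X \<inter> F = T} X) \<partial>srw x)"
      using ev by (intro nn_integral_sum[symmetric]) auto
    also have "\<dots> = (\<integral>\<^sup>+X. ennreal (a ^ card {y \<in> M. \<exists>k. X k \<in> S y}) \<partial>srw x)"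
    proof (rule nn_integral_cong)
      fix X :: "nat \<Rightarrow> int ^ 'd"
      have "(\<Sum>T\<in>Pow F. ennreal (a ^ N T) * indicator {X. range X \<inter> F = T} X)
          = (\<Sum>T\<in>Pow F. if T = range X \<inter> F then ennreal (a ^ N T) else 0)"
        by (rule sum.cong) (auto simp: indicator_def)
      also have "\<dots> = ennreal (a ^ N (range X \<inter> F))" using finF by (subst sum.delta) auto
      also have "N (range X \<inter> F) = card {y \<in> M. \<exists>k. X k \<in> S y}"
        unfolding N_def by (rule arg_cong[of _ _ card]) (auto simp: F_def)
      finally show "(\<Sum>T\<in>Pow F. ennreal (a ^ N T) * indicator {X. range X \<inter> F = T} X)
          = ennreal (a ^ card {y \<in> M. \<exists>k. X k \<in> S y})" .
    qed
    also have "\<dots> \<le> ennreal (2 * a)"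
      by (rule exp_moment_visits[OF d fin(1) disj G q a y])
    finally show ?thesis using a by (simp add: ennreal_le_iff)
  qed
  have "(\<Sum>T\<in>Pow F. trace_weight F T * a ^ N T)
      = (\<Sum>x\<in>F. equilibrium F x * (\<Sum>T\<in>Pow F. trace_prob F x T * a ^ N T))"
    unfolding trace_weight_def sum_distrib_left sum_distrib_right by (subst sum.swap) (simp add: mult_ac)
  also have "\<dots> \<le> (\<Sum>x\<in>F. equilibrium F x * (2 * a))"
    by (intro sum_mono mult_left_mono tr) auto
  also have "\<dots> = 2 * a * capacity F" by (simp add: capacity_def sum_distrib_left mult_ac)
  finally show ?thesis by (simp add: N_def)
qed

text \<open>Exponential Chebyshev inequality: if all sets are hit, the counts \<open>N T\<close> of
  the traces present add up to at least \<open>card M\<close>. By independence the expectation of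
  the product factorises, and a factor is at most \<open>1 + p T * a ^ N T\<close> with
  \<open>p T \<le> u * trace_weight F T\<close>.\<close>

lemma local_law_hits_all:
  fixes S :: "'c \<Rightarrow> (int ^ 'd::finite) set"
  assumes u: "0 \<le> u" and a: "1 \<le> a" and fin: "finite M" "finite F"
  shows "measure_pmf.prob (local_law u F) {I. \<forall>y\<in>M. I \<inter> S y \<noteq> {}} * a ^ card M
      \<le> exp (u * (\<Sum>T\<in>Pow F. trace_weight F T * a ^ card {y \<in> M. T \<inter> S y \<noteq> {}}))"
proof -
  define N where "N T = card {y \<in> M. T \<inter> S y \<noteq> {}}" for T
  define p where "p T = 1 - exp (- u * trace_weight F T)" for T
  have p: "0 \<le> p T" "p T \<le> 1" "p T \<le> u * trace_weight F T" for T
    using u exp_ge_add_one_self[of "- u * trace_weight F T"] by (auto simp: p_def)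
  define g where "g T v = (if v then a ^ N T else 1)" for T v
  have aN: "1 \<le> a ^ N T" for T using a by simp
  have g1: "1 \<le> g T v" for T v using aN by (simp add: g_def)
  define E where "E = {c. \<forall>y\<in>M. (\<Union>{T. T \<subseteq> F \<and> c T}) \<inter> S y \<noteq> {}}"
  have soup: "local_soup u F = Pi_pmf (Pow F) False (\<lambda>T. bernoulli_pmf (p T))"
    by (simp add: local_soup_def p_def)
  have int_g: "integrable (measure_pmf (bernoulli_pmf (p T))) (g T)" for T
    by (rule integrable_measure_pmf_finite) simp
  have int: "integrable (measure_pmf (local_soup u F)) (\<lambda>c. \<Prod>T\<in>Pow F. g T (c T))"
    unfolding soup using fin int_g by (intro integrable_prod_Pi_pmf) auto
  have ge: "indicator E c * a ^ card M \<le> (\<Prod>T\<in>Pow F. g T (c T))" for c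
  proof (cases "c \<in> E")
    case True
    let ?H = "{T \<in> Pow F. c T}"
    have "M \<subseteq> (\<Union>T\<in>?H. {y \<in> M. T \<inter> S y \<noteq> {}})"
    proof
      fix y assume y: "y \<in> M"
      then have "(\<Union>{T. T \<subseteq> F \<and> c T}) \<inter> S y \<noteq> {}" using True by (simp add: E_def)
      then obtain T where "T \<subseteq> F" "c T" "T \<inter> S y \<noteq> {}" by blast
      with y show "y \<in> (\<Union>T\<in>?H. {y \<in> M. T \<inter> S y \<noteq> {}})" by blast
    qed
    then have "card M \<le> card (\<Union>T\<in>?H. {y \<in> M. T \<inter> S y \<noteq> {}})"
      using fin by (intro card_mono) auto
    also have "\<dots> \<le> (\<Sum>T\<in>?H. N T)" unfolding N_def using fin by (intro card_UN_le) auto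
    finally have "a ^ card M \<le> a ^ (\<Sum>T\<in>?H. N T)" using a by (intro power_increasing)
    also have "\<dots> = (\<Prod>T\<in>?H. a ^ N T)" by (simp add: power_sum)
    also have "\<dots> = (\<Prod>T\<in>Pow F. g T (c T))"
      using fin by (intro prod.mono_neutral_cong_left) (auto simp: g_def)
    finally show ?thesis using True by simp
  next
    case False
    have "0 \<le> (\<Prod>T\<in>Pow F. g T (c T))" using g1 by (intro prod_nonneg) (meson order_trans zero_le_one)
    then show ?thesis using False by simp
  qed
  have "measure_pmf.prob (local_law u F) {I. \<forall>y\<in>M. I \<inter> S y \<noteq> {}} = measure_pmf.prob (local_soup u F) E"
    by (simp add: local_law_def E_def vimage_def)
  also have "\<dots> = measure_pmf.expectation (local_soup u F) (indicator E)" by simp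
  finally have "measure_pmf.prob (local_law u F) {I. \<forall>y\<in>M. I \<inter> S y \<noteq> {}} * a ^ card M
      = measure_pmf.expectation (local_soup u F) (\<lambda>c. indicator E c * a ^ card M)" by simp
  also have "\<dots> \<le> measure_pmf.expectation (local_soup u F) (\<lambda>c. \<Prod>T\<in>Pow F. g T (c T))"
    by (rule integral_mono[OF _ int ge]) (auto intro!: integrable_mult_left integrable_real_indicator simp: less_top[symmetric])
  also have "\<dots> = (\<Prod>T\<in>Pow F. measure_pmf.expectation (bernoulli_pmf (p T)) (g T))"
    unfolding soup using fin int_g g1
    by (intro expectation_prod_Pi_pmf) (auto intro: order_trans[OF zero_le_one])
  also have "\<dots> = (\<Prod>T\<in>Pow F. p T * a ^ N T + (1 - p T))"
    using p by (simp add: g_def integral_measure_pmf[of UNIV] UNIV_bool add.commute)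
  also have "\<dots> \<le> (\<Prod>T\<in>Pow F. exp (u * (trace_weight F T * a ^ N T)))"
  proof (rule prod_mono)
    fix T
    have "0 \<le> p T * a ^ N T + (1 - p T)" using p[of T] a by simp
    moreover have "p T * a ^ N T + (1 - p T) \<le> 1 + p T * a ^ N T" using p by simp
    moreover have "p T * a ^ N T \<le> (u * trace_weight F T) * a ^ N T" using p a by (intro mult_right_mono) auto
    moreover have "1 + u * (trace_weight F T * a ^ N T) \<le> exp (u * (trace_weight F T * a ^ N T))"
      by (rule exp_ge_add_one_self)
    ultimately show "0 \<le> p T * a ^ N T + (1 - p T) \<and> p T * a ^ N T + (1 - p T) \<le> exp (u * (trace_weight F T * a ^ N T))"
      unfolding mult.assoc by linarith
  qed
  also have "\<dots> = exp (u * (\<Sum>T\<in>Pow F. trace_weight F T * a ^ N T))"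
    using fin by (simp add: exp_sum sum_distrib_left)
  finally show ?thesis by (simp add: N_def)
qed

section \<open>The lower bound\<close>

definition frame :: "'d::finite set \<Rightarrow> int \<Rightarrow> int ^ 'd \<Rightarrow> (int ^ 'd) set" where
  "frame J l y = (+) y ` plane_shell J l"

lemma frameD: "z \<in> frame J l y \<Longrightarrow> linf_norm (z - y) = l"
  by (auto simp: frame_def plane_shell_def)

lemma frameI:
  assumes "y \<in> plane J" "z \<in> plane J" "linf_norm (z - y) = l"
  shows "z \<in> frame J l y"
proof -
  have "z - y \<in> plane_shell J l" using assms by (simp add: plane_shell_def plane_def)
  then show ?thesis unfolding frame_def by (rule rev_image_eqI) simp
qed

lemma finite_frame [simp]: "finite (frame J l y)"
  by (simp add: frame_def)

lemma card_frame:
  assumes "card J = 2" "1 \<le> l"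
  shows "real (card (frame J l y)) = 8 * real_of_int l"
proof -
  have "card (frame J l y) = card (plane_shell J l)"
    unfolding frame_def by (rule card_image) simp
  then show ?thesis
    using card_plane_shell[OF assms(2), of J] assms(1) by (simp add: power2_eq_square algebra_simps)
qed

lemma leaf_sets_pair_dist:
  assumes l: "1 \<le> l" and A: "A \<in> leaf_sets J l n x" and yz: "y \<in> A" "z \<in> A" "y \<noteq> z"
  shows "\<exists>k. l * (6 ^ Suc k + 24) \<le> 5 * linf_norm (y - z)"
  using A yz(1,2)
proof (induction n arbitrary: x A)
  case (Suc n)
  from Suc.prems(1) obtain v w A1 A2 where *: "v \<in> plane_shell J 6" "w \<in> plane_shell J 12"
    "A1 \<in> leaf_sets J l n (x + (l * 6 ^ n) *s v)" "A2 \<in> leaf_sets J l n (x + (l * 6 ^ n) *s w)" "A = A1 \<union> A2"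
    by (rule leaf_sets_SucE)
  consider "y \<in> A1" "z \<in> A1" | "y \<in> A2" "z \<in> A2" | "y \<in> A1" "z \<in> A2" | "z \<in> A1" "y \<in> A2"
    using Suc.prems *(5) by blast
  then show ?case
  proof cases
    case 1 then show ?thesis using Suc.IH[OF *(3)] by blast
  next
    case 2 then show ?thesis using Suc.IH[OF *(4)] by blast
  next
    case 3 then show ?thesis using leaf_sets_separated[OF l *(1-4)] by blast
  next
    case 4 then show ?thesis using leaf_sets_separated[OF l *(1-4)] linf_norm_minus_commute[of y z] by metis
  qed
qed (use yz in auto)

lemma frames_disjoint:
  assumes l: "1 \<le> l" and A: "A \<in> leaf_sets J l n x" and yz: "y \<in> A" "z \<in> A" "y \<noteq> z"
  shows "frame J l y \<inter> frame J l z = {}"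
proof (rule ccontr)
  assume "frame J l y \<inter> frame J l z \<noteq> {}"
  then obtain p where p: "p \<in> frame J l y" "p \<in> frame J l z" by auto
  have "linf_norm (y - z) \<le> 2 * l"
    using linf_dist_triangle[of y z p] frameD[OF p(1)] frameD[OF p(2)] linf_norm_minus_commute[of y p] by linarith
  moreover obtain k where "l * (6 ^ Suc k + 24) \<le> 5 * linf_norm (y - z)"
    using leaf_sets_pair_dist[OF assms] by blast
  \<comment> \<open>Common points would need leaves within \<open>2 * l\<close>, but the additive 24
    in the separation puts them at least \<open>24/5 * l\<close> apart.\<close>
  moreover have "l * 24 \<le> l * (6 ^ Suc k + 24)" using l by (intro mult_left_mono) auto
  ultimately show False using l by linarith
qed

text \<open>A frame has \<open>8 * l\<close> points. At distance at least \<open>l * t\<close> with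
  \<open>t \<ge> 1\<close>, each contributes at most \<open>C_g * l^(2-d) / t\<close>, so frames
  play the role of leaves with \<open>c = 8 * C_g / l^(d-3)\<close>, and the tree sum multiplies
  this by 5/4.\<close>

lemma green_other_frames:
  assumes d: "CARD('d::finite) \<ge> 3" and J: "card J = 2" and l: "1 \<le> l"
    and A: "A \<in> leaf_sets J l n (x0 :: int ^ 'd)" and y: "y \<in> A" and x: "x \<in> frame J l y"
  shows "(\<Sum>y'\<in>A - {y}. \<Sum>z\<in>frame J l y'. green x z) \<le> 10 * C_green TYPE('d) / real_of_int l ^ (CARD('d) - 3)"
proof -
  let ?C = "C_green TYPE('d)" and ?l = "real_of_int l"
  define c where "c = 8 * ?C / ?l ^ (CARD('d) - 3)"
  have C: "1 \<le> ?C" by (rule C_green_ge_1[OF d])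
  have l1: "1 \<le> ?l" using l by simp
  have c: "0 \<le> c" using C l1 by (simp add: c_def)
  have d2: "CARD('d) - 2 = Suc (CARD('d) - 3)" using d by simp
  have "(\<Sum>y'\<in>A - {y}. \<Sum>z\<in>frame J l y'. green x z) \<le> 5 / 4 * (1 - (1 / 3) ^ n) * c"
  proof (rule leaf_sets_sum_le[OF l A y c])
    fix y' k assume far: "l * (6 ^ Suc k + 24) \<le> 5 * linf_norm (y - y')"
    define t :: real where "t = 6 ^ Suc k / 5"
    have t: "1 \<le> t"
    proof -
      have "(1 :: real) \<le> 6 ^ k" by simp
      then have "(5 :: real) \<le> 6 * 6 ^ k" by linarith
      then show ?thesis by (simp add: t_def)
    qed
    have "green x z \<le> ?C * (1 / (?l ^ (CARD('d) - 2)) * (1 / t))" if z: "z \<in> frame J l y'" for z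
    proof -
      have "linf_norm (y - y') \<le> linf_norm (y - x) + (linf_norm (x - z) + linf_norm (z - y'))"
        using linf_dist_triangle[of y y' x] linf_dist_triangle[of x y' z] by linarith
      then have "linf_norm (y - y') \<le> linf_norm (x - z) + 2 * l"
        using frameD[OF x] frameD[OF z] linf_norm_minus_commute[of y x] by linarith
      then have "l * 6 ^ Suc k \<le> 5 * linf_norm (x - z)"
        using far l by (simp add: distrib_left)
      then have "real_of_int (l * 6 ^ Suc k) \<le> real_of_int (5 * linf_norm (x - z))"
        by (simp only: of_int_le_iff)
      then have lt: "?l * t \<le> real_of_int (linf_norm (x - z))" by (simp add: t_def)
      have "?l ^ (CARD('d) - 2) * t \<le> ?l ^ (CARD('d) - 2) * t ^ (CARD('d) - 2)"
        using l1 t d power_increasing[of 1 "CARD('d) - 2" t] by (intro mult_left_mono) auto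
      also have "\<dots> = (?l * t) ^ (CARD('d) - 2)" by (simp add: power_mult_distrib)
      also have "\<dots> \<le> real_of_int (max (linf_norm (x - z)) 1) ^ (CARD('d) - 2)"
        using lt l1 t by (intro power_mono) auto
      finally have "green_decay x z \<le> 1 / (?l ^ (CARD('d) - 2) * t)"
        unfolding green_decay_eq[OF d] using l1 t by (intro divide_left_mono) auto
      then have "?C * green_decay x z \<le> ?C * (1 / (?l ^ (CARD('d) - 2) * t))"
        using C by (intro mult_left_mono) auto
      then show ?thesis using green_le_C_green[OF d, of x z] by simp
    qed
    then have "(\<Sum>z\<in>frame J l y'. green x z) \<le> (\<Sum>z\<in>frame J l y'. ?C * (1 / (?l ^ (CARD('d) - 2)) * (1 / t)))"
      by (rule sum_mono)
    also have "\<dots> = 8 * ?l * (?C * (1 / (?l ^ (CARD('d) - 2)) * (1 / t)))"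
      using card_frame[OF J l, of y'] by simp
    also have "\<dots> = c * (1 / t)" unfolding c_def d2 using l1 by simp
    finally show "(\<Sum>z\<in>frame J l y'. green x z) \<le> c * (5 / 6 ^ Suc k)" by (simp add: t_def)
  qed
  also have "\<dots> \<le> 5 / 4 * 1 * c" using c by (intro mult_right_mono mult_left_mono) auto
  finally show ?thesis by (simp add: c_def)
qed

text \<open>From every point of the frame a segment of length \<open>l\<close> runs along it. In
  dimension 3 the Green function decays on it like the inverse distance, and the harmonic sum
  exceeds the logarithm.\<close>

lemma green_frame_ge_ln:
  assumes d: "CARD('d::finite) = 3" and ij: "i \<noteq> j" and l: "1 \<le> l" and x: "(x :: int ^ 'd) \<in> frame {i, j} l y"
  shows "c_green TYPE('d) * ln (real_of_int l) \<le> (\<Sum>z\<in>frame {i, j} l y. green x z)"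
proof -
  have d3: "CARD('d) \<ge> 3" using d by simp
  obtain v where v: "v \<in> plane_shell {i, j} l" "x = y + v" using x by (auto simp: frame_def)
  have v_le: "\<bar>v $ k\<bar> \<le> l" for k using v abs_nth_le_linf[of v k] by (simp add: plane_shell_def)
  obtain k where k: "\<bar>v $ k\<bar> = l" using v linf_norm_attained[of v] by (auto simp: plane_shell_def)
  have "k \<in> {i, j}" using k v l by (auto simp: plane_shell_def plane_def)
  then obtain k' where k': "k' \<in> {i, j}" "k' \<noteq> k" using ij by blast
  \<comment> \<open>The segment points towards the farther end of the side, so that \<open>l\<close>
    steps do not leave the frame.\<close>
  define s :: int where "s = (if v $ k' \<le> 0 then 1 else - 1)"
  define z where "z t = x + axis k' (s * int t)" for t
  have "z t \<in> frame {i, j} l y" if t: "t \<in> {1..nat l}" for t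
  proof -
    let ?v = "v + axis k' (s * int t)"
    have "\<bar>?v $ m\<bar> \<le> l" for m
      using v_le[of m] t l by (auto simp: axis_def s_def)
    moreover have "\<bar>?v $ k\<bar> = l" using k k' by (simp add: axis_def)
    ultimately have "linf_norm ?v = l"
      using abs_nth_le_linf[of ?v k] by (intro antisym) (auto simp: linf_norm_le_iff)
    moreover have "?v \<in> plane {i, j}" using v k' by (auto simp: plane_shell_def plane_def axis_def)
    ultimately have "?v \<in> plane_shell {i, j} l" by (simp add: plane_shell_def)
    then show ?thesis unfolding frame_def z_def v(2) by (rule rev_image_eqI) simp
  qed
  then have sub: "z ` {1..nat l} \<subseteq> frame {i, j} l y" by blast
  have inj: "inj_on z {1..nat l}"
    by (rule inj_onI) (auto simp: z_def axis_eq_axis s_def split: if_splits)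
  have decay: "c_green TYPE('d) * inverse (real t) \<le> green x (z t)" if t: "t \<in> {1..nat l}" for t
  proof -
    have nrm: "linf_norm (x - z t) = int t"
    proof (rule antisym)
      show "linf_norm (x - z t) \<le> int t" by (auto simp: linf_norm_le_iff z_def axis_def s_def)
      show "int t \<le> linf_norm (x - z t)"
        unfolding linf_norm_ge_iff by (intro exI[of _ k']) (auto simp: z_def axis_def s_def)
    qed
    have "green_decay x (z t) = inverse (real t)"
      unfolding green_decay_eq[OF d3] nrm using t d by (simp add: max_def inverse_eq_divide)
    then show ?thesis using c_green_bounds(1)[OF d3, of x "z t"] by simp
  qed
  have "ln (real_of_int l) \<le> ln (real (nat l) + 1)" using l by simp
  also have "\<dots> \<le> harm (nat l)" by (rule ln_le_harm)
  finally have "c_green TYPE('d) * ln (real_of_int l) \<le> c_green TYPE('d) * (\<Sum>t=1..nat l. inverse (real t))"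
    using c_green_bounds(2)[OF d3] by (intro mult_left_mono) (simp_all add: harm_def)
  also have "\<dots> \<le> (\<Sum>t=1..nat l. green x (z t))"
    unfolding sum_distrib_left by (intro sum_mono decay)
  also have "\<dots> = (\<Sum>w\<in>z ` {1..nat l}. green x w)" by (subst sum.reindex[OF inj]) simp
  also have "\<dots> \<le> (\<Sum>w\<in>frame {i, j} l y. green x w)"
    by (intro sum_mono2 sub green_nonneg[OF d3]) auto
  finally show ?thesis .
qed

lemma L0_props:
  assumes d: "CARD('d::finite) \<ge> 3" and c: "0 < c_green TYPE('d)"
  defines "a \<equiv> 48 * (C_green TYPE('d) / c_green TYPE('d)) * C_comb 2"
  shows "1 \<le> L0 TYPE('d)" "CARD('d) = 3 \<Longrightarrow> a \<le> ln (real_of_int (L0 TYPE('d)))"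
    "CARD('d) > 3 \<Longrightarrow> a \<le> real_of_int (L0 TYPE('d)) ^ (CARD('d) - 3)"
proof -
  have a: "0 < a"
    unfolding a_def using c C_green_ge_1[OF d] C_comb_ge_1[of 2] by (intro mult_pos_pos divide_pos_pos) auto
  have L3: "exp a \<le> real_of_int (L0 TYPE('d))" if "CARD('d) = 3"
    using that by (simp add: L0_def a_def Let_def)
  have L4: "a powr (1 / (real CARD('d) - 3)) \<le> real_of_int (L0 TYPE('d))" if "CARD('d) > 3"
    using that by (simp add: L0_def a_def Let_def)
  have "0 < real_of_int (L0 TYPE('d))"
  proof (cases "CARD('d) = 3")
    case True
    then show ?thesis using L3 exp_gt_zero[of a] by linarith
  next
    case False
    then have "0 < a powr (1 / (real CARD('d) - 3))" "CARD('d) > 3" using a d by auto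
    then show ?thesis using L4 by linarith
  qed
  then show "1 \<le> L0 TYPE('d)" by simp
  show "a \<le> ln (real_of_int (L0 TYPE('d)))" if "CARD('d) = 3"
    using L3[OF that] \<open>0 < real_of_int (L0 TYPE('d))\<close> by (simp add: ln_ge_iff)
  show "a \<le> real_of_int (L0 TYPE('d)) ^ (CARD('d) - 3)" if d3: "CARD('d) > 3"
  proof -
    have "a = a powr ((1 / (real CARD('d) - 3)) * real (CARD('d) - 3))"
      using a d3 by (simp add: of_nat_diff)
    also have "\<dots> = (a powr (1 / (real CARD('d) - 3))) ^ (CARD('d) - 3)"
      using a by (simp only: powr_powr[symmetric]) (simp add: powr_realpow)
    also have "\<dots> \<le> real_of_int (L0 TYPE('d)) ^ (CARD('d) - 3)"
      using L4[OF d3] by (intro power_mono) auto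
    finally show ?thesis .
  qed
qed

text \<open>The purpose of \<open>L0\<close>: a lower bound of the same form in all dimensions, from
  the harmonic sum for \<open>d = 3\<close> and from the diagonal term for \<open>d \<ge> 4\<close>.
  The ratio of the other frames to the own one is then at most \<open>10 / (48 * C_comb 2)\<close>,
  whatever \<open>l\<close> is.\<close>

lemma green_own_frame:
  assumes d: "CARD('d::finite) \<ge> 3" and c: "0 < c_green TYPE('d)" and ij: "i \<noteq> j"
  defines "l \<equiv> L0 TYPE('d)"
  assumes x: "(x :: int ^ 'd) \<in> frame {i, j} l y"
  shows "48 * C_green TYPE('d) * C_comb 2 / real_of_int l ^ (CARD('d) - 3) \<le> (\<Sum>z\<in>frame {i, j} l y. green x z)"
proof (cases "CARD('d) = 3")
  case True
  have "48 * C_green TYPE('d) * C_comb 2 = c_green TYPE('d) * (48 * (C_green TYPE('d) / c_green TYPE('d)) * C_comb 2)"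
    using c by simp
  also have "\<dots> \<le> c_green TYPE('d) * ln (real_of_int l)"
    unfolding l_def using c L0_props(2)[OF d c True] by (intro mult_left_mono) auto
  also have "\<dots> \<le> (\<Sum>z\<in>frame {i, j} l y. green x z)"
    using green_frame_ge_ln[OF True ij _ x] L0_props(1)[OF d c] by (simp add: l_def)
  finally show ?thesis using True by simp
next
  case False
  then have d4: "CARD('d) > 3" using d by simp
  have l: "1 \<le> l" unfolding l_def by (rule L0_props(1)[OF d c])
  have "c_green TYPE('d) * (48 * (C_green TYPE('d) / c_green TYPE('d)) * C_comb 2) \<le> c_green TYPE('d) * real_of_int l ^ (CARD('d) - 3)"
    unfolding l_def using c L0_props(3)[OF d c d4] by (intro mult_left_mono) auto
  then have "48 * C_green TYPE('d) * C_comb 2 / real_of_int l ^ (CARD('d) - 3) \<le> c_green TYPE('d)"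
    using c l by (simp add: divide_le_eq)
  also have "\<dots> \<le> green x x" using c_green_bounds(1)[OF d, of x x] by simp
  also have "\<dots> \<le> (\<Sum>z\<in>frame {i, j} l y. green x z)"
    using x by (intro member_le_sum green_nonneg[OF d]) auto
  finally show ?thesis .
qed

lemma capacity_le_card:
  assumes d: "CARD('d::finite) \<ge> 3" and c: "0 < c_green TYPE('d)"
  shows "capacity (K :: (int ^ 'd) set) \<le> real (card K) / c_green TYPE('d)"
proof -
  have "capacity K \<le> (\<Sum>x\<in>K. 1 / c_green TYPE('d))"
    unfolding capacity_def
  proof (rule sum_mono)
    fix x assume "x \<in> K"
    then have "equilibrium K x \<le> 1 / green x x" by (rule equilibrium_le_inverse_green[OF d])
    also have "\<dots> \<le> 1 / c_green TYPE('d)"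
      using c_green_bounds(1)[OF d, of x x] c one_le_green_diag[OF d, of x] by (intro divide_left_mono) auto
    finally show "equilibrium K x \<le> 1 / c_green TYPE('d)" .
  qed
  then show ?thesis by simp
qed

lemma frames_hit_prob:
  assumes d: "CARD('d::finite) \<ge> 3" and c: "0 < c_green TYPE('d)" and ij: "i \<noteq> j"
  defines "l \<equiv> L0 TYPE('d)"
  assumes u: "0 \<le> u" "u \<le> c_green TYPE('d) / real_of_int l * (1 / C_comb 2) / 256"
    and A: "A \<in> leaf_sets {i, j} l n (x :: int ^ 'd)"
  shows "measure (interlacement_law u) {I. \<forall>y\<in>A. I \<inter> frame {i, j} l y \<noteq> {}} \<le> (exp (1 / 8) / (2 * C_comb 2)) ^ (2 ^ n)"
proof -
  let ?S = "frame {i, j} l" and ?C = "C_green TYPE('d)" and ?c = "c_green TYPE('d)"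
  \<comment> \<open>The base must beat the tree count, which is at most \<open>C_comb 2\<close> per
    leaf; the factor 2 is the surplus.\<close>
  define a where "a = 2 * C_comb 2"
  define F where "F = (\<Union>y\<in>A. ?S y)"
  define G where "G = 48 * ?C * C_comb 2 / real_of_int l ^ (CARD('d) - 3)"
  define q where "q = 10 / (48 * C_comb 2)"
  have C2: "1 \<le> C_comb 2" by (rule C_comb_ge_1) simp
  have C: "1 \<le> ?C" by (rule C_green_ge_1[OF d])
  have l: "1 \<le> l" unfolding l_def by (rule L0_props(1)[OF d c])
  have J: "card {i, j} = 2" using ij by simp
  have finA: "finite A" and cardA: "card A = 2 ^ n" using leaf_sets_card[OF l A] by auto
  have finF: "finite F" using finA by (simp add: F_def)
  have G: "0 < G" unfolding G_def using C C2 l by (intro divide_pos_pos) auto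
  have a1: "1 \<le> a" using C2 by (simp add: a_def)
  have aq: "(2 * a - 1) * q \<le> 1" using C2 by (simp add: a_def q_def field_simps)
  have qG: "10 * ?C / real_of_int l ^ (CARD('d) - 3) = q * G"
    using C2 by (simp add: q_def G_def)
  have moment: "(\<Sum>T\<in>Pow F. trace_weight F T * a ^ card {y \<in> A. T \<inter> ?S y \<noteq> {}}) \<le> 2 * a * capacity F"
    unfolding F_def
  proof (rule exp_moment_trace[OF d finA _ _ G _ _ a1 aq])
    show "?S y \<inter> ?S y' = {}" if "y \<in> A" "y' \<in> A" "y \<noteq> y'" for y y'
      by (rule frames_disjoint[OF l A that])
    show "G \<le> (\<Sum>z\<in>?S y. green x z)" if "x \<in> ?S y" for x y
      using green_own_frame[OF d c ij, of x y] that by (simp add: G_def l_def)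
    show "(\<Sum>y'\<in>A - {y}. \<Sum>z\<in>?S y'. green x z) \<le> q * G" if "y \<in> A" "x \<in> ?S y" for x y
      using green_other_frames[OF d J l A that] by (simp only: qG)
  qed simp
  \<comment> \<open>Each leaf has a frame of \<open>8 * l\<close> points of equilibrium mass at most
    \<open>1 / ?c\<close>. With the 256 in the bound on \<open>u\<close> this leaves
    \<open>8 / 256 = 1 / 32\<close>, chosen so that multiplication by \<open>2 * a\<close> gives 1/8
    per leaf.\<close>
  have cap: "u * capacity F \<le> 2 ^ n / (32 * C_comb 2)"
  proof -
    have "real (card F) \<le> (\<Sum>y\<in>A. real (card (?S y)))"
      unfolding F_def using card_UN_le[OF finA, of ?S] by (simp flip: of_nat_sum)
    also have "\<dots> = 2 ^ n * (8 * real_of_int l)"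
      using card_frame[OF J l] cardA by simp
    finally have "capacity F \<le> 2 ^ n * (8 * real_of_int l) / ?c"
      using capacity_le_card[OF d c, of F] c by (meson divide_right_mono less_imp_le order_trans)
    then have "u * capacity F \<le> u * (2 ^ n * (8 * real_of_int l) / ?c)"
      using u by (intro mult_left_mono) auto
    also have "\<dots> \<le> (?c / real_of_int l * (1 / C_comb 2) / 256) * (2 ^ n * (8 * real_of_int l) / ?c)"
      using u c l by (intro mult_right_mono) auto
    also have "\<dots> = 2 ^ n / (32 * C_comb 2)" using c l C2 by (simp add: field_simps)
    finally show ?thesis .
  qed
  have "measure (interlacement_law u) {I. \<forall>y\<in>A. I \<inter> ?S y \<noteq> {}}
      = measure (interlacement_law u) {I. \<forall>y\<in>A. (I \<inter> F) \<inter> ?S y \<noteq> {}}"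
    by (rule arg_cong[of _ _ "measure _"]) (auto simp: F_def)
  also have "\<dots> = measure_pmf.prob (local_law u F) {I. \<forall>y\<in>A. I \<inter> ?S y \<noteq> {}}"
    by (rule interlacement_local[OF d u(1) finF])
  finally have "measure (interlacement_law u) {I. \<forall>y\<in>A. I \<inter> ?S y \<noteq> {}} * a ^ (2 ^ n)
      \<le> exp (u * (\<Sum>T\<in>Pow F. trace_weight F T * a ^ card {y \<in> A. T \<inter> ?S y \<noteq> {}}))"
    using local_law_hits_all[OF u(1) a1 finA finF, of ?S] by (simp add: cardA)
  also have "\<dots> \<le> exp (u * (2 * a * capacity F))"
    using u moment by (simp add: mult_left_mono)
  also have "\<dots> \<le> exp (2 ^ n * (1 / 8))"
  proof -
    have "u * (2 * a * capacity F) = 2 * a * (u * capacity F)" by simp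
    also have "\<dots> \<le> 2 * a * (2 ^ n / (32 * C_comb 2))" using cap a1 by (intro mult_left_mono) auto
    also have "\<dots> = 2 ^ n * (1 / 8)" using C2 by (simp add: a_def)
    finally show ?thesis by simp
  qed
  also have "\<dots> = exp (1 / 8) ^ (2 ^ n)" by (simp flip: exp_of_nat_mult)
  finally have "measure (interlacement_law u) {I. \<forall>y\<in>A. I \<inter> ?S y \<noteq> {}} \<le> exp (1 / 8) ^ (2 ^ n) / a ^ (2 ^ n)"
    using a1 by (simp add: le_divide_eq)
  then show ?thesis by (simp add: a_def power_divide)
qed

section \<open>Crossing events, the union bound over trees and scales\<close>

definition crossing_event :: "'d::finite set \<Rightarrow> int \<Rightarrow> nat \<Rightarrow> int ^ 'd \<Rightarrow> (int ^ 'd) set set" where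
  "crossing_event J l n x = (\<Union>A\<in>leaf_sets J l n x. {I. \<forall>y\<in>A. I \<inter> frame J l y \<noteq> {}})"

lemma frames_hit_measurable:
  assumes "1 \<le> l" "A \<in> leaf_sets J l n x"
  shows "{I. \<forall>y\<in>A. I \<inter> frame J l y \<noteq> {}} \<in> sets config_space"
proof -
  have "finite A" using leaf_sets_card[OF assms] by simp
  then have "{I \<in> space config_space. \<forall>y\<in>A. \<exists>z\<in>frame J l y. z \<in> I} \<in> sets config_space"
    by measurable
  also have "{I \<in> space config_space. \<forall>y\<in>A. \<exists>z\<in>frame J l y. z \<in> I} = {I. \<forall>y\<in>A. I \<inter> frame J l y \<noteq> {}}"
    by auto
  finally show ?thesis .
qed

lemma crossing_event_measurable:
  assumes "1 \<le> l"
  shows "crossing_event J l n x \<in> sets config_space"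
  unfolding crossing_event_def
  using frames_hit_measurable[OF assms] card_leaf_sets[of J l n x] by (intro sets.finite_UN) auto

lemma crossing_event_prob:
  assumes d: "CARD('d::finite) \<ge> 3" and c: "0 < c_green TYPE('d)" and ij: "i \<noteq> j"
  defines "l \<equiv> L0 TYPE('d)"
  assumes u: "0 \<le> u" "u \<le> c_green TYPE('d) / real_of_int l * (1 / C_comb 2) / 256"
  shows "measure (interlacement_law u) (crossing_event {i, j} l n (x :: int ^ 'd)) \<le> (exp (1 / 8) / 2) ^ (2 ^ n)"
proof -
  let ?L = "leaf_sets {i, j} l n x"
  have C2: "1 \<le> C_comb 2" by (rule C_comb_ge_1) simp
  have l: "1 \<le> l" unfolding l_def by (rule L0_props(1)[OF d c])
  interpret Q: prob_space "interlacement_law u :: (int ^ 'd) set measure" by (rule interlacement_law_props(1)[OF d u(1)])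
  have J: "card {i, j} = 2" using ij by simp
  have fin: "finite ?L" using card_leaf_sets by blast
  have "measure (interlacement_law u) (crossing_event {i, j} l n x)
      \<le> (\<Sum>A\<in>?L. measure (interlacement_law u) {I. \<forall>y\<in>A. I \<inter> frame {i, j} l y \<noteq> {}})"
    unfolding crossing_event_def
    using frames_hit_measurable[OF l, of _ "{i, j}" n x] interlacement_law_props(2)[OF d u(1)]
    by (intro Q.finite_measure_subadditive_finite fin) auto
  also have "\<dots> \<le> (\<Sum>A\<in>?L. (exp (1 / 8) / (2 * C_comb 2)) ^ (2 ^ n))"
    using frames_hit_prob[OF d c ij u(1)] u(2) by (intro sum_mono) (auto simp: l_def)
  also have "\<dots> = real (card ?L) * (exp (1 / 8) / (2 * C_comb 2)) ^ (2 ^ n)" by simp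
  also have "\<dots> \<le> C_comb 2 ^ (2 ^ n) * (exp (1 / 8) / (2 * C_comb 2)) ^ (2 ^ n)"
  proof (rule mult_right_mono)
    have "real (card ?L) \<le> real ((card (plane_shell {i, j} 6) * card (plane_shell {i, j} 12)) ^ (2 ^ n - 1))"
      using card_leaf_sets[of "{i, j}" l n x] by (simp only: of_nat_le_iff)
    also have "\<dots> = C_comb 2 ^ (2 ^ n - 1)" by (simp only: of_nat_power card_shells_C_comb J)
    also have "\<dots> \<le> C_comb 2 ^ (2 ^ n)" using C2 by (intro power_increasing) auto
    finally show "real (card ?L) \<le> C_comb 2 ^ (2 ^ n)" .
  qed (use C2 in simp)
  also have "\<dots> = (C_comb 2 * (exp (1 / 8) / (2 * C_comb 2))) ^ (2 ^ n)" by (simp only: power_mult_distrib)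
  also have "C_comb 2 * (exp (1 / 8) / (2 * C_comb 2)) = exp (1 / 8) / 2" using C2 by simp
  finally show ?thesis .
qed

lemma scale_exists:
  fixes L m :: int
  assumes "1 \<le> L" "2 * L \<le> m"
  obtains n where "2 * (L * 6 ^ n) \<le> m" "m < 12 * (L * 6 ^ n)"
proof -
  obtain N where N: "m < 6 ^ N" using six_power_gt[of m] by blast
  define P where "P n \<longleftrightarrow> m < 12 * (L * 6 ^ n)" for n
  have "1 * 6 ^ N \<le> 12 * L * 6 ^ N" using assms by (intro mult_right_mono) auto
  then have ex: "P N" unfolding P_def using N by linarith
  define n where "n = (LEAST n. P n)"
  have Pn: "P n" unfolding n_def using ex by (rule LeastI)
  have "2 * (L * 6 ^ n) \<le> m"
  proof (cases n)
    case 0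
    then show ?thesis using assms by simp
  next
    case (Suc k)
    then have "\<not> P k" using not_less_Least[of k P] by (simp add: n_def)
    then show ?thesis using Suc by (simp add: P_def)
  qed
  with Pn show ?thesis using that by (simp add: P_def)
qed

text \<open>The dual set meets the positive axis at some \<open>m\<close>, which lies between
  \<open>2 * L\<close> and \<open>12 * L\<close> for some scale \<open>L\<close>. The multiple
  \<open>k * L\<close> just below \<open>m\<close> is within \<open>L - 1\<close> of it, and since
  \<open>k \<ge> 2\<close> the point on the negative axis is at least \<open>2 * L\<close> away. Ten
  roots per scale therefore suffice.\<close>

lemma no_infinite_component_crossing:
  fixes I :: "(int ^ 'd::finite) set"
  assumes ij: "i \<noteq> j" and l: "1 \<le> l" and no_inf: "\<not> has_infinite_component (- I)"
  shows "\<exists>n. \<exists>k\<in>{2..11}. I \<in> crossing_event {i, j} l (n0 + n) (axis i (k * (l * 6 ^ (n0 + n))))"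
proof -
  obtain S m m' where S: "star_connected S" "S \<subseteq> I \<inter> plane {i, j}" and m: "2 * (l * 6 ^ n0) < m" "0 < m'"
    and ax: "axis i m \<in> S" "axis i (- m') \<in> S"
    using plane_duality[OF ij no_inf] by blast
  have l0: "1 \<le> l * 6 ^ n0" using l by (simp add: int_one_le_iff_zero_less)
  obtain n where n: "2 * (l * 6 ^ n0 * 6 ^ n) \<le> m" "m < 12 * (l * 6 ^ n0 * 6 ^ n)"
    using scale_exists[OF l0, of m] m by auto
  define L where "L = l * 6 ^ (n0 + n)"
  have L: "1 \<le> L" using l by (simp add: L_def int_one_le_iff_zero_less)
  have mL: "2 * L \<le> m" "m < 12 * L" using n by (simp_all add: L_def power_add mult.assoc)
  define k where "k = m div L"
  have "2 * L div L \<le> m div L" using mL L by (intro zdiv_mono1) auto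
  then have k2: "2 \<le> k" using L by (simp add: k_def)
  have "k < 12"
  proof (rule ccontr)
    assume "\<not> k < 12"
    then have "12 * L \<le> k * L" using L by (intro mult_right_mono) auto
    also have "k * L \<le> m" 
    proof -
      have "0 \<le> m mod L" using L by (intro pos_mod_sign) simp
      then show ?thesis using div_mult_mod_eq[of m L] unfolding k_def by linarith
    qed
    finally show False using mL by simp
  qed
  with k2 have k: "k \<in> {2..11}" by simp
  let ?x = "axis i (k * L) :: int ^ 'd"
  have ax_norm: "linf_norm (axis i b :: int ^ 'd) = \<bar>b\<bar>" for b
  proof (rule antisym)
    show "linf_norm (axis i b :: int ^ 'd) \<le> \<bar>b\<bar>" by (simp add: linf_norm_le_iff axis_def)
    show "\<bar>b\<bar> \<le> linf_norm (axis i b :: int ^ 'd)" using abs_nth_le_linf[of "axis i b" i] by simp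
  qed
  have ax_diff: "axis i b - axis i c = (axis i (b - c) :: int ^ 'd)" for b c by (simp add: vec_eq_iff axis_def)
  have mod: "m - k * L = m mod L" by (simp add: k_def minus_div_mult_eq_mod)
  have near: "linf_norm (axis i m - ?x) \<le> L - 1"
    unfolding ax_diff ax_norm mod using L pos_mod_bound[of L m] pos_mod_sign[of L m] by simp
  have far: "2 * L \<le> linf_norm (axis i (- m') - ?x)"
  proof -
    have "2 * L \<le> k * L" using k2 L by (intro mult_right_mono) auto
    then show ?thesis unfolding ax_diff ax_norm using m L by linarith
  qed
  have plane: "?x \<in> plane {i, j}" by (simp add: plane_def axis_def)
  obtain A where A: "A \<in> leaf_sets {i, j} l (n0 + n) ?x"
    "\<And>y. y \<in> A \<Longrightarrow> (\<exists>p\<in>S. linf_norm (p - y) \<le> l - 1) \<and> (\<exists>q\<in>S. 2 * l \<le> linf_norm (q - y))"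
    using crossing_leaves[OF l S(1) _ plane ax(1) _ ax(2), of "n0 + n"] S(2) near far unfolding L_def by blast
  have "I \<inter> frame {i, j} l y \<noteq> {}" if y: "y \<in> A" for y
  proof -
    obtain p q where pq: "p \<in> S" "linf_norm (p - y) \<le> l - 1" "q \<in> S" "2 * l \<le> linf_norm (q - y)"
      using A(2)[OF y] by blast
    then obtain z where z: "z \<in> S" "linf_norm (z - y) = l"
      using star_connected_meets_sphere[OF S(1) pq(1) _ pq(3), of y l] l by auto
    have "y \<in> plane {i, j}" using leaf_sets_plane[OF A(1) plane] y by blast
    then have "z \<in> frame {i, j} l y" using z S(2) by (intro frameI) auto
    then show ?thesis using z S(2) by blast
  qed
  then have "I \<in> crossing_event {i, j} l (n0 + n) ?x" unfolding crossing_event_def using A(1) by blast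
  then show ?thesis using k unfolding L_def by blast
qed

text \<open>Only countable quantifiers remain once connection is expressed by a path length and
  infinity by unboundedness of the norm. Measurability is what allows passing to the complementary
  event.\<close>

lemma has_infinite_component_measurable:
  "{I :: (int ^ 'd::finite) set. has_infinite_component (- I)} \<in> sets config_space"
proof -
  define R where "R I a b \<longleftrightarrow> a \<notin> I \<and> b \<notin> I \<and> lattice_adj a b" for I and a b :: "int ^ 'd"
  have R [measurable]: "Measurable.pred config_space (\<lambda>I. R I a b)" for a b
    unfolding R_def by measurable
  have pow [measurable]: "Measurable.pred config_space (\<lambda>I. (R I ^^ n) a b)" for n a b
  proof (induction n arbitrary: b)
    case (Suc n)
    then show ?case unfolding relpowp_Suc_right OO_def by measurable
  qed simp
  have comp: "y \<in> component (- I) x \<longleftrightarrow> (\<exists>n. (R I ^^ n) x y)" for I x y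
  proof -
    have "y \<in> component (- I) x \<longleftrightarrow> (R I)\<^sup>*\<^sup>* x y"
      unfolding component_def R_def[abs_def] by simp
    then show ?thesis by (simp add: rtranclp_power)
  qed
  have inf: "infinite (S :: (int ^ 'd) set) \<longleftrightarrow> (\<forall>r :: int. \<exists>y. y \<in> S \<and> r \<le> linf_norm y)" for S
  proof
    assume "\<forall>r :: int. \<exists>y. y \<in> S \<and> r \<le> linf_norm y"
    then show "infinite S"
    proof (rule contrapos_pn)
      assume fin: "finite S"
      define r where "r = Max (insert 0 (linf_norm ` S)) + 1"
      have "linf_norm y < r" if "y \<in> S" for y
      proof -
        have "linf_norm y \<le> Max (insert 0 (linf_norm ` S))" using fin that by (intro Max_ge) auto
        then show ?thesis by (simp add: r_def)
      qed
      then show "\<not> (\<forall>r. \<exists>y. y \<in> S \<and> r \<le> linf_norm y)" by (meson not_le)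
    qed
  qed (use infinite_unbounded in blast)
  have "{I :: (int ^ 'd) set. has_infinite_component (- I)}
      = {I \<in> space config_space. \<exists>x. x \<notin> I \<and> (\<forall>r :: int. \<exists>y. (\<exists>n. (R I ^^ n) x y) \<and> r \<le> linf_norm y)}"
    unfolding has_infinite_component_def inf comp by auto
  also have "\<dots> \<in> sets config_space" by measurable
  finally show ?thesis .
qed

lemma exp_eighth_half_less_1: "exp (1 / 8 :: real) / 2 < 1"
proof -
  have "exp (1 / 8 :: real) ^ 8 = exp 1" by (simp flip: exp_of_nat_mult)
  also have "\<dots> \<le> 3" by (rule exp_le)
  also have "(3 :: real) < 2 ^ 8" by simp
  finally have "exp (1 / 8 :: real) < 2" by (rule power_less_imp_less_base) simp
  then show ?thesis by simp
qed

lemma infinite_component_below: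
  assumes d: "CARD('d::finite) \<ge> 3" and c: "0 < c_green TYPE('d)"
    and u: "0 \<le> u" "u \<le> c_green TYPE('d) / real_of_int (L0 TYPE('d)) * (1 / C_comb 2) / 256"
  shows "measure (interlacement_law u) {I :: (int ^ 'd) set. has_infinite_component (- I)} \<noteq> 0"
proof
  assume zero: "measure (interlacement_law u) {I :: (int ^ 'd) set. has_infinite_component (- I)} = 0"
  define l where "l = L0 TYPE('d)"
  have l: "1 \<le> l" unfolding l_def by (rule L0_props(1)[OF d c])
  define Q :: "(int ^ 'd) set measure" where "Q = interlacement_law u"
  interpret Q: prob_space Q unfolding Q_def by (rule interlacement_law_props(1)[OF d u(1)])
  have sets_Q: "sets Q = sets config_space" unfolding Q_def by (rule interlacement_law_props(2)[OF d u(1)])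
  have space_Q: "space Q = UNIV" unfolding Q_def by (rule interlacement_law_props(3)[OF d u(1)])
  obtain i j :: 'd where ij: "i \<noteq> j"
  proof -
    have "\<exists>i j :: 'd. i \<noteq> j"
    proof (rule ccontr)
      assume "\<not> (\<exists>i j :: 'd. i \<noteq> j)"
      then have "(UNIV :: 'd set) \<subseteq> {undefined}" by blast
      then have "CARD('d) \<le> card {undefined :: 'd}" by (intro card_mono) auto
      with d show False by simp
    qed
    then show thesis using that by blast
  qed
  define r :: real where "r = exp (1 / 8) / 2"
  have r: "0 < r" "r < 1" using exp_eighth_half_less_1 by (simp_all add: r_def)
  have "(\<lambda>n. 10 * r ^ n / (1 - r)) \<longlonglongrightarrow> 10 * 0 / (1 - r)"
    using r by (intro tendsto_intros LIMSEQ_power_zero) auto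
  then have "\<forall>\<^sub>F n in sequentially. 10 * r ^ n / (1 - r) < 1" by (intro order_tendstoD) auto
  \<comment> \<open>Restricting to scales from \<open>n0\<close> on makes the union bound less than
    1, the 10 being the number of roots per scale. If infinite components had probability zero,
    crossings would occur with probability 1 instead.\<close>
  then obtain n0 where n0: "10 * r ^ n0 / (1 - r) < 1" by (auto simp: eventually_sequentially)
  define E where "E n = (\<Union>k\<in>{2..11}. crossing_event {i, j} l (n0 + n) (axis i (k * (l * 6 ^ (n0 + n)))) :: (int ^ 'd) set set)" for n
  have ev: "crossing_event {i, j} l m x \<in> sets Q" for m x
    unfolding sets_Q by (rule crossing_event_measurable[OF l])
  have E_sets: "E n \<in> sets Q" for n unfolding E_def using ev by (intro sets.finite_UN) auto
  have E_prob: "measure Q (E n) \<le> 10 * r ^ n0 * r ^ n" for n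
  proof -
    have "measure Q (E n) \<le> (\<Sum>k\<in>{2..11}. measure Q (crossing_event {i, j} l (n0 + n) (axis i (k * (l * 6 ^ (n0 + n))))))"
      unfolding E_def using ev by (intro Q.finite_measure_subadditive_finite) auto
    also have "\<dots> \<le> (\<Sum>k\<in>{2..11 :: int}. r ^ (2 ^ (n0 + n)))"
      unfolding Q_def r_def l_def by (intro sum_mono crossing_event_prob[OF d c ij u])
    also have "\<dots> = 10 * r ^ (2 ^ (n0 + n))" by simp
    also have "\<dots> \<le> 10 * r ^ (n0 + n)"
      using r less_exp[of "n0 + n"] by (intro mult_left_mono power_decreasing) auto
    finally show ?thesis by (simp add: power_add)
  qed
  have geo: "(\<lambda>n. 10 * r ^ n0 * r ^ n) sums (10 * r ^ n0 * (1 / (1 - r)))"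
    using r by (intro sums_mult geometric_sums) auto
  have summ: "summable (\<lambda>n. measure Q (E n))"
    by (rule summable_comparison_test'[OF sums_summable[OF geo], of 0]) (use E_prob in auto)
  have "measure Q (\<Union>n. E n) \<le> (\<Sum>n. measure Q (E n))"
    using E_sets summ by (intro Q.finite_measure_subadditive_countably) auto
  also have "\<dots> \<le> (\<Sum>n. 10 * r ^ n0 * r ^ n)"
    by (intro suminf_le E_prob summ sums_summable[OF geo])
  also have "\<dots> = 10 * r ^ n0 / (1 - r)" using sums_unique[OF geo] by simp
  finally have lt: "measure Q (\<Union>n. E n) < 1" using n0 by simp
  define H where "H = {I :: (int ^ 'd) set. has_infinite_component (- I)}"
  have H: "H \<in> sets Q" unfolding H_def sets_Q by (rule has_infinite_component_measurable)
  have "space Q - H \<subseteq> (\<Union>n. E n)"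
  proof
    fix I assume "I \<in> space Q - H"
    then have "\<not> has_infinite_component (- I)" by (simp add: H_def)
    then obtain n k where "k \<in> {2..11}" "I \<in> crossing_event {i, j} l (n0 + n) (axis i (k * (l * 6 ^ (n0 + n))))"
      using no_infinite_component_crossing[OF ij l, of I n0] by blast
    then show "I \<in> (\<Union>n. E n)" unfolding E_def by blast
  qed
  then have "measure Q (space Q - H) \<le> measure Q (\<Union>n. E n)"
    using E_sets by (intro Q.finite_measure_mono) auto
  moreover have "measure Q (space Q - H) = 1"
    using Q.prob_compl[OF H] zero by (simp add: H_def Q_def)
  ultimately show False using lt by simp
qed

theorem theorem1p1:
  assumes "CARD('d::finite) \<ge> 3"
  shows "ereal (c_green TYPE('d) / real_of_int (L0 TYPE('d)) * (1 / C_comb 2)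
             * 2 powi (- (int CARD('d) + 5))) \<le> u_star TYPE('d)
       \<and> u_star TYPE('d) \<le> ereal (5 / 2 * C_green TYPE('d) * ln (C_comb CARD('d)))"
proof (rule conjI)
  note d = assms
  have C2: "1 \<le> C_comb 2" by (rule C_comb_ge_1) simp
  show "ereal (c_green TYPE('d) / real_of_int (L0 TYPE('d)) * (1 / C_comb 2) * 2 powi (- (int CARD('d) + 5)))
      \<le> u_star TYPE('d)"
    unfolding u_star_def
  proof (rule Inf_greatest, clarify)
    fix u :: real
    assume u: "0 < u" and zero: "measure (interlacement_law u) {I :: (int ^ 'd) set. has_infinite_component (- I)} = 0"
    let ?b = "c_green TYPE('d) / real_of_int (L0 TYPE('d)) * (1 / C_comb 2)"
    show "ereal (?b * 2 powi (- (int CARD('d) + 5))) \<le> ereal u"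
    \<comment> \<open>Only \<open>0 \<le> c_green\<close> is available here; if it vanishes, the
      left side is 0 and lies below \<open>u\<close>.\<close>
    proof (cases "c_green TYPE('d) = 0")
      case True
      then show ?thesis using u by simp
    next
      case False
      then have c: "0 < c_green TYPE('d)" using c_green_bounds(2)[OF d] by simp
      have b: "0 \<le> ?b" using c C2 L0_props(1)[OF d c] by (intro mult_nonneg_nonneg divide_nonneg_nonneg) auto
      have "\<not> u \<le> ?b / 256" using infinite_component_below[OF d c, of u] zero u by auto
      \<comment> \<open>The bound is proved at \<open>1/256 = 2 ^ (-8)\<close>, the value of the
        last factor for \<open>d = 3\<close>; for larger \<open>d\<close> that factor is
        smaller.\<close>
      moreover have "?b * 2 powi (- (int CARD('d) + 5)) \<le> ?b / 256"
      proof -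
        have "- (int CARD('d) + 5) = - int (CARD('d) + 5)" by simp
        then have "(2 :: real) powi (- (int CARD('d) + 5)) = 1 / 2 ^ (CARD('d) + 5)"
          by (simp only: power_int_minus power_int_of_nat inverse_eq_divide)
        also have "\<dots> \<le> 1 / 2 ^ 8" using d by (intro divide_left_mono power_increasing) auto
        finally have "(2 :: real) powi (- (int CARD('d) + 5)) \<le> 1 / 256" by simp
        then have "?b * 2 powi (- (int CARD('d) + 5)) \<le> ?b * (1 / 256)" using b by (rule mult_left_mono)
        then show ?thesis by simp
      qed
      ultimately have "?b * 2 powi (- (int CARD('d) + 5)) \<le> u" by linarith
      then show ?thesis by simp
    qed
  qed
  show "u_star TYPE('d) \<le> ereal (5 / 2 * C_green TYPE('d) * ln (C_comb CARD('d)))"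
  \<comment> \<open>Infinite components are excluded strictly above the bound, so the infimum is
    estimated by \<open>?b + e\<close> for every positive \<open>e\<close>.\<close>
  proof (rule ereal_le_epsilon2)
    fix e :: real assume e: "0 < e"
    let ?b = "5 / 2 * C_green TYPE('d) * ln (C_comb CARD('d))"
    have "0 \<le> ?b"
      using C_green_ge_1[OF d] C_comb_ge_1[of "CARD('d)"] d by (intro mult_nonneg_nonneg) auto
    then have "0 < ?b + e" using e by linarith
    moreover have "measure (interlacement_law (?b + e)) {I :: (int ^ 'd) set. has_infinite_component (- I)} = 0"
      by (rule no_infinite_component_above[OF d]) (use e in simp)
    ultimately have "u_star TYPE('d) \<le> ereal (?b + e)"
      unfolding u_star_def by (intro Inf_lower) blast
    then show "u_star TYPE('d) \<le> ereal ?b + ereal e" by simp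
  qed
qed

end
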